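(* Let $E$ be a vector bundle over $M$, with Liouville vector field $\Delta$. Every Jacobi structure $J$ on $E$ which is linear and affine (i.e. such that the linear functions and the affine functions on $E$ are closed with respect to the Jacobi bracket) is of the form $J=(\Lambda+\Gamma\wedge\Delta,\Gamma)$, where $\Lambda$ is a linear Poisson tensor and $\Gamma=\Gamma_0+\Gamma_1$ is an affine vector field with decomposition into homogeneous parts $\Gamma_0,\Gamma_1$ of orders $-1$ and $0$, respectively, such that $$[\Gamma_0,\Lambda]=0,\qquad [\Gamma_1,\Lambda]=\Gamma_0\wedge\Gamma_1 .$$ The vertical vector field $\Gamma_0$ is the vertical lift $\Phi^v$ of a certain section $\Phi$ of $E$ which is closed with respect to the exterior derivative $d_\Lambda$ associated with the Lie algebroid structure on $E^*$ induced by $\Lambda$. If, additionally, the Jacobi bracket of a linear and a basic function is basic (i.e. the Jacobi bracket is homogeneous of degree $-1$), then $\Gamma_1=0$ and $$J=(\Lambda+\Delta\wedge\Phi^v,-\Phi^v)$$ for a section $\Phi$ of $E$ with $d_\Lambda\Phi=0$.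
   Context: All objects are smooth. $[\cdot,\cdot]$ is the Schouten bracket of multivector fields, in the convention making multivector fields a graded Lie algebra: it extends the Lie bracket of vector fields, and with $x=|X|-1$, $y=|Y|-1$ one has $[X,f]=X(f)$ for vector fields $X$ and functions $f$, $[X,Y]=-(-1)^{xy}[Y,X]$, $[X,Y\wedge Z]=[X,Y]\wedge Z+(-1)^{x(y+1)}Y\wedge[X,Z]$. A Jacobi structure on a manifold is a pair $(\Lambda',\Gamma)$ of a bivector field and a vector field with $[\Gamma,\Lambda']=0$ and $[\Lambda',\Lambda']=-2\Gamma\wedge\Lambda'$; its Jacobi bracket is $\{f,g\}=\Lambda'(f,g)+f\Gamma(g)-g\Gamma(f)$, where $\Lambda'(f,g)=\Lambda'(df,dg)$ and $(X\wedge Y)(f,g)=X(f)Y(g)-X(g)Y(f)$. On the total space of a vector bundle $\pi:E\to M$: $\Delta$ is the Liouville (Euler) vector field; linear functions are those linear along fibres, i.e. the functions $\iota_\mu$, $\mu\in\mathrm{Sec}(E^* )$, $\iota_\mu(e)=\langle\mu,e\rangle$; basic functions are pull-backs from $M$; affine functions are sums of a basic and a linear function, graded by giving basic functions degree 0 and linear functions degree 1. A vector field $\Gamma$ is affine if it maps affine functions to affine functions; a vector field is homogeneous of order $k$ if $[\Delta,\Gamma]=k\Gamma$. The vertical lift $\Phi^v$ of a section $\Phi$ of $E$ is the vertical vector field, constant along fibres, with $\Phi^v(\iota_\mu)=\pi^*\langle\mu,\Phi\rangle$. A Poisson tensor $\Lambda$ ($[\Lambda,\Lambda]=0$) on $E$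 is linear if the Poisson bracket of linear functions is linear (then $[\Delta,\Lambda]=-\Lambda$). The induced Lie algebroid structure on $E^*$ has bracket and anchor given by $\iota_{[\mu,\nu]}=\Lambda(\iota_\mu,\iota_\nu)$, $\pi^*(\rho(\mu)f)=\Lambda(\iota_\mu,\pi^*f)$; $d_\Lambda$ is its exterior derivative, acting on $\mathrm{Sec}(\bigwedge E)$.
   Formalization: The vector bundle E is assumed to have positive rank; for rank 0 (E=M, Δ=0) the claim fails, since e.g. a contact Jacobi structure on R^3 is vacuously linear and affine but its bivector field is not Poisson. *)

theory Defs
  imports "HOL-Analysis.Analysis" "HOL-Library.Function_Algebras"
begin

section \<open>Smooth manifolds\<close>

text \<open>
  The model space is \<^const>\<open>Euclidean_space\<close> \<open>n\<close>, whose points are the sequences \<open>x\<close> with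
  \<open>x i = 0\<close> for \<open>i \<ge> n\<close>. The dimension is a natural number, so that dimension 0 is covered.
\<close>

definition partial_deriv :: "nat \<Rightarrow> ((nat \<Rightarrow> real) \<Rightarrow> real) \<Rightarrow> (nat \<Rightarrow> real) \<Rightarrow> real" where
  "partial_deriv i f x = deriv (\<lambda>t. f (x(i := t))) (x i)"

primrec Ck_on :: "nat \<Rightarrow> nat \<Rightarrow> (nat \<Rightarrow> real) set \<Rightarrow> ((nat \<Rightarrow> real) \<Rightarrow> real) \<Rightarrow> bool" where
  "Ck_on 0 n V f \<longleftrightarrow>
     continuous_map (subtopology (Euclidean_space n) V) euclideanreal f"
| "Ck_on (Suc k) n V f \<longleftrightarrow>
     continuous_map (subtopology (Euclidean_space n) V) euclideanreal f \<and>
     (\<forall>i<n. (\<forall>x\<in>V. (\<lambda>t. f (x(i := t))) field_differentiable at (x i)) \<and>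
            Ck_on k n V (partial_deriv i f))"

text \<open>Only used for \<open>V\<close> open in \<^const>\<open>Euclidean_space\<close> \<open>n\<close>.\<close>

definition smooth_on :: "nat \<Rightarrow> (nat \<Rightarrow> real) set \<Rightarrow> ((nat \<Rightarrow> real) \<Rightarrow> real) \<Rightarrow> bool" where
  "smooth_on n V f \<longleftrightarrow> (\<forall>k. Ck_on k n V f)"

type_synonym 'a chart = "'a set \<times> ('a \<Rightarrow> nat \<Rightarrow> real)"

record 'a manifold =
  mdim :: nat
  atlas :: "'a chart set"

definition is_chart :: "nat \<Rightarrow> 'a::topological_space chart \<Rightarrow> bool" where
  "is_chart n c \<longleftrightarrow> (case c of (U, \<phi>) \<Rightarrow>
     open U \<and> openin (Euclidean_space n) (\<phi> ` U) \<and>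
     homeomorphic_map (top_of_set U) (subtopology (Euclidean_space n) (\<phi> ` U)) \<phi>)"

definition smooth_transition :: "nat \<Rightarrow> 'a chart \<Rightarrow> 'a chart \<Rightarrow> bool" where
  "smooth_transition n c d \<longleftrightarrow> (case (c, d) of ((U, \<phi>), (V, \<psi>)) \<Rightarrow>
     \<forall>i<n. smooth_on n (\<phi> ` (U \<inter> V)) (\<lambda>x. \<psi> (inv_into U \<phi> x) i))"

text \<open>
  The underlying set of a manifold is a whole type, whose classes provide the Hausdorff property
  and second countability.
\<close>

definition smooth_manifold ::
  "'a::{t2_space,second_countable_topology} manifold \<Rightarrow> bool" where
  "smooth_manifold M \<longleftrightarrow>
     (\<forall>c\<in>atlas M. is_chart (mdim M) c) \<and>
     (\<Union>c\<in>atlas M. fst c) = UNIV \<and>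
     (\<forall>c\<in>atlas M. \<forall>d\<in>atlas M. smooth_transition (mdim M) c d)"

definition maximal_atlas :: "'a::topological_space manifold \<Rightarrow> 'a chart set" where
  "maximal_atlas M = {c. is_chart (mdim M) c \<and>
     (\<forall>d\<in>atlas M. smooth_transition (mdim M) c d \<and> smooth_transition (mdim M) d c)}"

definition smooth_functions :: "'a manifold \<Rightarrow> ('a \<Rightarrow> real) set" where
  "smooth_functions M =
     {f. \<forall>(U, \<phi>)\<in>atlas M. smooth_on (mdim M) (\<phi> ` U) (\<lambda>x. f (inv_into U \<phi> x))}"

definition smooth_map ::
  "'a::topological_space manifold \<Rightarrow> 'b::topological_space manifold \<Rightarrow> ('a \<Rightarrow> 'b) \<Rightarrow> bool" where
  "smooth_map M N F \<longleftrightarrow> continuous_on UNIV F \<and>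
     (\<forall>(U, \<phi>)\<in>atlas M. \<forall>(V, \<psi>)\<in>atlas N. \<forall>i<mdim N.
        smooth_on (mdim M) (\<phi> ` (U \<inter> F -` V)) (\<lambda>x. \<psi> (F (inv_into U \<phi> x)) i))"

section \<open>Multivector fields and the Schouten bracket\<close>

text \<open>
  A \<open>k\<close>-vector field is given by its values \<open>A(f\<^sub>1, \<dots>, f\<^sub>k) = A(df\<^sub>1, \<dots>, df\<^sub>k)\<close>, that is, as an
  alternating \<open>k\<close>-derivation of the algebra of smooth functions. It is extended by \<open>0\<close> to all other
  argument lists, so that equality of multivector fields is equality of functions.
\<close>

type_synonym 'a multivector = "('a \<Rightarrow> real) list \<Rightarrow> 'a \<Rightarrow> real"

definition multivector_field :: "'a manifold \<Rightarrow> nat \<Rightarrow> 'a multivector \<Rightarrow> bool" where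
  "multivector_field M k A \<longleftrightarrow>
     (\<forall>fs. \<not> (length fs = k \<and> set fs \<subseteq> smooth_functions M) \<longrightarrow> A fs = 0) \<and>
     (\<forall>fs. length fs = k \<and> set fs \<subseteq> smooth_functions M \<longrightarrow>
        A fs \<in> smooth_functions M \<and>
        (\<forall>i<k. \<forall>j<i. fs ! i = fs ! j \<longrightarrow> A fs = 0) \<and>
        (\<forall>i<k. \<forall>f\<in>smooth_functions M. \<forall>g\<in>smooth_functions M. \<forall>c::real.
           A (fs[i := f + g]) = A (fs[i := f]) + A (fs[i := g]) \<and>
           A (fs[i := (\<lambda>p. c * f p)]) = (\<lambda>p. c * A (fs[i := f]) p) \<and>
           A (fs[i := f * g]) = f * A (fs[i := g]) + g * A (fs[i := f])))"

abbreviation vector_field :: "'a manifold \<Rightarrow> 'a multivector \<Rightarrow> bool" where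
  "vector_field M \<equiv> multivector_field M 1"

abbreviation bivector_field :: "'a manifold \<Rightarrow> 'a multivector \<Rightarrow> bool" where
  "bivector_field M \<equiv> multivector_field M 2"

text \<open>
  A subset \<open>S\<close> of \<open>{..<m}\<close> encodes the shuffle that lists \<open>S\<close> increasingly, followed by its
  complement listed increasingly; its sign counts the inversions.
\<close>

definition shuffle_sign :: "nat \<Rightarrow> nat set \<Rightarrow> real" where
  "shuffle_sign m S = (-1) ^ card {(i, j). i \<in> S \<and> j < i \<and> j \<in> {..<m} - S}"

definition shuffles_of :: "nat \<Rightarrow> nat \<Rightarrow> nat set set" where
  "shuffles_of k m = {S. S \<subseteq> {..<m} \<and> card S = k}"

definition wedge :: "nat \<Rightarrow> 'a multivector \<Rightarrow> 'a multivector \<Rightarrow> 'a multivector" where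
  "wedge k A B fs = (\<lambda>p. \<Sum>S\<in>shuffles_of k (length fs).
     shuffle_sign (length fs) S * A (nths fs S) p * B (nths fs (- S)) p)"

text \<open>\<open>k\<close> is the degree of the inserted field \<open>B\<close>.\<close>

definition insertion :: "nat \<Rightarrow> 'a multivector \<Rightarrow> 'a multivector \<Rightarrow> 'a multivector" where
  "insertion k A B fs = (\<lambda>p. \<Sum>S\<in>shuffles_of k (length fs).
     shuffle_sign (length fs) S * A (B (nths fs S) # nths fs (- S)) p)"

text \<open>
  The Schouten bracket of fields \<open>A\<close>, \<open>B\<close> of degrees \<open>a\<close>, \<open>b\<close>. Writing \<open>x = a - 1\<close> and
  \<open>y = b - 1\<close>, the sign \<open>(-1)^(x * y)\<close> is chosen such that \<open>[X, f] = X(f)\<close>,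
  \<open>[A, B] = - (-1)^(x * y) [B, A]\<close> and
  \<open>[A, B \<and> C] = [A, B] \<and> C + (-1)^(x * (y + 1)) B \<and> [A, C]\<close>. In the code the exponent is
  \<open>(a + 1) * (b + 1)\<close>, of the same parity, since subtraction truncates on \<^typ>\<open>nat\<close>.
\<close>

definition schouten ::
  "nat \<Rightarrow> nat \<Rightarrow> 'a multivector \<Rightarrow> 'a multivector \<Rightarrow> 'a multivector" where
  "schouten a b A B fs =
     (\<lambda>p. (-1) ^ ((a + 1) * (b + 1)) * insertion b A B fs p - insertion a B A fs p)"

section \<open>Jacobi structures\<close>

definition jacobi_structure :: "'a manifold \<Rightarrow> 'a multivector \<times> 'a multivector \<Rightarrow> bool" where
  "jacobi_structure M J \<longleftrightarrow> (case J of (\<Lambda>, \<Gamma>) \<Rightarrow>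
     bivector_field M \<Lambda> \<and> vector_field M \<Gamma> \<and>
     schouten 1 2 \<Gamma> \<Lambda> = 0 \<and>
     schouten 2 2 \<Lambda> \<Lambda> = (\<lambda>fs p. -2 * wedge 1 \<Gamma> \<Lambda> fs p))"

definition jacobi_bracket ::
  "'a multivector \<times> 'a multivector \<Rightarrow> ('a \<Rightarrow> real) \<Rightarrow> ('a \<Rightarrow> real) \<Rightarrow> 'a \<Rightarrow> real" where
  "jacobi_bracket J f g = (case J of (\<Lambda>, \<Gamma>) \<Rightarrow> \<Lambda> [f, g] + f * \<Gamma> [g] - g * \<Gamma> [f])"

definition poisson_tensor :: "'a manifold \<Rightarrow> 'a multivector \<Rightarrow> bool" where
  "poisson_tensor M \<Lambda> \<longleftrightarrow> bivector_field M \<Lambda> \<and> schouten 2 2 \<Lambda> \<Lambda> = 0"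

section \<open>Vector bundles\<close>

record ('m, 'e) vbundle =
  base :: "'m manifold"
  total :: "'e manifold"
  rank :: nat
  proj :: "'e \<Rightarrow> 'm"
  vadd :: "'e \<Rightarrow> 'e \<Rightarrow> 'e"
  smul :: "real \<Rightarrow> 'e \<Rightarrow> 'e"

definition fibre :: "('m, 'e) vbundle \<Rightarrow> 'm \<Rightarrow> 'e set" where
  "fibre E x = {e. proj E e = x}"

definition fibre_linear :: "('m, 'e) vbundle \<Rightarrow> 'm \<Rightarrow> ('e \<Rightarrow> real) \<Rightarrow> bool" where
  "fibre_linear E x h \<longleftrightarrow>
     (\<forall>e\<in>fibre E x. \<forall>e'\<in>fibre E x. h (vadd E e e') = h e + h e') \<and>
     (\<forall>e\<in>fibre E x. \<forall>c. h (smul E c e) = c * h e)"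

definition local_trivialization ::
  "('m::topological_space, 'e::topological_space) vbundle \<Rightarrow> 'm chart \<Rightarrow> ('e \<Rightarrow> nat \<Rightarrow> real) \<Rightarrow> bool"
where
  "local_trivialization E c \<tau> \<longleftrightarrow> (case c of (U, \<phi>) \<Rightarrow>
     (U, \<phi>) \<in> maximal_atlas (base E) \<and>
     (proj E -` U, \<lambda>e i. if i < mdim (base E) then \<phi> (proj E e) i else \<tau> e (i - mdim (base E)))
       \<in> maximal_atlas (total E) \<and>
     (\<forall>x\<in>U. bij_betw \<tau> (fibre E x) (topspace (Euclidean_space (rank E))) \<and>
             (\<forall>i. fibre_linear E x (\<lambda>e. \<tau> e i))))"

text \<open>
  The vector space axioms for the fibres need not be listed: each fibre is closed under the
  operations, and a local trivialization maps it bijectively onto the model space, compatibly with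
  the operations.
\<close>

definition vector_bundle ::
  "('m::{t2_space,second_countable_topology}, 'e::{t2_space,second_countable_topology}) vbundle \<Rightarrow> bool"
where
  "vector_bundle E \<longleftrightarrow>
     smooth_manifold (base E) \<and> smooth_manifold (total E) \<and>
     mdim (total E) = mdim (base E) + rank E \<and>
     (\<forall>x. \<forall>e\<in>fibre E x. (\<forall>e'\<in>fibre E x. vadd E e e' \<in> fibre E x) \<and>
                          (\<forall>c. smul E c e \<in> fibre E x)) \<and>
     (\<forall>x. \<exists>c \<tau>. x \<in> fst c \<and> local_trivialization E c \<tau>)"

definition sections ::
  "('m::topological_space, 'e::topological_space) vbundle \<Rightarrow> ('m \<Rightarrow> 'e) set" where
  "sections E = {\<Phi>. smooth_map (base E) (total E) \<Phi> \<and> (\<forall>x. \<Phi> x \<in> fibre E x)}"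

text \<open>
  A section \<open>\<mu>\<close> of the dual bundle assigns to \<open>x\<close> a linear form on the fibre over \<open>x\<close>, extended by \<open>0\<close>
  to the other fibres; its smoothness is the smoothness of the function \<open>\<iota>\<^sub>\<mu>\<close>.
\<close>

definition iota :: "('m, 'e) vbundle \<Rightarrow> ('m \<Rightarrow> 'e \<Rightarrow> real) \<Rightarrow> 'e \<Rightarrow> real" where
  "iota E \<mu> e = \<mu> (proj E e) e"

definition dual_sections :: "('m, 'e) vbundle \<Rightarrow> ('m \<Rightarrow> 'e \<Rightarrow> real) set" where
  "dual_sections E = {\<mu>. (\<forall>x. fibre_linear E x (\<mu> x) \<and> (\<forall>e. e \<notin> fibre E x \<longrightarrow> \<mu> x e = 0)) \<and>
                         iota E \<mu> \<in> smooth_functions (total E)}"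

definition pairing :: "('m \<Rightarrow> 'e \<Rightarrow> real) \<Rightarrow> ('m \<Rightarrow> 'e) \<Rightarrow> 'm \<Rightarrow> real" where
  "pairing \<mu> \<Phi> x = \<mu> x (\<Phi> x)"

definition linear_functions :: "('m, 'e) vbundle \<Rightarrow> ('e \<Rightarrow> real) set" where
  "linear_functions E = iota E ` dual_sections E"

definition basic_functions :: "('m, 'e) vbundle \<Rightarrow> ('e \<Rightarrow> real) set" where
  "basic_functions E = (\<lambda>g. g \<circ> proj E) ` smooth_functions (base E)"

definition affine_functions :: "('m, 'e) vbundle \<Rightarrow> ('e \<Rightarrow> real) set" where
  "affine_functions E = {f + g | f g. f \<in> basic_functions E \<and> g \<in> linear_functions E}"

definition vector_field_by ::
  "'a manifold \<Rightarrow> (('a \<Rightarrow> real) \<Rightarrow> 'a \<Rightarrow> real) \<Rightarrow> 'a multivector" where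
  "vector_field_by M D fs = (if length fs = 1 \<and> hd fs \<in> smooth_functions M then D (hd fs) else 0)"

definition liouville :: "('m, 'e) vbundle \<Rightarrow> 'e multivector" where
  "liouville E = vector_field_by (total E) (\<lambda>f e. deriv (\<lambda>t. f (smul E t e)) 1)"

definition vertical_lift :: "('m, 'e) vbundle \<Rightarrow> ('m \<Rightarrow> 'e) \<Rightarrow> 'e multivector" where
  "vertical_lift E \<Phi> = vector_field_by (total E)
     (\<lambda>f e. deriv (\<lambda>t. f (vadd E e (smul E t (\<Phi> (proj E e))))) 0)"

definition affine_vector_field :: "('m, 'e) vbundle \<Rightarrow> 'e multivector \<Rightarrow> bool" where
  "affine_vector_field E X \<longleftrightarrow> vector_field (total E) X \<and>
     (\<forall>f\<in>affine_functions E. X [f] \<in> affine_functions E)"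

definition homogeneous_vector_field ::
  "('m, 'e) vbundle \<Rightarrow> real \<Rightarrow> 'e multivector \<Rightarrow> bool" where
  "homogeneous_vector_field E k X \<longleftrightarrow> vector_field (total E) X \<and>
     schouten 1 1 (liouville E) X = (\<lambda>fs p. k * X fs p)"

definition linear_poisson_tensor :: "('m, 'e) vbundle \<Rightarrow> 'e multivector \<Rightarrow> bool" where
  "linear_poisson_tensor E \<Lambda> \<longleftrightarrow> poisson_tensor (total E) \<Lambda> \<and>
     (\<forall>f\<in>linear_functions E. \<forall>g\<in>linear_functions E. \<Lambda> [f, g] \<in> linear_functions E)"

section \<open>The Lie algebroid structure on the dual bundle\<close>

definition dual_bracket :: "('m, 'e) vbundle \<Rightarrow> 'e multivector \<Rightarrow>
    ('m \<Rightarrow> 'e \<Rightarrow> real) \<Rightarrow> ('m \<Rightarrow> 'e \<Rightarrow> real) \<Rightarrow> 'm \<Rightarrow> 'e \<Rightarrow> real" where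
  "dual_bracket E \<Lambda> \<mu> \<nu> =
     (THE \<kappa>. \<kappa> \<in> dual_sections E \<and> iota E \<kappa> = \<Lambda> [iota E \<mu>, iota E \<nu>])"

definition dual_anchor :: "('m, 'e) vbundle \<Rightarrow> 'e multivector \<Rightarrow>
    ('m \<Rightarrow> 'e \<Rightarrow> real) \<Rightarrow> ('m \<Rightarrow> real) \<Rightarrow> 'm \<Rightarrow> real" where
  "dual_anchor E \<Lambda> \<mu> f = (THE g. g \<circ> proj E = \<Lambda> [iota E \<mu>, f \<circ> proj E])"

text \<open>
  A section of the \<open>k\<close>-th exterior power of the bundle is viewed as an alternating form \<open>\<omega>\<close> on
  sections of the dual bundle.
\<close>

definition lie_algebroid_d :: "('m, 'e) vbundle \<Rightarrow> 'e multivector \<Rightarrow>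
    (('m \<Rightarrow> 'e \<Rightarrow> real) list \<Rightarrow> 'm \<Rightarrow> real) \<Rightarrow> ('m \<Rightarrow> 'e \<Rightarrow> real) list \<Rightarrow> 'm \<Rightarrow> real" where
  "lie_algebroid_d E \<Lambda> \<omega> \<mu>s = (\<lambda>x.
     (\<Sum>i<length \<mu>s. (-1) ^ i * dual_anchor E \<Lambda> (\<mu>s ! i) (\<omega> (nths \<mu>s (- {i}))) x) +
     (\<Sum>j<length \<mu>s. \<Sum>i<j. (-1) ^ (i + j) *
        \<omega> (dual_bracket E \<Lambda> (\<mu>s ! i) (\<mu>s ! j) # nths \<mu>s (- {i, j})) x))"

definition closed_section ::
  "('m::topological_space, 'e::topological_space) vbundle \<Rightarrow> 'e multivector \<Rightarrow> ('m \<Rightarrow> 'e) \<Rightarrow> bool"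
where
  "closed_section E \<Lambda> \<Phi> \<longleftrightarrow> \<Phi> \<in> sections E \<and>
     (\<forall>\<mu>\<in>dual_sections E. \<forall>\<nu>\<in>dual_sections E.
        lie_algebroid_d E \<Lambda> (\<lambda>\<mu>s. pairing (hd \<mu>s) \<Phi>) [\<mu>, \<nu>] = 0)"

section \<open>Consistency checks\<close>

text \<open>
  Evaluations of the general formulas in low degree, and the defining properties of linear
  functions, the Liouville field and vertical lifts.
\<close>

lemma shuffles_of_eq:
  "shuffles_of 0 0 = {{}}" "shuffles_of (Suc 0) 0 = {}"
  "shuffles_of (Suc 0) (Suc 0) = {{0}}" "shuffles_of (Suc 0) 2 = {{0}, {1}}"
  "shuffles_of 2 2 = {{0, 1}}" "shuffles_of (Suc 0) 3 = {{0}, {1}, {2}}"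
  "shuffles_of 2 3 = {{0, 1}, {0, 2}, {1, 2}}"
proof -
  have P: "shuffles_of k m = {S \<in> Pow {..<m}. card S = k}" for k m
    by (auto simp: shuffles_of_def)
  have [simp]: "{..<Suc 0} = {0}" "{..<2::nat} = {0, 1}" "{..<3::nat} = {0, 1, 2}"
    by auto
  show "shuffles_of 0 0 = {{}}" "shuffles_of (Suc 0) 0 = {}"
    "shuffles_of (Suc 0) (Suc 0) = {{0}}" "shuffles_of (Suc 0) 2 = {{0}, {1}}"
    "shuffles_of 2 2 = {{0, 1}}" "shuffles_of (Suc 0) 3 = {{0}, {1}, {2}}"
    "shuffles_of 2 3 = {{0, 1}, {0, 2}, {1, 2}}"
    unfolding P by (auto simp: Pow_insert)
qed

lemma shuffle_sign_eq:
  "shuffle_sign 0 {} = 1" "shuffle_sign (Suc 0) {0} = 1"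
  "shuffle_sign 2 {0} = 1" "shuffle_sign 2 {Suc 0} = -1" "shuffle_sign 2 {0, Suc 0} = 1"
  "shuffle_sign 3 {0} = 1" "shuffle_sign 3 {Suc 0} = -1" "shuffle_sign 3 {2} = 1"
  "shuffle_sign 3 {0, Suc 0} = 1" "shuffle_sign 3 {0, 2} = -1" "shuffle_sign 3 {Suc 0, 2} = 1"
proof -
  let ?I = "\<lambda>m S. {(i, j). i \<in> S \<and> j < i \<and> j \<in> {..<m} - S} :: (nat \<times> nat) set"
  have I: "?I 0 {} = {}" "?I (Suc 0) {0} = {}"
    "?I 2 {0} = {}" "?I 2 {Suc 0} = {(1, 0)}" "?I 2 {0, Suc 0} = {}"
    "?I 3 {0} = {}" "?I 3 {Suc 0} = {(1, 0)}" "?I 3 {2} = {(2, 0), (2, 1)}"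
    "?I 3 {0, Suc 0} = {}" "?I 3 {0, 2} = {(2, 1)}" "?I 3 {Suc 0, 2} = {(1, 0), (2, 0)}"
    by auto
  show "shuffle_sign 0 {} = 1" "shuffle_sign (Suc 0) {0} = 1"
    "shuffle_sign 2 {0} = 1" "shuffle_sign 2 {Suc 0} = -1" "shuffle_sign 2 {0, Suc 0} = 1"
    "shuffle_sign 3 {0} = 1" "shuffle_sign 3 {Suc 0} = -1" "shuffle_sign 3 {2} = 1"
    "shuffle_sign 3 {0, Suc 0} = 1" "shuffle_sign 3 {0, 2} = -1" "shuffle_sign 3 {Suc 0, 2} = 1"
    unfolding shuffle_sign_def I by simp_all
qed

lemma length_2_3: "length [f, g] = 2" "length [f, g, h] = 3"
  by simp_all

lemmas shuffle_simps = shuffles_of_eq shuffle_sign_eq length_2_3 nths_Cons doubleton_eq_iff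

lemma wedge_1_1: "wedge 1 X Y [f, g] = X [f] * Y [g] - X [g] * Y [f]"
  by (rule ext) (simp add: wedge_def shuffle_simps del: list.size)

lemma wedge_1_2:
  "wedge 1 X B [f, g, h] = X [f] * B [g, h] - X [g] * B [f, h] + X [h] * B [f, g]"
  by (rule ext) (simp add: wedge_def shuffle_simps del: list.size)

lemma schouten_1_0: "schouten 1 0 X F [] = X [F []]"
  by (rule ext) (simp add: schouten_def insertion_def shuffle_simps)

lemma schouten_1_1: "schouten 1 1 X Y [f] = X [Y [f]] - Y [X [f]]"
  by (rule ext) (simp add: schouten_def insertion_def shuffle_simps)

lemma schouten_1_2:
  "schouten 1 2 X B [f, g] = X [B [f, g]] - B [X [f], g] + B [X [g], f]"
  by (rule ext) (simp add: schouten_def insertion_def shuffle_simps del: list.size)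

lemma schouten_2_2:
  "schouten 2 2 B B [f, g, h] =
     (\<lambda>p. -2 * (B [B [f, g], h] p - B [B [f, h], g] p + B [B [g, h], f] p))"
  by (rule ext) (simp add: schouten_def insertion_def shuffle_simps algebra_simps del: list.size)

lemma linear_functions_eq:
  assumes "\<And>e x. e \<in> fibre E x \<Longrightarrow> (\<forall>c. smul E c e \<in> fibre E x)"
    and "\<And>e e' x. e \<in> fibre E x \<Longrightarrow> e' \<in> fibre E x \<Longrightarrow> vadd E e e' \<in> fibre E x"
  shows "linear_functions E = {h \<in> smooth_functions (total E). \<forall>x. fibre_linear E x h}"
proof (intro equalityI subsetI)
  fix h assume "h \<in> linear_functions E"
  then obtain \<mu> where \<mu>: "\<mu> \<in> dual_sections E" "h = iota E \<mu>"
    by (auto simp: linear_functions_def)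
  then show "h \<in> {h \<in> smooth_functions (total E). \<forall>x. fibre_linear E x h}"
    using assms by (auto simp: dual_sections_def fibre_linear_def iota_def fibre_def)
next
  fix h assume h: "h \<in> {h \<in> smooth_functions (total E). \<forall>x. fibre_linear E x h}"
  let ?\<mu> = "\<lambda>x e. if e \<in> fibre E x then h e else 0"
  have eq: "iota E ?\<mu> = h"
    by (auto simp: iota_def fibre_def)
  have "?\<mu> \<in> dual_sections E"
    unfolding dual_sections_def mem_Collect_eq eq using h assms by (auto simp: fibre_linear_def)
  then show "h \<in> linear_functions E"
    unfolding linear_functions_def by (rule image_eqI[where x = ?\<mu> and f = "iota E", OF eq[symmetric]])
qed

lemma liouville_linear:
  assumes "f \<in> smooth_functions (total E)" and "\<And>x. fibre_linear E x f"
  shows "liouville E [f] = f"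
proof
  fix e
  have "(\<lambda>t. f (smul E t e)) = (\<lambda>t. t * f e)"
    using assms(2)[of "proj E e"] by (auto simp: fibre_linear_def fibre_def)
  moreover have "deriv (\<lambda>t. t * f e) 1 = f e"
    by (rule DERIV_imp_deriv) (auto intro!: derivative_eq_intros)
  ultimately show "liouville E [f] e = f e"
    using assms(1) by (simp add: liouville_def vector_field_by_def)
qed

lemma vertical_lift_iota:
  assumes E: "vector_bundle E" and \<Phi>: "\<Phi> \<in> sections E" and \<mu>: "\<mu> \<in> dual_sections E"
  shows "vertical_lift E \<Phi> [iota E \<mu>] = pairing \<mu> \<Phi> \<circ> proj E"
proof
  fix e
  let ?x = "proj E e"
  have "\<Phi> ?x \<in> fibre E ?x" using \<Phi> by (auto simp: sections_def)
  then have mem: "smul E t (\<Phi> ?x) \<in> fibre E ?x" "vadd E e (smul E t (\<Phi> ?x)) \<in> fibre E ?x" for t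
    using E by (auto simp: vector_bundle_def fibre_def)
  have "iota E \<mu> (vadd E e (smul E t (\<Phi> ?x))) = \<mu> ?x e + t * \<mu> ?x (\<Phi> ?x)" for t
    using \<mu> mem \<open>\<Phi> ?x \<in> fibre E ?x\<close>
    by (auto simp: dual_sections_def fibre_linear_def iota_def fibre_def)
  moreover have "deriv (\<lambda>t. \<mu> ?x e + t * \<mu> ?x (\<Phi> ?x)) 0 = \<mu> ?x (\<Phi> ?x)"
    by (rule DERIV_imp_deriv) (auto intro!: derivative_eq_intros)
  ultimately show "vertical_lift E \<Phi> [iota E \<mu>] e = (pairing \<mu> \<Phi> \<circ> proj E) e"
    using \<mu> by (simp add: vertical_lift_def vector_field_by_def dual_sections_def pairing_def)
qed

lemma vertical_lift_basic:
  assumes E: "vector_bundle E" and \<Phi>: "\<Phi> \<in> sections E"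
  shows "vertical_lift E \<Phi> [g \<circ> proj E] = 0"
proof
  fix e
  have "proj E (vadd E e (smul E t (\<Phi> (proj E e)))) = proj E e" for t
    using E \<Phi> by (auto simp: vector_bundle_def fibre_def sections_def)
  then show "vertical_lift E \<Phi> [g \<circ> proj E] e = 0 e"
    by (simp add: vertical_lift_def vector_field_by_def)
qed

end

theory Submission
  imports Defs
begin

text \<open>
  If the rank is positive, a derivation of \<open>C\<^sup>\<infinity>(E)\<close> that vanishes on linear functions is zero: at a
  nonzero vector the differentials of linear functions span the cotangent space, and nonzero vectors
  are dense. Hence identities between multivector fields on \<open>E\<close> need only be checked on linear
  functions. There, \<open>\<Lambda> = \<Lambda>' - \<Gamma> \<and> \<Delta>\<close> coincides with the Jacobi bracket of \<open>J = (\<Lambda>', \<Gamma>)\<close>, so that its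
  Jacobi identity comes for free. Since \<open>{1, f} = \<Gamma>(f)\<close>, the field \<open>\<Gamma>\<close> is affine. The basic part of
  \<open>\<Gamma>(\<iota>\<^sub>\<mu>)\<close> is linear over \<open>C\<^sup>\<infinity>(M)\<close> in \<open>\<mu>\<close>, hence given by a section \<open>\<Phi>\<close>, and \<open>\<Gamma>0 = \<Phi>\<^sup>v\<close>. The remaining
  equations are the basic and the linear part of \<open>[\<Gamma>, \<Lambda>'] = 0\<close> on linear functions.
\<close>

section \<open>Calculus on Euclidean spaces\<close>

text \<open>The assumption \<open>rank E > 0\<close> excludes a real exception: in rank 0 every
  smooth function is basic and \<open>\<Delta> = 0\<close>, so the Jacobi structure of a contact
  form on a base of dimension 3 would itself have to be Poisson. Multivector fields act on global
  functions only. Reducing a derivation to its values on coordinates therefore takes cut-off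
  functions and Hadamard's lemma, and this is what the calculus on Euclidean spaces is for.
  Identities between affine functions are split by homogeneity: a function that is both basic and
  linear vanishes on comparing \<open>e\<close> with the zero vector over the same point. For linear
  \<open>f\<close> and basic \<open>b\<close> the hypotheses only make
  \<open>\<Lambda> [f, b]\<close> affine. Its linear part \<open>l\<close> disappears because the
  product rule for \<open>b * l\<close> shows that \<open>l * l\<close> is linear. Only then is the
  anchor of the dual algebroid well defined, and closedness of \<open>\<Phi>\<close> becomes the
  equation \<open>[\<Gamma>0, \<Lambda>] = 0\<close> read on linear functions.\<close>

abbreviation rspace :: "nat \<Rightarrow> (nat \<Rightarrow> real) set" where
  "rspace n \<equiv> {x. \<forall>i\<ge>n. x i = 0}"

abbreviation ropen :: "nat \<Rightarrow> (nat \<Rightarrow> real) set \<Rightarrow> bool" where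
  "ropen n \<equiv> openin (Euclidean_space n)"

declare Ck_on.simps [simp del]

text \<open>Besides forming a neighbourhood basis, cubes allow small changes of a single coordinate,
  as partial derivatives and the mean value theorem require, and contraction towards
  \<open>p\<close>, as Hadamard's lemma requires.\<close>

definition cube :: "nat \<Rightarrow> (nat \<Rightarrow> real) \<Rightarrow> real \<Rightarrow> (nat \<Rightarrow> real) set" where
  "cube n p d = {x \<in> rspace n. \<forall>i<n. \<bar>x i - p i\<bar> < d}"

lemma Euclidean_space_top_of_set: "Euclidean_space n = top_of_set (rspace n)"
  by (simp add: Euclidean_space_def euclidean_product_topology)

lemma openin_Euclidean_space_iff: "ropen n V \<longleftrightarrow> (\<exists>T. open T \<and> V = rspace n \<inter> T)"
  by (auto simp: Euclidean_space_top_of_set openin_open)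

lemma openin_Euclidean_space_subset: "ropen n V \<Longrightarrow> V \<subseteq> rspace n"
  by (auto simp: openin_Euclidean_space_iff)

lemma openin_cube: "ropen n (cube n p d)"
proof -
  have "open {x::nat\<Rightarrow>real. \<bar>x i - p i\<bar> < d}" for i
    by (intro open_Collect_less continuous_intros continuous_on_product_coordinates)
  then have "open (\<Inter>i\<in>{..<n}. {x::nat\<Rightarrow>real. \<bar>x i - p i\<bar> < d})"
    by (intro open_INT) auto
  moreover have "cube n p d = rspace n \<inter> (\<Inter>i\<in>{..<n}. {x. \<bar>x i - p i\<bar> < d})"
    by (auto simp: cube_def)
  ultimately show ?thesis
    unfolding openin_Euclidean_space_iff by blast
qed

lemma centre_in_cube: "p \<in> rspace n \<Longrightarrow> d > 0 \<Longrightarrow> p \<in> cube n p d"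
  by (auto simp: cube_def)

lemma cube_subset_openin:
  assumes "ropen n V" "p \<in> V"
  obtains d where "d > 0" "cube n p d \<subseteq> V"
proof -
  obtain T where T: "open T" "V = rspace n \<inter> T"
    using assms(1) by (auto simp: openin_Euclidean_space_iff)
  have "openin (product_topology (\<lambda>i::nat. euclideanreal) UNIV) T"
    using T(1) by (simp add: euclidean_product_topology)
  moreover have "p \<in> T" using assms(2) T by auto
  ultimately obtain X where X: "p \<in> PiE UNIV X" "\<And>i. open (X i)" "finite {i. X i \<noteq> UNIV}" "PiE UNIV X \<subseteq> T"
    using product_topology_open_contains_basis[of "\<lambda>i. euclideanreal" UNIV T p] by auto
  have "\<exists>d>0. \<forall>y. \<bar>y - p i\<bar> < d \<longrightarrow> y \<in> X i" for i
  proof -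
    have "p i \<in> X i" using X(1) by auto
    then obtain d where "d > 0" "ball (p i) d \<subseteq> X i"
      using X(2)[of i] open_contains_ball by blast
    then show ?thesis
      by (intro exI[of _ d]) (auto simp: subset_iff dist_real_def abs_minus_commute)
  qed
  then obtain d where d: "\<And>i. d i > 0" "\<And>i y. \<bar>y - p i\<bar> < d i \<Longrightarrow> y \<in> X i"
    by metis
  \<comment> \<open>The inserted 1 keeps the minimum defined for \<open>n = 0\<close>. From index
    \<open>n\<close> on, points of the model space agree with \<open>p\<close>, so finitely many
    radii suffice.\<close>
  let ?d = "Min (insert 1 (d ` {..<n}))"
  have "?d > 0" using d(1) by (subst Min_gr_iff) auto
  moreover have "x \<in> V" if x: "x \<in> cube n p ?d" for x
  proof -
    have "x i \<in> X i" for i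
    proof (cases "i < n")
      case True
      then have "?d \<le> d i" by (intro Min_le) auto
      with x True show ?thesis by (intro d(2)) (auto simp: cube_def)
    next
      case False
      then have "x i = p i" using x assms(2) T by (auto simp: cube_def)
      then show ?thesis using X(1) by auto
    qed
    then have "x \<in> T" using X(4) by auto
    then show ?thesis using x T by (auto simp: cube_def)
  qed
  ultimately show ?thesis using that[of ?d] by blast
qed

lemma eventually_fun_upd_in_openin:
  assumes "ropen n V" "x \<in> V" "i < n"
  shows "\<exists>d>0. \<forall>t. \<bar>t - x i\<bar> < d \<longrightarrow> x(i := t) \<in> V"
proof -
  obtain d where d: "d > 0" "cube n x d \<subseteq> V"
    using cube_subset_openin[OF assms(1,2)] by blast
  have "x(i := t) \<in> cube n x d" if "\<bar>t - x i\<bar> < d" for t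
    using that assms d openin_Euclidean_space_subset[OF assms(1)] by (auto simp: cube_def)
  with d show ?thesis by blast
qed

section \<open>Congruence, restriction and gluing for functions of class \<open>C^k\<close>\<close>

lemma Ck_on_0:
  assumes "V \<subseteq> rspace n"
  shows "Ck_on 0 n V f \<longleftrightarrow> continuous_on V f"
proof -
  have "subtopology (Euclidean_space n) V = top_of_set V"
    using assms by (auto simp: Euclidean_space_top_of_set subtopology_subtopology Int_absorb1)
  then show ?thesis by (simp add: Ck_on.simps)
qed

lemma Ck_on_Suc:
  assumes "V \<subseteq> rspace n"
  shows "Ck_on (Suc k) n V f \<longleftrightarrow> continuous_on V f \<and>
     (\<forall>i<n. (\<forall>x\<in>V. ((\<lambda>t. f (x(i := t))) has_real_derivative partial_deriv i f x) (at (x i))) \<and>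
            Ck_on k n V (partial_deriv i f))"
  using Ck_on_0[OF assms, of f]
  by (auto simp: partial_deriv_def DERIV_deriv_iff_field_differentiable Ck_on.simps)

lemma Ck_on_imp_continuous_on: "V \<subseteq> rspace n \<Longrightarrow> Ck_on k n V f \<Longrightarrow> continuous_on V f"
  by (cases k) (auto simp: Ck_on_0 Ck_on_Suc)

text \<open>\<open>partial_deriv\<close> refers to the function on a whole coordinate line. Since
  \<open>V\<close> is open, the line through a point of \<open>V\<close> stays in \<open>V\<close>
  near that point, so both functions have the same germ there and agreement passes to the
  derivatives.\<close>

lemma Ck_on_cong:
  assumes V: "ropen n V" and eq: "\<And>x. x \<in> V \<Longrightarrow> f x = g x"
  shows "Ck_on k n V f \<longleftrightarrow> Ck_on k n V g"
proof -
  have imp: "Ck_on k n V g" if "\<And>x. x \<in> V \<Longrightarrow> f x = g x" "Ck_on k n V f" for f g :: "(nat \<Rightarrow> real) \<Rightarrow> real"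
    using that
  proof (induction k arbitrary: f g)
    case 0
    then show ?case
      using continuous_on_cong[OF refl, of V f g] by (simp add: Ck_on_0[OF openin_Euclidean_space_subset[OF V]])
  next
    case (Suc k)
    note sub = openin_Euclidean_space_subset[OF V]
    have der: "((\<lambda>t. g (x(i := t))) has_real_derivative partial_deriv i f x) (at (x i))"
      if x: "x \<in> V" and i: "i < n" for x i
    proof -
      obtain d where d: "d > 0" "\<forall>t. \<bar>t - x i\<bar> < d \<longrightarrow> x(i := t) \<in> V"
        using eventually_fun_upd_in_openin[OF V x i] by blast
      have "((\<lambda>t. f (x(i := t))) has_real_derivative partial_deriv i f x) (at (x i))"
        using Suc.prems(2) x i by (simp add: Ck_on_Suc[OF sub])
      then show ?thesis
        by (rule has_field_derivative_transform_within[where d = d])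
          (use d Suc.prems(1) in \<open>auto simp: dist_real_def\<close>)
    qed
    have "partial_deriv i f x = partial_deriv i g x" if "x \<in> V" "i < n" for x i
      using der[OF that] by (simp add: partial_deriv_def DERIV_imp_deriv)
    then have "Ck_on k n V (partial_deriv i g)" if "i < n" for i
      using Suc.IH[of "partial_deriv i f" "partial_deriv i g"] Suc.prems(2) that
      by (simp add: Ck_on_Suc[OF sub])
    moreover have "continuous_on V g"
      using Suc.prems continuous_on_cong[OF refl, of V f g] by (simp add: Ck_on_Suc[OF sub])
    moreover have "partial_deriv i g x = partial_deriv i f x" if "x \<in> V" "i < n" for x i
      using der[OF that] by (simp add: partial_deriv_def DERIV_imp_deriv)
    ultimately show ?case
      unfolding Ck_on_Suc[OF sub] using der by simp
  qed
  show ?thesis using imp[of f g] imp[of g f] eq by auto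
qed

text \<open>Lets derivatives be supplied by formulas that are correct only on \<open>V\<close>;
  equality with \<open>partial_deriv\<close> need not hold elsewhere.\<close>

lemma Ck_on_SucI:
  assumes V: "ropen n V" and cont: "continuous_on V f"
    and der: "\<And>i x. i < n \<Longrightarrow> x \<in> V \<Longrightarrow> ((\<lambda>t. f (x(i := t))) has_real_derivative f' i x) (at (x i))"
    and Ck: "\<And>i. i < n \<Longrightarrow> Ck_on k n V (f' i)"
  shows "Ck_on (Suc k) n V f"
proof -
  have eq: "partial_deriv i f x = f' i x" if "x \<in> V" "i < n" for x i
    using der[OF that(2,1)] by (simp add: partial_deriv_def DERIV_imp_deriv)
  then have "Ck_on k n V (partial_deriv i f)" if "i < n" for i
    using Ck_on_cong[OF V, of "partial_deriv i f" "f' i"] Ck[OF that] that by auto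
  then show ?thesis
    using eq der cont by (auto simp: Ck_on_Suc[OF openin_Euclidean_space_subset[OF V]])
qed

lemma Ck_on_SucD: "Ck_on (Suc k) n V f \<Longrightarrow> Ck_on k n V f"
  by (induction k arbitrary: f) (auto simp: Ck_on.simps)

lemma Ck_on_partial_deriv: "Ck_on (Suc k) n V f \<Longrightarrow> i < n \<Longrightarrow> Ck_on k n V (partial_deriv i f)"
  by (simp add: Ck_on.simps)

lemma Ck_on_subset: "Ck_on k n V f \<Longrightarrow> W \<subseteq> V \<Longrightarrow> Ck_on k n W f"
proof (induction k arbitrary: f)
  case 0
  then show ?case
    using continuous_map_from_subtopology_mono[of "Euclidean_space n" V euclideanreal f W]
    by (simp add: Ck_on.simps)
next
  case (Suc k)
  have "continuous_map (subtopology (Euclidean_space n) W) euclideanreal f"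
    by (rule continuous_map_from_subtopology_mono) (use Suc.prems in \<open>auto simp: Ck_on.simps\<close>)
  with Suc show ?case by (auto simp: Ck_on.simps)
qed

text \<open>Differentiability is already a condition at each point, so only continuity has to be
  glued, once for each order of differentiation.\<close>

lemma Ck_on_local:
  assumes V: "ropen n V"
    and "\<And>x. x \<in> V \<Longrightarrow> \<exists>W. ropen n W \<and> x \<in> W \<and> Ck_on k n (V \<inter> W) f"
  shows "Ck_on k n V f"
proof -
  note sub = openin_Euclidean_space_subset[OF V]
  have cont: "continuous_on V f"
    if loc: "\<And>x. x \<in> V \<Longrightarrow> \<exists>W. ropen n W \<and> x \<in> W \<and> Ck_on k n (V \<inter> W) f" for k f
    unfolding continuous_on_eq_continuous_within
  proof
    fix x assume "x \<in> V"
    then obtain W where W: "ropen n W" "x \<in> W" "Ck_on k n (V \<inter> W) f"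
      using loc by blast
    have c: "continuous_on (V \<inter> W) f"
      by (rule Ck_on_imp_continuous_on[OF _ W(3)]) (use sub in auto)
    obtain T where T: "open T" "W = rspace n \<inter> T"
      using W by (auto simp: openin_Euclidean_space_iff)
    have "at x within (V \<inter> W) = at x within V"
      by (rule at_within_nhd[where S = T]) (use T W(2) sub in auto)
    then show "continuous (at x within V) f"
      using c W(2) \<open>x \<in> V\<close> by (metis IntI continuous_on_eq_continuous_within)
  qed
  show ?thesis using assms(2)
  proof (induction k arbitrary: f)
    case 0
    then show ?case using cont[of 0] Ck_on_0[OF sub] by blast
  next
    case (Suc k)
    have "continuous_on V f" using cont Suc.prems by blast
    moreover have "Ck_on k n V (partial_deriv i f)" if "i < n" for i
    proof (rule Suc.IH)
      fix x assume "x \<in> V"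
      from Suc.prems[OF this] show "\<exists>W. ropen n W \<and> x \<in> W \<and> Ck_on k n (V \<inter> W) (partial_deriv i f)"
        using Ck_on_partial_deriv that by blast
    qed
    moreover have "(\<lambda>t. f (x(i := t))) field_differentiable at (x i)" if x: "x \<in> V" and i: "i < n" for x i
    proof -
      obtain W where "x \<in> W" "Ck_on (Suc k) n (V \<inter> W) f" using Suc.prems[OF x] by blast
      then show ?thesis using x i by (simp add: Ck_on.simps)
    qed
    ultimately show ?case using Ck_on_0[OF sub] by (simp add: Ck_on.simps)
  qed
qed

section \<open>Algebraic operations on functions of class \<open>C^k\<close>\<close>

lemma Ck_on_const: "Ck_on k n V (\<lambda>x. c)"
proof (induction k arbitrary: c)
  case (Suc k)
  have "partial_deriv i (\<lambda>x. c) = (\<lambda>x. 0)" for i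
    by (auto simp: partial_deriv_def)
  with Suc show ?case by (auto simp: Ck_on.simps)
qed (auto simp: Ck_on.simps)

lemma Ck_on_coord: "V \<subseteq> rspace n \<Longrightarrow> Ck_on k n V (\<lambda>x. x j)"
proof (cases k)
  case (Suc k')
  assume V: "V \<subseteq> rspace n"
  have der: "((\<lambda>t. (x(i := t)) j) has_real_derivative (if i = j then 1 else 0)) (at s)" for x i s
    by (auto intro!: derivative_eq_intros)
  then have "partial_deriv i (\<lambda>x. x j) = (\<lambda>x. if i = j then 1 else 0)" for i
    by (auto simp: partial_deriv_def intro!: DERIV_imp_deriv)
  moreover have "continuous_on V (\<lambda>x. x j)"
    by (rule continuous_on_subset[OF continuous_on_product_coordinates]) auto
  ultimately show ?thesis
    unfolding Suc Ck_on_Suc[OF V] using der by (simp add: Ck_on_const)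
qed (auto simp: Ck_on_0 intro!: continuous_on_subset[OF continuous_on_product_coordinates])

context
  fixes n :: nat and V :: "(nat \<Rightarrow> real) set"
  assumes V: "ropen n V"
begin

private lemma sub: "V \<subseteq> rspace n"
  by (rule openin_Euclidean_space_subset[OF V])

lemma Ck_on_add: "Ck_on k n V f \<Longrightarrow> Ck_on k n V g \<Longrightarrow> Ck_on k n V (\<lambda>x. f x + g x)"
proof (induction k arbitrary: f g)
  case 0
  then show ?case by (simp add: Ck_on_0[OF sub] continuous_on_add)
next
  case (Suc k)
  show ?case
  proof (rule Ck_on_SucI[OF V, where f' = "\<lambda>i x. partial_deriv i f x + partial_deriv i g x"])
    show "continuous_on V (\<lambda>x. f x + g x)"
      using Suc.prems by (simp add: Ck_on_Suc[OF sub] continuous_on_add)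
    fix i assume i: "i < n"
    show "Ck_on k n V (\<lambda>x. partial_deriv i f x + partial_deriv i g x)"
      using Suc i by (simp add: Ck_on_partial_deriv)
    fix x assume x: "x \<in> V"
    show "((\<lambda>t. f (x(i := t)) + g (x(i := t))) has_real_derivative
        partial_deriv i f x + partial_deriv i g x) (at (x i))"
      using Suc.prems x i by (intro DERIV_add) (simp_all add: Ck_on_Suc[OF sub])
  qed
qed

lemma Ck_on_mult: "Ck_on k n V f \<Longrightarrow> Ck_on k n V g \<Longrightarrow> Ck_on k n V (\<lambda>x. f x * g x)"
proof (induction k arbitrary: f g)
  case 0
  then show ?case by (simp add: Ck_on_0[OF sub] continuous_on_mult)
next
  case (Suc k)
  show ?case
  proof (rule Ck_on_SucI[OF V, where f' = "\<lambda>i x. partial_deriv i f x * g x + f x * partial_deriv i g x"])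
    show "continuous_on V (\<lambda>x. f x * g x)"
      using Suc.prems by (simp add: Ck_on_Suc[OF sub] continuous_on_mult)
    fix i assume i: "i < n"
    show "Ck_on k n V (\<lambda>x. partial_deriv i f x * g x + f x * partial_deriv i g x)"
      using Suc i by (auto intro!: Ck_on_add Suc.IH simp: Ck_on_SucD Ck_on_partial_deriv)
    fix x assume x: "x \<in> V"
    have f: "((\<lambda>t. f (x(i := t))) has_real_derivative partial_deriv i f x) (at (x i))"
      and g: "((\<lambda>t. g (x(i := t))) has_real_derivative partial_deriv i g x) (at (x i))"
      using Suc.prems x i by (auto simp: Ck_on_Suc[OF sub])
    show "((\<lambda>t. f (x(i := t)) * g (x(i := t))) has_real_derivative
        partial_deriv i f x * g x + f x * partial_deriv i g x) (at (x i))"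
      using DERIV_mult[OF f g] by (simp add: algebra_simps)
  qed
qed

lemma Ck_on_sum: "(\<And>i. i \<in> I \<Longrightarrow> Ck_on k n V (f i)) \<Longrightarrow> Ck_on k n V (\<lambda>x. \<Sum>i\<in>I. f i x)"
  by (induction I rule: infinite_finite_induct) (simp_all add: Ck_on_const Ck_on_add)

lemma Ck_on_inverse:
  "Ck_on k n V f \<Longrightarrow> (\<And>x. x \<in> V \<Longrightarrow> f x \<noteq> 0) \<Longrightarrow> Ck_on k n V (\<lambda>x. inverse (f x))"
proof (induction k arbitrary: f)
  case 0
  then show ?case by (simp add: Ck_on_0[OF sub] continuous_on_inverse)
next
  case (Suc k)
  let ?f' = "\<lambda>i x. (-1) * (inverse (f x) * partial_deriv i f x * inverse (f x))"
  show ?case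
  proof (rule Ck_on_SucI[OF V, where f' = ?f'])
    show "continuous_on V (\<lambda>x. inverse (f x))"
      using Suc.prems by (simp add: Ck_on_Suc[OF sub] continuous_on_inverse)
    fix i assume i: "i < n"
    have "Ck_on k n V (\<lambda>x. inverse (f x))"
      using Suc by (intro Suc.IH) (auto simp: Ck_on_SucD)
    then show "Ck_on k n V (?f' i)"
      using Suc i by (intro Ck_on_mult Ck_on_const) (auto simp: Ck_on_partial_deriv)
    fix x assume x: "x \<in> V"
    have f: "((\<lambda>t. f (x(i := t))) has_real_derivative partial_deriv i f x) (at (x i))"
      using Suc.prems x i by (auto simp: Ck_on_Suc[OF sub])
    show "((\<lambda>t. inverse (f (x(i := t)))) has_real_derivative ?f' i x) (at (x i))"
      using DERIV_inverse'[OF f] Suc.prems(2)[OF x] by (simp add: algebra_simps)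
  qed
qed

end

subsection \<open>The chain rule\<close>

text \<open>This chain rule works without a total derivative on the ambient sequence space. The
  increment of \<open>F\<close> is telescoped over the coordinates; by the mean value theorem each
  one-coordinate increment is governed by a partial derivative at an intermediate point, and
  continuity of the partial derivatives yields the limit.\<close>

lemma has_real_derivative_along_curve:
  assumes V: "ropen n V" and F: "Ck_on 1 n V F"
    and \<gamma>: "\<And>i. i < n \<Longrightarrow> ((\<lambda>t. \<gamma> t i) has_real_derivative d i) (at t0)"
    and mem: "\<gamma> t0 \<in> V" and ev: "\<forall>\<^sub>F t in at t0. \<gamma> t \<in> rspace n"
  shows "((\<lambda>t. F (\<gamma> t)) has_real_derivative (\<Sum>i<n. partial_deriv i F (\<gamma> t0) * d i)) (at t0)"
proof -
  let ?p = "\<gamma> t0"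
  note sub = openin_Euclidean_space_subset[OF V]
  have p: "?p \<in> rspace n" using mem sub by auto
  have partial: "((\<lambda>t. F (x(i := t))) has_real_derivative partial_deriv i F x) (at (x i))"
    if "x \<in> V" "i < n" for x i
    using F that by (simp add: Ck_on_Suc[OF sub])
  have cont: "continuous_on V (partial_deriv i F)" if "i < n" for i
    using F that by (simp add: Ck_on_Suc[OF sub] Ck_on_0[OF sub])
  \<comment> \<open>\<open>z j t\<close> has moved only the first \<open>j\<close> coordinates.
    \<open>z n t\<close> equals \<open>\<gamma> t\<close> near \<open>t0\<close>, because
    \<open>ev\<close> makes the coordinates from \<open>n\<close> on vanish there.\<close>
  define z where "z j t = (\<lambda>i. if i < j then \<gamma> t i else ?p i)" for j t
  have lim: "((\<lambda>t. \<gamma> t i) \<longlongrightarrow> ?p i) (at t0)" if "i < n" for i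
    using DERIV_isCont[OF \<gamma>[OF that]] by (simp add: isCont_def)
  have near: "\<forall>\<^sub>F t in at t0. \<forall>i<n. \<bar>\<gamma> t i - ?p i\<bar> < e" if "e > 0" for e
  proof -
    have "\<forall>\<^sub>F t in at t0. \<forall>i\<in>{..<n}. \<bar>\<gamma> t i - ?p i\<bar> < e"
      using lim that by (intro eventually_ball_finite) (auto simp: tendsto_iff dist_real_def)
    then show ?thesis by (simp add: Ball_def)
  qed
  have step: "((\<lambda>t. F (z (Suc j) t) - F (z j t)) has_real_derivative partial_deriv j F ?p * d j) (at t0)"
    if j: "j < n" for j
  proof -
    \<comment> \<open>The difference quotient in the moved coordinate, filled in by the partial
      derivative when \<open>\<gamma> t j\<close> equals \<open>?p j\<close>, which may happen at
      times other than \<open>t0\<close>. The increment is then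
      \<open>q t * (\<gamma> t j - ?p j)\<close> without exception.\<close>
    define q where "q t = (if \<gamma> t j = ?p j then partial_deriv j F ?p
        else (F (z (Suc j) t) - F (z j t)) / (\<gamma> t j - ?p j))" for t
    have zS: "z (Suc j) t = (z j t)(j := \<gamma> t j)" for t
      by (auto simp: z_def fun_eq_iff)
    have zj: "z j t j = ?p j" for t by (simp add: z_def)
    have q: "(q \<longlongrightarrow> partial_deriv j F ?p) (at t0)"
      unfolding tendsto_iff
    proof (intro allI impI)
      fix e :: real assume e: "e > 0"
      have "openin (top_of_set V) (V \<inter> partial_deriv j F -` ball (partial_deriv j F ?p) e)"
        using cont[OF j] by (intro continuous_openin_preimage_gen) auto
      then have "ropen n (V \<inter> partial_deriv j F -` ball (partial_deriv j F ?p) e)"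
        using V unfolding Euclidean_space_top_of_set by (rule openin_trans)
      moreover have "?p \<in> V \<inter> partial_deriv j F -` ball (partial_deriv j F ?p) e"
        using mem e by auto
      ultimately obtain r where r: "r > 0"
        "cube n ?p r \<subseteq> V \<inter> partial_deriv j F -` ball (partial_deriv j F ?p) e"
        using cube_subset_openin by blast
      show "\<forall>\<^sub>F t in at t0. dist (q t) (partial_deriv j F ?p) < e"
        using near[OF r(1)]
      proof eventually_elim
        case (elim t)
        show ?case
        proof (cases "\<gamma> t j = ?p j")
          case True
          then show ?thesis using e by (simp add: q_def)
        next
          case False
          have inc: "(z j t)(j := s) \<in> cube n ?p r" if "\<bar>s - ?p j\<bar> < r" for s
            using that elim j p r(1) by (auto simp: z_def cube_def)
          have "\<exists>s. \<bar>s - ?p j\<bar> < r \<and> F (z (Suc j) t) - F (z j t) = (\<gamma> t j - ?p j) * partial_deriv j F ((z j t)(j := s))"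
          proof -
            let ?h = "\<lambda>s. F ((z j t)(j := s))" and ?h' = "\<lambda>s. partial_deriv j F ((z j t)(j := s))"
            have h: "(?h has_real_derivative ?h' s) (at s)" if "\<bar>s - ?p j\<bar> < r" for s
              using partial[of "(z j t)(j := s)" j] inc[OF that] r(2) j by (auto simp: fun_upd_upd)
            have ends: "F (z (Suc j) t) = ?h (\<gamma> t j)" "F (z j t) = ?h (?p j)"
              using fun_upd_triv[of "z j t" j] by (simp_all add: zS zj)
            have b: "\<bar>\<gamma> t j - ?p j\<bar> < r" using elim j by auto
            consider "?p j < \<gamma> t j" | "\<gamma> t j < ?p j" using False by linarith
            then show ?thesis
            proof cases
              case 1
              have "\<exists>s. ?p j < s \<and> s < \<gamma> t j \<and> ?h (\<gamma> t j) - ?h (?p j) = (\<gamma> t j - ?p j) * ?h' s"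
                by (intro MVT2 h) (use 1 b in auto)
              then obtain s where s: "?p j < s" "s < \<gamma> t j" "?h (\<gamma> t j) - ?h (?p j) = (\<gamma> t j - ?p j) * ?h' s"
                by blast
              moreover have "\<bar>s - ?p j\<bar> < r" using s b by linarith
              ultimately show ?thesis unfolding ends by blast
            next
              case 2
              have "\<exists>s. \<gamma> t j < s \<and> s < ?p j \<and> ?h (?p j) - ?h (\<gamma> t j) = (?p j - \<gamma> t j) * ?h' s"
                by (intro MVT2 h) (use 2 b in auto)
              then obtain s where s: "\<gamma> t j < s" "s < ?p j" "?h (?p j) - ?h (\<gamma> t j) = (?p j - \<gamma> t j) * ?h' s"
                by blast
              then have "?h (\<gamma> t j) - ?h (?p j) = (\<gamma> t j - ?p j) * ?h' s"
                by (simp add: algebra_simps)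
              moreover have "\<bar>s - ?p j\<bar> < r" using s b by linarith
              ultimately show ?thesis unfolding ends by blast
            qed
          qed
          then obtain s where s: "\<bar>s - ?p j\<bar> < r" "q t = partial_deriv j F ((z j t)(j := s))"
            using False by (auto simp: q_def)
          then have "partial_deriv j F ((z j t)(j := s)) \<in> ball (partial_deriv j F ?p) e"
            using inc[OF s(1)] r(2) by blast
          then show ?thesis using s by (simp add: dist_commute)
        qed
      qed
    qed
    have "((\<lambda>t. q t * ((\<gamma> t j - ?p j) / (t - t0))) \<longlongrightarrow> partial_deriv j F ?p * d j) (at t0)"
      using \<gamma>[OF j] q by (intro tendsto_mult) (auto simp: has_field_derivative_iff)
    moreover have "q t * ((\<gamma> t j - ?p j) / (t - t0)) =
        (F (z (Suc j) t) - F (z j t) - (F (z (Suc j) t0) - F (z j t0))) / (t - t0)" for t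
    proof -
      have "z (Suc j) t0 = z j t0" by (auto simp: z_def)
      moreover have "z (Suc j) t = z j t" if "\<gamma> t j = ?p j"
        using that zS zj by (metis fun_upd_triv)
      ultimately show ?thesis by (auto simp: q_def)
    qed
    ultimately show ?thesis unfolding has_field_derivative_iff by (simp only:)
  qed
  have "((\<lambda>t. F (z j t)) has_real_derivative (\<Sum>i<j. partial_deriv i F ?p * d i)) (at t0)" if "j \<le> n" for j
    using that
  proof (induction j)
    case 0
    then show ?case by (simp add: z_def)
  next
    case (Suc j)
    then have "((\<lambda>t. F (z j t) + (F (z (Suc j) t) - F (z j t))) has_real_derivative
      (\<Sum>i<j. partial_deriv i F ?p * d i) + partial_deriv j F ?p * d j) (at t0)"
      using step by (intro DERIV_add) auto
    then show ?case by simp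
  qed
  then have "((\<lambda>t. F (z n t)) has_real_derivative (\<Sum>i<n. partial_deriv i F ?p * d i)) (at t0)"
    by blast
  moreover have "\<forall>\<^sub>F t in at t0. F (z n t) = F (\<gamma> t)"
    using ev
  proof eventually_elim
    case (elim t)
    then have "z n t = \<gamma> t" using p by (auto simp: z_def fun_eq_iff)
    then show ?case by simp
  qed
  ultimately show ?thesis
  proof (subst DERIV_cong_ev[OF refl _ refl])
    have "z n t0 = \<gamma> t0" by (auto simp: z_def)
    then show "\<forall>\<^sub>F t in nhds t0. F (\<gamma> t) = F (z n t)"
      using \<open>\<forall>\<^sub>F t in at t0. F (z n t) = F (\<gamma> t)\<close>
      by (auto simp: eventually_at_filter elim: eventually_mono)
  qed
qed

lemma Ck_on_mono: "Ck_on k n V f \<Longrightarrow> l \<le> k \<Longrightarrow> Ck_on l n V f"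
proof (induction "k - l" arbitrary: l)
  case (Suc d)
  then have "Ck_on (Suc l) n V f" by (auto intro!: Suc.hyps(1)[of "Suc l"])
  then show ?case by (rule Ck_on_SucD)
qed auto

lemma Ck_on_compose:
  assumes V: "ropen n V" and W: "ropen m W"
    and "Ck_on k m W F" and "\<And>i. i < m \<Longrightarrow> Ck_on k n V (\<lambda>x. H x i)" and HW: "H ` V \<subseteq> W"
  shows "Ck_on k n V (\<lambda>x. F (H x))"
proof -
  note sub = openin_Euclidean_space_subset[OF V] and subW = openin_Euclidean_space_subset[OF W]
  have cont: "continuous_on V (\<lambda>x. F (H x))"
    if F: "continuous_on W F" and H: "\<And>i. i < m \<Longrightarrow> continuous_on V (\<lambda>x. H x i)" for F :: "(nat \<Rightarrow> real) \<Rightarrow> real"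
  proof -
    \<comment> \<open>Only the coordinates below \<open>m\<close> are known to be continuous; the
      others vanish on \<open>V\<close> because \<open>H\<close> maps \<open>V\<close> into
      \<open>W\<close>.\<close>
    have "continuous_on V (\<lambda>x. H x i)" for i
    proof (cases "i < m")
      case False
      then have "H x i = 0" if "x \<in> V" for x using HW subW that by force
      then show ?thesis using continuous_on_cong[OF refl, of V "\<lambda>x. H x i" "\<lambda>x. 0"] by simp
    qed (use H in auto)
    then have "continuous_on V H" by (rule continuous_on_coordinatewise_then_product)
    then show ?thesis using continuous_on_compose2[OF F _ HW] by auto
  qed
  show ?thesis using assms(3,4)
  proof (induction k arbitrary: F)
    case 0
    then show ?case using cont[of F] by (simp add: Ck_on_0[OF sub] Ck_on_0[OF subW])
  next
    case (Suc k)
    show ?case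
    proof (rule Ck_on_SucI[OF V, where f' = "\<lambda>j x. \<Sum>i<m. partial_deriv i F (H x) * partial_deriv j (\<lambda>x. H x i) x"])
      show "continuous_on V (\<lambda>x. F (H x))"
        by (rule cont) (use Suc.prems in \<open>auto simp: Ck_on_Suc[OF sub] Ck_on_Suc[OF subW]\<close>)
      fix j assume j: "j < n"
      show "Ck_on k n V (\<lambda>x. \<Sum>i<m. partial_deriv i F (H x) * partial_deriv j (\<lambda>x. H x i) x)"
      proof (intro Ck_on_sum[OF V] Ck_on_mult[OF V])
        fix i assume "i \<in> {..<m}"
        then have i: "i < m" by simp
        show "Ck_on k n V (\<lambda>x. partial_deriv i F (H x))"
          by (rule Suc.IH) (use Suc.prems i in \<open>auto intro: Ck_on_partial_deriv Ck_on_SucD\<close>)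
        show "Ck_on k n V (partial_deriv j (\<lambda>x. H x i))"
          using Suc.prems(2)[OF i] j by (rule Ck_on_partial_deriv)
      qed
      fix x assume x: "x \<in> V"
      obtain r where r: "r > 0" "\<forall>t. \<bar>t - x j\<bar> < r \<longrightarrow> x(j := t) \<in> V"
        using eventually_fun_upd_in_openin[OF V x j] by blast
      have "\<forall>\<^sub>F t in at (x j). \<bar>t - x j\<bar> < r"
        using eventually_at_in_open'[of "ball (x j) r" "x j"] r(1) by (auto simp: dist_real_def abs_minus_commute)
      then have "\<forall>\<^sub>F t in at (x j). H (x(j := t)) \<in> rspace m"
        by eventually_elim (use r(2) HW subW in blast)
      moreover have "Ck_on 1 m W F"
        using Suc.prems(1) by (rule Ck_on_mono) simp
      moreover have "((\<lambda>t. H (x(j := t)) i) has_real_derivative partial_deriv j (\<lambda>x. H x i) x) (at (x j))" if "i < m" for i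
        using Suc.prems(2)[OF that] x j by (simp add: Ck_on_Suc[OF sub])
      ultimately show "((\<lambda>t. F (H (x(j := t)))) has_real_derivative
          (\<Sum>i<m. partial_deriv i F (H x) * partial_deriv j (\<lambda>x. H x i) x)) (at (x j))"
        using has_real_derivative_along_curve[OF W, of F "\<lambda>t. H (x(j := t))" _ "x j"] x HW by auto
    qed
  qed
qed

subsection \<open>Smooth functions\<close>

lemma smooth_on_const: "smooth_on n V (\<lambda>x. c)"
  by (simp add: smooth_on_def Ck_on_const)

lemma smooth_on_coord: "V \<subseteq> rspace n \<Longrightarrow> smooth_on n V (\<lambda>x. x j)"
  by (simp add: smooth_on_def Ck_on_coord)

lemma smooth_on_cong:
  assumes "ropen n V" "\<And>x. x \<in> V \<Longrightarrow> f x = g x"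
  shows "smooth_on n V f \<longleftrightarrow> smooth_on n V g"
  using Ck_on_cong[OF assms] by (simp add: smooth_on_def)

lemma smooth_on_subset: "smooth_on n V f \<Longrightarrow> W \<subseteq> V \<Longrightarrow> smooth_on n W f"
  by (auto simp: smooth_on_def intro: Ck_on_subset)

lemma smooth_on_partial_deriv: "smooth_on n V f \<Longrightarrow> i < n \<Longrightarrow> smooth_on n V (partial_deriv i f)"
  by (auto simp: smooth_on_def intro: Ck_on_partial_deriv)

lemma smooth_on_imp_continuous_on: "V \<subseteq> rspace n \<Longrightarrow> smooth_on n V f \<Longrightarrow> continuous_on V f"
  by (auto simp: smooth_on_def intro: Ck_on_imp_continuous_on)

lemma smooth_on_local:
  assumes "ropen n V"
    and "\<And>x. x \<in> V \<Longrightarrow> \<exists>W. ropen n W \<and> x \<in> W \<and> smooth_on n (V \<inter> W) f"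
  shows "smooth_on n V f"
  unfolding smooth_on_def
proof
  fix k show "Ck_on k n V f"
    by (rule Ck_on_local[OF assms(1)]) (use assms(2) in \<open>auto simp: smooth_on_def\<close>)
qed

lemma smooth_on_compose:
  assumes "ropen n V" "ropen m W" "smooth_on m W F"
    and "\<And>i. i < m \<Longrightarrow> smooth_on n V (\<lambda>x. H x i)" "H ` V \<subseteq> W"
  shows "smooth_on n V (\<lambda>x. F (H x))"
  unfolding smooth_on_def
proof
  fix k show "Ck_on k n V (\<lambda>x. F (H x))"
    by (rule Ck_on_compose[OF assms(1,2) _ _ assms(5)]) (use assms(3,4) in \<open>auto simp: smooth_on_def\<close>)
qed

context
  fixes n :: nat and V :: "(nat \<Rightarrow> real) set"
  assumes V: "ropen n V"
begin

lemma smooth_on_add: "smooth_on n V f \<Longrightarrow> smooth_on n V g \<Longrightarrow> smooth_on n V (\<lambda>x. f x + g x)"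
  by (simp add: smooth_on_def Ck_on_add[OF V])

lemma smooth_on_mult: "smooth_on n V f \<Longrightarrow> smooth_on n V g \<Longrightarrow> smooth_on n V (\<lambda>x. f x * g x)"
  by (simp add: smooth_on_def Ck_on_mult[OF V])

lemma smooth_on_diff: "smooth_on n V f \<Longrightarrow> smooth_on n V g \<Longrightarrow> smooth_on n V (\<lambda>x. f x - g x)"
  using smooth_on_add[OF _ smooth_on_mult[OF smooth_on_const[of n V "-1"]], of f g] by simp

lemma smooth_on_sum: "(\<And>i. i \<in> I \<Longrightarrow> smooth_on n V (f i)) \<Longrightarrow> smooth_on n V (\<lambda>x. \<Sum>i\<in>I. f i x)"
  by (simp add: smooth_on_def Ck_on_sum[OF V])

lemma smooth_on_inverse:
  "smooth_on n V f \<Longrightarrow> (\<And>x. x \<in> V \<Longrightarrow> f x \<noteq> 0) \<Longrightarrow> smooth_on n V (\<lambda>x. inverse (f x))"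
  by (simp add: smooth_on_def Ck_on_inverse[OF V])

end

subsection \<open>Hadamard's lemma\<close>

definition segment_point :: "(nat \<Rightarrow> real) \<Rightarrow> real \<Rightarrow> (nat \<Rightarrow> real) \<Rightarrow> nat \<Rightarrow> real" where
  "segment_point p t x = (\<lambda>i. p i + t * (x i - p i))"

lemma segment_point_in_cube:
  assumes "p \<in> rspace n" "x \<in> cube n p d" "0 \<le> t" "t \<le> 1"
  shows "segment_point p t x \<in> cube n p d"
proof -
  have le: "\<bar>t * (x i - p i)\<bar> \<le> \<bar>x i - p i\<bar>" for i
    using assms(3,4) by (simp add: abs_mult mult_left_le_one_le)
  then show ?thesis
    using assms(1,2) unfolding cube_def segment_point_def by (auto intro: order_le_less_trans[OF le])
qed

lemma continuous_on_segment_point: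
  assumes p: "p \<in> rspace n" and h: "continuous_on (cube n p d) h"
  shows "continuous_on (cube n p d \<times> {0..1}) (\<lambda>(x, t). t ^ m * h (segment_point p t x))"
proof -
  have coord: "continuous_on S (\<lambda>y. (fst y :: nat \<Rightarrow> real) i)" for S :: "((nat \<Rightarrow> real) \<times> real) set" and i
    by (rule continuous_on_compose2[OF continuous_on_product_coordinates[of i] continuous_on_fst])
      (auto intro: continuous_on_id)
  have "continuous_on (cube n p d \<times> {0..1}) (\<lambda>y. segment_point p (snd y) (fst y))"
    unfolding segment_point_def
    by (intro continuous_on_coordinatewise_then_product continuous_intros coord)
  then have "continuous_on (cube n p d \<times> {0..1}) (\<lambda>y. h (segment_point p (snd y) (fst y)))"
    by (rule continuous_on_compose2[OF h]) (auto intro!: segment_point_in_cube[OF p])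
  then show ?thesis
    unfolding case_prod_beta by (intro continuous_intros)
qed

text \<open>The weight \<open>t ^ m\<close> is there for the induction: differentiating under the
  integral sign brings out a factor \<open>t\<close>, the derivative of the segment point in
  coordinate \<open>j\<close>, so the derivative is again such an integral, with
  \<open>Suc m\<close>.\<close>

lemma Ck_on_integral_segment:
  assumes p: "p \<in> rspace n" and h: "smooth_on n (cube n p d) h"
  shows "Ck_on k n (cube n p d) (\<lambda>x. integral {0..1} (\<lambda>t. t ^ m * h (segment_point p t x)))"
proof -
  let ?V = "cube n p d"
  have V: "ropen n ?V" and sub: "?V \<subseteq> rspace n"
    by (rule openin_cube) (auto simp: cube_def)
  have cont: "continuous_on ?V (\<lambda>x. integral {0..1} (\<lambda>t. t ^ m * h (segment_point p t x)))"
    if "smooth_on n ?V h" for h m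
    using integral_continuous_on_param[of ?V 0 1 "\<lambda>x t. t ^ m * h (segment_point p t x)"]
      continuous_on_segment_point[OF p smooth_on_imp_continuous_on[OF sub that]]
    by (simp add: cbox_interval)
  show ?thesis
    using h
  proof (induction k arbitrary: h m)
    case 0
    then show ?case using cont[OF 0] by (simp add: Ck_on_0[OF sub])
  next
    case (Suc k)
    show ?case
    proof (rule Ck_on_SucI[OF V cont[OF Suc.prems],
        where f' = "\<lambda>j x. integral {0..1} (\<lambda>t. t ^ Suc m * partial_deriv j h (segment_point p t x))"])
      fix j assume j: "j < n"
      have h': "smooth_on n ?V (partial_deriv j h)"
        using Suc.prems j by (rule smooth_on_partial_deriv)
      show "Ck_on k n ?V (\<lambda>x. integral {0..1} (\<lambda>t. t ^ Suc m * partial_deriv j h (segment_point p t x)))"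
        using h' by (rule Suc.IH)
      fix x assume x: "x \<in> ?V"
      let ?U = "ball (p j) d"
      have upd: "x(j := s) \<in> ?V" if "s \<in> ?U" for s
        using that x j by (auto simp: cube_def dist_real_def abs_minus_commute)
      have contU: "continuous_on (?U \<times> {0..1}) (\<lambda>(s, t). t ^ l * g (segment_point p t (x(j := s))))"
        if g: "smooth_on n ?V g" for g l
      proof -
        have "continuous_on (?U \<times> {0..1}) (\<lambda>y :: real \<times> real. (x(j := fst y), snd y))"
        proof (intro continuous_on_Pair continuous_on_coordinatewise_then_product)
          fix i
          show "continuous_on (?U \<times> {0..1}) (\<lambda>y :: real \<times> real. (x(j := fst y)) i)"
            by (cases "i = j") (auto intro!: continuous_intros)
        qed (intro continuous_intros)
        then show ?thesis
          using continuous_on_compose2[OF continuous_on_segment_point[OF p smooth_on_imp_continuous_on[OF sub g]],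
              of "?U \<times> {0..1}" "\<lambda>y. (x(j := fst y), snd y)" l] upd
          by (auto simp: case_prod_beta image_subset_iff)
      qed
      have "((\<lambda>s. integral (cbox 0 1) (\<lambda>t. t ^ m * h (segment_point p t (x(j := s))))) has_field_derivative
          integral (cbox 0 1) (\<lambda>t. t ^ Suc m * partial_deriv j h (segment_point p t (x(j := x j))))) (at (x j) within ?U)"
      proof (rule leibniz_rule_field_derivative[where
          fx = "\<lambda>s t. t ^ Suc m * partial_deriv j h (segment_point p t (x(j := s)))"])
        fix s t :: real assume s: "s \<in> ?U" and t: "t \<in> cbox 0 1"
        let ?y = "segment_point p t (x(j := s))"
        have y: "?y \<in> ?V" using segment_point_in_cube[OF p upd[OF s]] t by auto
        have "((\<lambda>u. h (?y(j := u))) has_real_derivative partial_deriv j h ?y) (at (?y j))"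
          using Suc.prems y j Ck_on_Suc[OF sub, of 0 h] unfolding smooth_on_def by blast
        moreover have "((\<lambda>s. p j + t * (s - p j)) has_real_derivative t) (at s within ?U)"
          by (auto intro!: derivative_eq_intros)
        ultimately have "((\<lambda>s'. h (?y(j := p j + t * (s' - p j)))) has_real_derivative partial_deriv j h ?y * t) (at s within ?U)"
          by (intro DERIV_chain2[where f = "\<lambda>u. h (?y(j := u))"]) (simp_all add: segment_point_def)
        moreover have "?y(j := p j + t * (s' - p j)) = segment_point p t (x(j := s'))" for s'
          by (auto simp: segment_point_def fun_eq_iff)
        ultimately have "((\<lambda>s. h (segment_point p t (x(j := s)))) has_real_derivative
            partial_deriv j h ?y * t) (at s within ?U)"
          by (simp only:)
        from DERIV_cmult[OF this, of "t ^ m"]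
        show "((\<lambda>s. t ^ m * h (segment_point p t (x(j := s)))) has_real_derivative
            t ^ Suc m * partial_deriv j h ?y) (at s within ?U)"
          by (simp add: mult_ac)
      next
        fix s assume s: "s \<in> ?U"
        have "continuous_on {0..1} (\<lambda>t::real. (s, t))"
          by (intro continuous_intros)
        with contU[OF Suc.prems]
        have "continuous_on {0..1} (\<lambda>t. case (s, t) of (s, t) \<Rightarrow> t ^ m * h (segment_point p t (x(j := s))))"
          by (rule continuous_on_compose2) (use s in auto)
        then have "continuous_on {0..1} (\<lambda>t. t ^ m * h (segment_point p t (x(j := s))))"
          by simp
        then show "(\<lambda>t. t ^ m * h (segment_point p t (x(j := s)))) integrable_on cbox 0 1"
          unfolding cbox_interval by (rule integrable_continuous_real)
      next
        show "continuous_on (?U \<times> cbox 0 1) (\<lambda>(s, t). t ^ Suc m * partial_deriv j h (segment_point p t (x(j := s))))"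
          unfolding cbox_interval by (rule contU[OF h'])
        show "x j \<in> ?U" using x j by (auto simp: cube_def dist_real_def abs_minus_commute)
      qed auto
      moreover have "x j \<in> ?U" using x j by (auto simp: cube_def dist_real_def abs_minus_commute)
      ultimately show "((\<lambda>s. integral {0..1} (\<lambda>t. t ^ m * h (segment_point p t (x(j := s))))) has_real_derivative
          integral {0..1} (\<lambda>t. t ^ Suc m * partial_deriv j h (segment_point p t x))) (at (x j))"
        by (simp only: cbox_interval fun_upd_triv at_within_open[OF _ open_ball])
    qed
  qed
qed

text \<open>The derivative of \<open>f\<close> is integrated along the segment from \<open>p\<close>
  to \<open>x\<close>; the coefficient of \<open>x i - p i\<close> is the mean of the partial
  derivative of index \<open>i\<close> over that segment.\<close>

lemma Hadamard:
  assumes p: "p \<in> rspace n" and f: "smooth_on n (cube n p d) f"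
  shows "\<exists>g. (\<forall>i<n. smooth_on n (cube n p d) (g i)) \<and>
    (\<forall>x\<in>cube n p d. f x = f p + (\<Sum>i<n. (x i - p i) * g i x))"
proof -
  let ?V = "cube n p d"
  have sub: "?V \<subseteq> rspace n" by (auto simp: cube_def)
  define g where "g i x = integral {0..1} (\<lambda>t. t ^ 0 * partial_deriv i f (segment_point p t x))" for i x
  have f': "smooth_on n ?V (partial_deriv i f)" if "i < n" for i
    using f that by (rule smooth_on_partial_deriv)
  have "smooth_on n ?V (g i)" if "i < n" for i
    unfolding smooth_on_def g_def using Ck_on_integral_segment[OF p f'[OF that]] by blast
  moreover have "f x = f p + (\<Sum>i<n. (x i - p i) * g i x)" if x: "x \<in> ?V" for x
  proof -
    have "((\<lambda>t. f (segment_point p t x)) has_real_derivative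
        (\<Sum>i<n. partial_deriv i f (segment_point p t x) * (x i - p i))) (at t)" if t: "t \<in> {0..1}" for t
    proof (rule has_real_derivative_along_curve[OF openin_cube])
      show "Ck_on 1 n ?V f" using f by (simp add: smooth_on_def)
      show "((\<lambda>t. segment_point p t x i) has_real_derivative (x i - p i)) (at t)" for i
        unfolding segment_point_def by (auto intro!: derivative_eq_intros)
      show "segment_point p t x \<in> ?V" using segment_point_in_cube[OF p x] t by auto
      show "\<forall>\<^sub>F t in at t. segment_point p t x \<in> rspace n"
        using p x by (auto simp: segment_point_def cube_def)
    qed
    then have "((\<lambda>t. \<Sum>i<n. partial_deriv i f (segment_point p t x) * (x i - p i)) has_integral
        f (segment_point p 1 x) - f (segment_point p 0 x)) {0..1}"
      by (intro fundamental_theorem_of_calculus)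
        (auto simp: has_real_derivative_iff_has_vector_derivative[symmetric] intro: has_field_derivative_at_within)
    moreover have "((\<lambda>t. \<Sum>i<n. partial_deriv i f (segment_point p t x) * (x i - p i)) has_integral
        (\<Sum>i<n. g i x * (x i - p i))) {0..1}"
    proof (intro has_integral_sum has_integral_mult_left)
      fix i assume "i \<in> {..<n}"
      then have "continuous_on (?V \<times> {0..1}) (\<lambda>(x, t). t ^ 0 * partial_deriv i f (segment_point p t x))"
        using f' by (intro continuous_on_segment_point[OF p] smooth_on_imp_continuous_on[OF sub]) auto
      moreover have "continuous_on {0..1} (\<lambda>t::real. (x, t))"
        by (intro continuous_intros)
      ultimately have "continuous_on {0..1} (\<lambda>t. case (x, t) of (x, t) \<Rightarrow> t ^ 0 * partial_deriv i f (segment_point p t x))"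
        by (rule continuous_on_compose2) (use x in auto)
      then have "continuous_on {0..1} (\<lambda>t. t ^ 0 * partial_deriv i f (segment_point p t x))"
        by simp
      then show "((\<lambda>t. partial_deriv i f (segment_point p t x)) has_integral g i x) {0..1}"
        unfolding g_def power_0 mult_1 by (intro integrable_integral integrable_continuous_real)
    qed simp
    ultimately have "f (segment_point p 1 x) - f (segment_point p 0 x) = (\<Sum>i<n. g i x * (x i - p i))"
      by (rule has_integral_unique)
    moreover have "segment_point p 1 x = x" "segment_point p 0 x = p"
      by (auto simp: segment_point_def)
    ultimately show ?thesis by (simp add: mult.commute)
  qed
  ultimately show ?thesis by blast
qed

subsection \<open>Plateau functions\<close>

text \<open>The classical flat function \<open>exp (- 1/t)\<close>, with inverse powers of
  \<open>t\<close> included so that the family is closed under linear combinations of derivatives.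
  Smoothness can then be proved by induction for all \<open>m\<close> at once.\<close>

definition exp_flat :: "nat \<Rightarrow> real \<Rightarrow> real" where
  "exp_flat m t = (if t > 0 then exp (- inverse t) * inverse t ^ m else 0)"

lemma exp_flat_tendsto_0: "(exp_flat m \<longlongrightarrow> 0) (at 0)"
proof -
  have "((\<lambda>t. inverse t ^ m / exp (inverse t)) \<longlongrightarrow> 0) (at_right (0::real))"
    using tendsto_power_div_exp_0[of m] filterlim_inverse_at_top_right
    by (rule filterlim_compose)
  moreover have "\<forall>\<^sub>F t in at_right 0. inverse t ^ m / exp (inverse t) = exp_flat m t"
    using eventually_at_right_less[of 0]
    by eventually_elim (simp add: exp_flat_def exp_minus field_simps)
  ultimately have "(exp_flat m \<longlongrightarrow> 0) (at_right 0)"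
    by (rule Lim_transform_eventually)
  moreover have "(exp_flat m \<longlongrightarrow> 0) (at_left 0)"
    by (rule tendsto_eventually, rule eventually_at_leftI[of "-1"]) (auto simp: exp_flat_def)
  ultimately show ?thesis by (rule filterlim_split_at[rotated])
qed

lemma DERIV_exp_flat:
  "(exp_flat m has_real_derivative exp_flat (m + 2) t - m * exp_flat (m + 1) t) (at t)"
proof -
  consider "t > 0" | "t = 0" | "t < 0" by linarith
  then show ?thesis
  proof cases
    case 1
    have "((\<lambda>t. exp (- inverse t) * inverse t ^ m) has_real_derivative
        exp_flat (m + 2) t - m * exp_flat (m + 1) t) (at t)"
      using 1 by (auto intro!: derivative_eq_intros simp: exp_flat_def field_simps power2_eq_square)
        (cases m; simp add: field_simps)
    then show ?thesis
      by (rule has_field_derivative_transform_within_open[where S = "{0<..}"])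
        (use 1 in \<open>auto simp: exp_flat_def\<close>)
  next
    case 2
    \<comment> \<open>At 0 the difference quotient is the next member of the family, so its limit 0
      is already known.\<close>
    have "(\<lambda>y. (exp_flat m y - exp_flat m 0) / (y - 0)) = exp_flat (m + 1)"
      by (auto simp: exp_flat_def fun_eq_iff field_simps)
    then show ?thesis
      using exp_flat_tendsto_0[of "m + 1"] 2 by (simp add: has_field_derivative_iff exp_flat_def)
  next
    case 3
    have "((\<lambda>t. 0) has_real_derivative exp_flat (m + 2) t - m * exp_flat (m + 1) t) (at t)"
      using 3 by (simp add: exp_flat_def)
    then show ?thesis
      by (rule has_field_derivative_transform_within_open[where S = "{..<0}"])
        (use 3 in \<open>auto simp: exp_flat_def\<close>)
  qed
qed

lemma smooth_on_exp_flat: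
  assumes V: "ropen n V" and u: "smooth_on n V u"
  shows "smooth_on n V (\<lambda>x. exp_flat m (u x))"
proof -
  note sub = openin_Euclidean_space_subset[OF V]
  have cont: "continuous_on V (\<lambda>x. exp_flat m (u x))" for m
    by (rule continuous_on_compose2[OF _ smooth_on_imp_continuous_on[OF sub u], of UNIV])
      (auto intro: DERIV_continuous_on DERIV_exp_flat)
  have "Ck_on k n V (\<lambda>x. exp_flat m (u x))" for k
  proof (induction k arbitrary: m)
    case 0
    then show ?case using cont by (simp add: Ck_on_0[OF sub])
  next
    case (Suc k)
    show ?case
    proof (rule Ck_on_SucI[OF V cont, where f' = "\<lambda>i x.
        (exp_flat (m + 2) (u x) + (- m) * exp_flat (m + 1) (u x)) * partial_deriv i u x"])
      fix i assume i: "i < n"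
      have "Ck_on k n V (partial_deriv i u)"
        using smooth_on_partial_deriv[OF u i] by (simp add: smooth_on_def)
      then show "Ck_on k n V (\<lambda>x. (exp_flat (m + 2) (u x) + (- m) * exp_flat (m + 1) (u x)) * partial_deriv i u x)"
        by (intro Ck_on_mult[OF V] Ck_on_add[OF V] Ck_on_const Suc.IH)
      fix x assume x: "x \<in> V"
      have "((\<lambda>t. u (x(i := t))) has_real_derivative partial_deriv i u x) (at (x i))"
        using u x i Ck_on_Suc[OF sub, of 0 u] unfolding smooth_on_def by blast
      then show "((\<lambda>t. exp_flat m (u (x(i := t)))) has_real_derivative
          (exp_flat (m + 2) (u x) + (- m) * exp_flat (m + 1) (u x)) * partial_deriv i u x) (at (x i))"
        using DERIV_chain2[of "exp_flat m" _ "\<lambda>t. u (x(i := t))" "x i"] DERIV_exp_flat[of m "u x"] by auto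
    qed
  qed
  then show ?thesis by (simp add: smooth_on_def)
qed

lemma smooth_plateau:
  assumes p: "p \<in> rspace n" and r: "r > 0"
  obtains b d where "smooth_on n (rspace n) b" "0 < d" "d \<le> r" "\<forall>x\<in>cube n p d. b x = 1"
    "\<forall>x\<in>rspace n. b x \<noteq> 0 \<longrightarrow> (\<forall>i<n. \<bar>x i - p i\<bar> \<le> r)"
proof -
  have top: "ropen n (rspace n)"
    using openin_topspace[of "Euclidean_space n"] by (simp add: topspace_Euclidean_space)
  define u where "u x = (\<Sum>i<n. (x i - p i) * (x i - p i))" for x :: "nat \<Rightarrow> real"
  \<comment> \<open>The plateau is \<open>A / (A + B)\<close>. \<open>A\<close> is positive exactly
    where \<open>u < r^2\<close> and \<open>B\<close> exactly where \<open>u > r^2 / 2\<close>; the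
    two regions cover the space, so the denominator never vanishes, and the quotient is 1 where
    \<open>B\<close> is 0.\<close>
  define A where "A x = exp_flat 0 (r\<^sup>2 - u x)" for x
  define B where "B x = exp_flat 0 (u x - r\<^sup>2 / 2)" for x
  \<comment> \<open>On the cube of this size \<open>u\<close> is at most
    \<open>n * r^2 / (2 * (n + 1))\<close>, hence at most \<open>r^2 / 2\<close>, so
    \<open>B\<close> vanishes there. The summand 1 keeps the divisor positive for
    \<open>n = 0\<close>.\<close>
  define d where "d = r / sqrt (2 * (real n + 1))"
  have u: "smooth_on n (rspace n) u"
    unfolding u_def
    by (intro smooth_on_sum[OF top] smooth_on_mult[OF top] smooth_on_diff[OF top] smooth_on_const smooth_on_coord) auto
  have AB: "A x + B x \<noteq> 0" for x
  proof -
    have "A x \<ge> 0" "B x \<ge> 0" by (auto simp: A_def B_def exp_flat_def)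
    moreover have "A x > 0 \<or> B x > 0"
    proof (cases "u x < r\<^sup>2")
      case False
      have "r\<^sup>2 > 0" using r by simp
      then have "u x > r\<^sup>2 / 2" using False by linarith
      then show ?thesis by (simp add: B_def exp_flat_def)
    qed (simp add: A_def exp_flat_def)
    ultimately show ?thesis by linarith
  qed
  have "smooth_on n (rspace n) (\<lambda>x. A x * inverse (A x + B x))"
    unfolding A_def B_def
    by (intro smooth_on_mult[OF top] smooth_on_inverse[OF top] smooth_on_add[OF top] smooth_on_exp_flat[OF top]
        smooth_on_diff[OF top] smooth_on_const u) (use AB in \<open>auto simp: A_def B_def\<close>)
  moreover have "0 < d" "d \<le> r"
  proof -
    have "sqrt (2 * (real n + 1)) \<ge> sqrt 1" by (intro real_sqrt_le_mono) simp
    then show "0 < d" "d \<le> r" using r by (auto simp: d_def field_simps)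
  qed
  moreover have "A x * inverse (A x + B x) = 1" if x: "x \<in> cube n p d" for x
  proof -
    have "(x i - p i) * (x i - p i) \<le> r\<^sup>2 / (2 * (real n + 1))" if "i < n" for i
    proof -
      have "\<bar>x i - p i\<bar> \<le> d" using x that by (auto simp: cube_def intro: less_imp_le)
      then have "(x i - p i)\<^sup>2 \<le> d\<^sup>2" by (metis abs_le_square_iff abs_of_pos \<open>0 < d\<close>)
      then show ?thesis by (simp add: d_def power_divide power2_eq_square)
    qed
    then have "u x \<le> (\<Sum>i<n. r\<^sup>2 / (2 * (real n + 1)))"
      unfolding u_def by (intro sum_mono) auto
    also have "\<dots> \<le> r\<^sup>2 / 2" by (simp add: field_simps)
    finally have "B x = 0" by (simp add: B_def exp_flat_def)
    then show ?thesis using AB[of x] by simp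
  qed
  moreover have "\<forall>i<n. \<bar>x i - p i\<bar> \<le> r" if "A x * inverse (A x + B x) \<noteq> 0" for x
  proof (intro allI impI)
    fix i assume i: "i < n"
    have "u x < r\<^sup>2" using that by (auto simp: A_def exp_flat_def split: if_splits)
    moreover have "(x i - p i) * (x i - p i) \<le> u x"
      unfolding u_def using i by (intro member_le_sum) auto
    ultimately have "(x i - p i)\<^sup>2 \<le> r\<^sup>2" by (simp add: power2_eq_square)
    then show "\<bar>x i - p i\<bar> \<le> r" using r by (simp add: abs_le_square_iff[symmetric])
  qed
  ultimately show ?thesis using that[of "\<lambda>x. A x * inverse (A x + B x)" d] by blast
qed

section \<open>Smooth functions and derivations on manifolds\<close>

text \<open>The chart is taken from the maximal atlas so that the charts given by local
  trivializations can serve as witnesses directly.\<close>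

definition smooth_at :: "'a::topological_space manifold \<Rightarrow> ('a \<Rightarrow> real) \<Rightarrow> 'a \<Rightarrow> bool" where
  "smooth_at M f p \<longleftrightarrow> (\<exists>U \<phi> W. (U, \<phi>) \<in> maximal_atlas M \<and> open W \<and> p \<in> W \<and> W \<subseteq> U \<and>
     smooth_on (mdim M) (\<phi> ` W) (\<lambda>x. f (inv_into U \<phi> x)))"

section \<open>Topological properties of charts\<close>

context
  fixes n :: nat and U :: "'a::topological_space set" and \<phi> :: "'a \<Rightarrow> nat \<Rightarrow> real"
  assumes chart: "is_chart n (U, \<phi>)"
begin

lemma chart_open: "open U"
  using chart by (simp add: is_chart_def)

lemma chart_inj_on: "inj_on \<phi> U"
  using chart homeomorphic_imp_injective_map by (fastforce simp: is_chart_def)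

lemma chart_inv_into [simp]: "p \<in> U \<Longrightarrow> inv_into U \<phi> (\<phi> p) = p"
  using chart_inj_on by simp

lemma chart_image_openin:
  assumes "open W" "W \<subseteq> U"
  shows "ropen n (\<phi> ` W)"
proof -
  have "open_map (top_of_set U) (subtopology (Euclidean_space n) (\<phi> ` U)) \<phi>"
    using chart homeomorphic_imp_open_map by (auto simp: is_chart_def)
  then have "openin (subtopology (Euclidean_space n) (\<phi> ` U)) (\<phi> ` W)"
    using assms by (auto simp: open_map_def openin_open)
  moreover have "ropen n (\<phi> ` U)"
    using chart by (simp add: is_chart_def)
  ultimately show ?thesis by (simp add: openin_open_subtopology)
qed

lemma chart_mem_rspace: "p \<in> U \<Longrightarrow> \<phi> p \<in> rspace n"
  using openin_Euclidean_space_subset[OF chart_image_openin[OF chart_open order.refl]] by blast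

lemma chart_top: "subtopology (Euclidean_space n) (\<phi> ` U) = top_of_set (\<phi> ` U)"
proof -
  have "rspace n \<inter> \<phi> ` U = \<phi> ` U" using chart_mem_rspace by auto
  then show ?thesis by (simp add: Euclidean_space_top_of_set subtopology_subtopology)
qed

lemma chart_continuous_on: "continuous_on U \<phi>"
  using chart homeomorphic_imp_continuous_map[of "top_of_set U" "top_of_set (\<phi> ` U)" \<phi>]
  by (simp add: is_chart_def chart_top)

lemma chart_inv_continuous_on: "continuous_on (\<phi> ` U) (inv_into U \<phi>)"
proof (rule continuous_on_inverse_open_map[OF chart_continuous_on refl])
  fix W assume "openin (top_of_set U) W"
  then show "openin (top_of_set (\<phi> ` U)) (\<phi> ` W)"
    using chart homeomorphic_imp_open_map[of "top_of_set U" "top_of_set (\<phi> ` U)" \<phi>]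
    by (simp add: is_chart_def chart_top open_map_def)
qed simp

lemma chart_preimage_open:
  assumes "ropen n V"
  shows "open {p \<in> U. \<phi> p \<in> V}"
proof -
  obtain T where T: "open T" "V = rspace n \<inter> T"
    using assms by (auto simp: openin_Euclidean_space_iff)
  have "open (U \<inter> \<phi> -` T)"
    using chart_continuous_on chart_open T(1) by (simp add: continuous_on_open_vimage Int_commute)
  moreover have "{p \<in> U. \<phi> p \<in> V} = U \<inter> \<phi> -` T"
    using chart_mem_rspace T(2) by auto
  ultimately show ?thesis by simp
qed

end

lemma maximal_atlas_is_chart: "(U, \<phi>) \<in> maximal_atlas M \<Longrightarrow> is_chart (mdim M) (U, \<phi>)"
  by (simp add: maximal_atlas_def)

context
  fixes M :: "'a::{t2_space,second_countable_topology} manifold"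
  assumes M: "smooth_manifold M"
begin

lemma atlas_subset_maximal_atlas: "atlas M \<subseteq> maximal_atlas M"
  using M by (auto simp: smooth_manifold_def maximal_atlas_def)

lemma atlas_covers:
  obtains U \<phi> where "(U, \<phi>) \<in> atlas M" "p \<in> U"
proof -
  have "p \<in> (\<Union>c\<in>atlas M. fst c)" using M by (simp add: smooth_manifold_def)
  then show ?thesis using that by force
qed

lemma maximal_atlas_covers:
  obtains U \<phi> where "(U, \<phi>) \<in> maximal_atlas M" "p \<in> U"
  using atlas_covers atlas_subset_maximal_atlas by blast

text \<open>The maximal atlas only promises compatibility with the charts of the atlas. Near each
  point one such chart \<open>\<alpha>\<close> is inserted, and the transition is the composite of
  those from \<open>\<phi>\<close> to \<open>\<alpha>\<close> and from \<open>\<alpha>\<close> to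
  \<open>\<psi>\<close>.\<close>

lemma maximal_atlas_transition:
  assumes c: "(U, \<phi>) \<in> maximal_atlas M" and d: "(V, \<psi>) \<in> maximal_atlas M" and i: "i < mdim M"
  shows "smooth_on (mdim M) (\<phi> ` (U \<inter> V)) (\<lambda>x. \<psi> (inv_into U \<phi> x) i)"
proof (rule smooth_on_local)
  note cU = maximal_atlas_is_chart[OF c] and cV = maximal_atlas_is_chart[OF d]
  note open' = chart_open[OF cU] chart_open[OF cV]
  show "ropen (mdim M) (\<phi> ` (U \<inter> V))"
    by (intro chart_image_openin[OF cU] open_Int open') auto
  fix x assume "x \<in> \<phi> ` (U \<inter> V)"
  then obtain p where p: "x = \<phi> p" "p \<in> U" "p \<in> V" by auto
  obtain A \<alpha> where A: "(A, \<alpha>) \<in> atlas M" "p \<in> A" using atlas_covers by blast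
  then have A': "(A, \<alpha>) \<in> maximal_atlas M" using atlas_subset_maximal_atlas by blast
  note cA = maximal_atlas_is_chart[OF A']
  let ?W = "U \<inter> V \<inter> A"
  have opW: "ropen (mdim M) (\<phi> ` ?W)"
    by (intro chart_image_openin[OF cU] open_Int open' chart_open[OF cA]) auto
  have "smooth_on (mdim M) (\<phi> ` ?W) (\<lambda>x. \<psi> (inv_into A \<alpha> (\<alpha> (inv_into U \<phi> x))) i)"
  proof (rule smooth_on_compose[OF opW, where F = "\<lambda>y. \<psi> (inv_into A \<alpha> y) i"
        and H = "\<lambda>x. \<alpha> (inv_into U \<phi> x)"])
    show "ropen (mdim M) (\<alpha> ` (A \<inter> V))"
      by (intro chart_image_openin[OF cA] open_Int open' chart_open[OF cA]) auto
    show "smooth_on (mdim M) (\<alpha> ` (A \<inter> V)) (\<lambda>y. \<psi> (inv_into A \<alpha> y) i)"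
      using d A(1) i by (auto simp: maximal_atlas_def smooth_transition_def)
    show "smooth_on (mdim M) (\<phi> ` ?W) (\<lambda>x. \<alpha> (inv_into U \<phi> x) j)" if "j < mdim M" for j
    proof (rule smooth_on_subset)
      show "smooth_on (mdim M) (\<phi> ` (U \<inter> A)) (\<lambda>x. \<alpha> (inv_into U \<phi> x) j)"
        using c A(1) that by (auto simp: maximal_atlas_def smooth_transition_def)
    qed auto
    show "(\<lambda>x. \<alpha> (inv_into U \<phi> x)) ` \<phi> ` ?W \<subseteq> \<alpha> ` (A \<inter> V)"
      using chart_inv_into[OF cU] by auto
  qed
  then have "smooth_on (mdim M) (\<phi> ` ?W) (\<lambda>x. \<psi> (inv_into U \<phi> x) i)"
    by (subst smooth_on_cong[OF opW]) (auto simp: chart_inv_into[OF cU] chart_inv_into[OF cA])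
  moreover have "\<phi> ` (U \<inter> V) \<inter> \<phi> ` ?W = \<phi> ` ?W" by auto
  ultimately show "\<exists>W. ropen (mdim M) W \<and> x \<in> W \<and>
      smooth_on (mdim M) (\<phi> ` (U \<inter> V) \<inter> W) (\<lambda>x. \<psi> (inv_into U \<phi> x) i)"
    using opW p A(2) by (intro exI[of _ "\<phi> ` ?W"]) auto
qed

section \<open>Smoothness at a point and its independence of the chart\<close>

lemma smooth_at_in_chart:
  assumes f: "smooth_at M f p" and V: "(V, \<psi>) \<in> maximal_atlas M" "p \<in> V"
  obtains W where "open W" "p \<in> W" "W \<subseteq> V" "smooth_on (mdim M) (\<psi> ` W) (\<lambda>x. f (inv_into V \<psi> x))"
proof -
  obtain U \<phi> W where W: "(U, \<phi>) \<in> maximal_atlas M" "open W" "p \<in> W" "W \<subseteq> U"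
    "smooth_on (mdim M) (\<phi> ` W) (\<lambda>x. f (inv_into U \<phi> x))"
    using f by (auto simp: smooth_at_def)
  note cU = maximal_atlas_is_chart[OF W(1)] and cV = maximal_atlas_is_chart[OF V(1)]
  let ?W = "W \<inter> V"
  have open': "open ?W" using W chart_open[OF cV] by auto
  have opW: "ropen (mdim M) (\<psi> ` ?W)"
    by (intro chart_image_openin[OF cV] open') auto
  have "smooth_on (mdim M) (\<psi> ` ?W) (\<lambda>x. f (inv_into U \<phi> (\<phi> (inv_into V \<psi> x))))"
  proof (rule smooth_on_compose[OF opW, where F = "\<lambda>x. f (inv_into U \<phi> x)"
        and H = "\<lambda>x. \<phi> (inv_into V \<psi> x)"])
    show "ropen (mdim M) (\<phi> ` W)"
      by (intro chart_image_openin[OF cU] W)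
    show "smooth_on (mdim M) (\<phi> ` W) (\<lambda>x. f (inv_into U \<phi> x))" by (rule W)
    show "smooth_on (mdim M) (\<psi> ` ?W) (\<lambda>x. \<phi> (inv_into V \<psi> x) i)" if "i < mdim M" for i
      by (rule smooth_on_subset[OF maximal_atlas_transition[OF V(1) W(1) that]]) (use W in auto)
    show "(\<lambda>x. \<phi> (inv_into V \<psi> x)) ` \<psi> ` ?W \<subseteq> \<phi> ` W"
      using chart_inv_into[OF cV] by auto
  qed
  then have "smooth_on (mdim M) (\<psi> ` ?W) (\<lambda>x. f (inv_into V \<psi> x))"
    by (subst smooth_on_cong[OF opW]) (use W in \<open>auto simp: chart_inv_into[OF cU] chart_inv_into[OF cV] subset_iff\<close>)
  then show ?thesis using that[of ?W] open' W V by auto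
qed

lemma smooth_on_chart_iff:
  assumes V: "(V, \<psi>) \<in> maximal_atlas M" and W: "open W" "W \<subseteq> V"
  shows "smooth_on (mdim M) (\<psi> ` W) (\<lambda>x. f (inv_into V \<psi> x)) \<longleftrightarrow> (\<forall>p\<in>W. smooth_at M f p)"
proof
  note cV = maximal_atlas_is_chart[OF V]
  assume R: "\<forall>p\<in>W. smooth_at M f p"
  show "smooth_on (mdim M) (\<psi> ` W) (\<lambda>x. f (inv_into V \<psi> x))"
  proof (rule smooth_on_local)
    show "ropen (mdim M) (\<psi> ` W)"
      by (intro chart_image_openin[OF cV] W)
    fix x assume "x \<in> \<psi> ` W"
    then obtain p where p: "p \<in> W" "x = \<psi> p" by auto
    then have "smooth_at M f p" "p \<in> V" using R W by auto
    then obtain W' where W': "open W'" "p \<in> W'" "W' \<subseteq> V" "smooth_on (mdim M) (\<psi> ` W') (\<lambda>x. f (inv_into V \<psi> x))"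
      using smooth_at_in_chart[OF _ V] by blast
    then show "\<exists>T. ropen (mdim M) T \<and> x \<in> T \<and>
        smooth_on (mdim M) (\<psi> ` W \<inter> T) (\<lambda>x. f (inv_into V \<psi> x))"
      using p by (intro exI[of _ "\<psi> ` W'"] conjI chart_image_openin[OF cV])
        (auto intro: smooth_on_subset)
  qed
qed (use assms in \<open>auto simp: smooth_at_def\<close>)

lemma smooth_functions_iff: "f \<in> smooth_functions M \<longleftrightarrow> (\<forall>p. smooth_at M f p)"
proof
  assume f: "f \<in> smooth_functions M"
  show "\<forall>p. smooth_at M f p"
  proof
    fix p
    obtain U \<phi> where U: "(U, \<phi>) \<in> atlas M" "p \<in> U" using atlas_covers by blast
    then have U': "(U, \<phi>) \<in> maximal_atlas M" using atlas_subset_maximal_atlas by blast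
    have "smooth_on (mdim M) (\<phi> ` U) (\<lambda>x. f (inv_into U \<phi> x))"
      using f U by (auto simp: smooth_functions_def)
    then show "smooth_at M f p"
      using U U' chart_open[OF maximal_atlas_is_chart[OF U']] unfolding smooth_at_def by blast
  qed
next
  assume f: "\<forall>p. smooth_at M f p"
  have "smooth_on (mdim M) (\<phi> ` U) (\<lambda>x. f (inv_into U \<phi> x))" if "(U, \<phi>) \<in> atlas M" for U \<phi>
  proof -
    have U: "(U, \<phi>) \<in> maximal_atlas M" using that atlas_subset_maximal_atlas by blast
    show ?thesis
      using smooth_on_chart_iff[OF U chart_open[OF maximal_atlas_is_chart[OF U]] order.refl] f by simp
  qed
  then show "f \<in> smooth_functions M"
    by (auto simp: smooth_functions_def)
qed

lemma smooth_functionsD: "f \<in> smooth_functions M \<Longrightarrow> smooth_at M f p"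
  by (simp add: smooth_functions_iff)

lemma smooth_at_cong:
  assumes "smooth_at M f p" "open N" "p \<in> N" "\<And>q. q \<in> N \<Longrightarrow> f q = g q"
  shows "smooth_at M g p"
proof -
  obtain U \<phi> W where W: "(U, \<phi>) \<in> maximal_atlas M" "open W" "p \<in> W" "W \<subseteq> U"
    "smooth_on (mdim M) (\<phi> ` W) (\<lambda>x. f (inv_into U \<phi> x))"
    using assms(1) by (auto simp: smooth_at_def)
  note cU = maximal_atlas_is_chart[OF W(1)]
  have opW: "ropen (mdim M) (\<phi> ` (W \<inter> N))"
    using W assms by (intro chart_image_openin[OF cU]) auto
  have "smooth_on (mdim M) (\<phi> ` (W \<inter> N)) (\<lambda>x. f (inv_into U \<phi> x))"
    by (rule smooth_on_subset[OF W(5)]) auto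
  then have "smooth_on (mdim M) (\<phi> ` (W \<inter> N)) (\<lambda>x. g (inv_into U \<phi> x))"
    by (subst (asm) smooth_on_cong[OF opW])
      (use W assms(4) in \<open>auto simp: chart_inv_into[OF cU] subset_iff\<close>)
  moreover have "open (W \<inter> N)" "p \<in> W \<inter> N" "W \<inter> N \<subseteq> U" using W assms by auto
  ultimately show ?thesis unfolding smooth_at_def using W(1) by blast
qed

lemma smooth_at_nhd:
  assumes "smooth_at M f p"
  obtains W where "open W" "p \<in> W" "\<And>q. q \<in> W \<Longrightarrow> smooth_at M f q"
proof -
  obtain U \<phi> W where W: "(U, \<phi>) \<in> maximal_atlas M" "open W" "p \<in> W" "W \<subseteq> U"
    "smooth_on (mdim M) (\<phi> ` W) (\<lambda>x. f (inv_into U \<phi> x))"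
    using assms by (auto simp: smooth_at_def)
  then have "smooth_at M f q" if "q \<in> W" for q using that unfolding smooth_at_def by blast
  with W show ?thesis using that by blast
qed

lemma smooth_at_isCont:
  assumes "smooth_at M f p"
  shows "isCont f p"
proof -
  obtain U \<phi> W where W: "(U, \<phi>) \<in> maximal_atlas M" "open W" "p \<in> W" "W \<subseteq> U"
    "smooth_on (mdim M) (\<phi> ` W) (\<lambda>x. f (inv_into U \<phi> x))"
    using assms by (auto simp: smooth_at_def)
  note cU = maximal_atlas_is_chart[OF W(1)]
  have "continuous_on (\<phi> ` W) (\<lambda>x. f (inv_into U \<phi> x))"
    by (rule smooth_on_imp_continuous_on[OF _ W(5)])
      (use openin_Euclidean_space_subset[OF chart_image_openin[OF cU]] W in blast)
  then have "continuous_on W (\<lambda>q. f (inv_into U \<phi> (\<phi> q)))"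
    by (rule continuous_on_compose2[OF _ continuous_on_subset[OF chart_continuous_on[OF cU]]]) (use W in auto)
  moreover have "f (inv_into U \<phi> (\<phi> q)) = f q" if "q \<in> W" for q
    using that W by (auto simp: chart_inv_into[OF cU] subset_iff)
  ultimately have "continuous_on W f" by (rule continuous_on_eq)
  then show ?thesis using W by (simp add: continuous_on_eq_continuous_at)
qed

lemma smooth_at_const: "smooth_at M (\<lambda>q. c) p"
proof -
  obtain U \<phi> where U: "(U, \<phi>) \<in> maximal_atlas M" "p \<in> U" using maximal_atlas_covers by blast
  then show ?thesis
    unfolding smooth_at_def
    using smooth_on_const chart_open[OF maximal_atlas_is_chart[OF U(1)]] by blast
qed

lemma smooth_at_coord:
  assumes U: "(U, \<phi>) \<in> maximal_atlas M" "p \<in> U"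
  shows "smooth_at M (\<lambda>q. \<phi> q i) p"
proof -
  note cU = maximal_atlas_is_chart[OF U(1)]
  have op: "ropen (mdim M) (\<phi> ` U)"
    by (rule chart_image_openin[OF cU chart_open[OF cU] order.refl])
  have "smooth_on (mdim M) (\<phi> ` U) (\<lambda>x. \<phi> (inv_into U \<phi> x) i)"
    using smooth_on_coord[OF openin_Euclidean_space_subset[OF op], of i]
    by (subst smooth_on_cong[OF op, where g = "\<lambda>x. x i"]) (auto simp: chart_inv_into[OF cU])
  then show ?thesis
    unfolding smooth_at_def using U chart_open[OF cU] by blast
qed

lemma smooth_at_map2:
  assumes f: "smooth_at M f p" and g: "smooth_at M g p"
    and h: "\<And>V f g. ropen (mdim M) V \<Longrightarrow> smooth_on (mdim M) V f \<Longrightarrow>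
      smooth_on (mdim M) V g \<Longrightarrow> smooth_on (mdim M) V (\<lambda>x. h (f x) (g x))"
  shows "smooth_at M (\<lambda>q. h (f q) (g q)) p"
proof -
  obtain U \<phi> where U: "(U, \<phi>) \<in> maximal_atlas M" "p \<in> U" using maximal_atlas_covers by blast
  obtain W1 where W1: "open W1" "p \<in> W1" "W1 \<subseteq> U" "smooth_on (mdim M) (\<phi> ` W1) (\<lambda>x. f (inv_into U \<phi> x))"
    using smooth_at_in_chart[OF f U] by blast
  obtain W2 where W2: "open W2" "p \<in> W2" "W2 \<subseteq> U" "smooth_on (mdim M) (\<phi> ` W2) (\<lambda>x. g (inv_into U \<phi> x))"
    using smooth_at_in_chart[OF g U] by blast
  let ?W = "W1 \<inter> W2"
  have "ropen (mdim M) (\<phi> ` ?W)"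
    using W1 W2 by (intro chart_image_openin[OF maximal_atlas_is_chart[OF U(1)]]) auto
  moreover have "smooth_on (mdim M) (\<phi> ` ?W) (\<lambda>x. f (inv_into U \<phi> x))"
    by (rule smooth_on_subset[OF W1(4)]) auto
  moreover have "smooth_on (mdim M) (\<phi> ` ?W) (\<lambda>x. g (inv_into U \<phi> x))"
    by (rule smooth_on_subset[OF W2(4)]) auto
  ultimately have "smooth_on (mdim M) (\<phi> ` ?W) (\<lambda>x. h (f (inv_into U \<phi> x)) (g (inv_into U \<phi> x)))"
    by (rule h)
  moreover have "open ?W" "p \<in> ?W" "?W \<subseteq> U" using W1 W2 by auto
  ultimately show ?thesis unfolding smooth_at_def using U(1) by blast
qed

lemma smooth_at_add: "smooth_at M f p \<Longrightarrow> smooth_at M g p \<Longrightarrow> smooth_at M (\<lambda>q. f q + g q) p"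
  by (rule smooth_at_map2) (auto intro: smooth_on_add)

lemma smooth_at_mult: "smooth_at M f p \<Longrightarrow> smooth_at M g p \<Longrightarrow> smooth_at M (\<lambda>q. f q * g q) p"
  by (rule smooth_at_map2) (auto intro: smooth_on_mult)

lemma smooth_at_sum: "(\<And>i. i \<in> I \<Longrightarrow> smooth_at M (f i) p) \<Longrightarrow> smooth_at M (\<lambda>q. \<Sum>i\<in>I. f i q) p"
  by (induction I rule: infinite_finite_induct) (simp_all add: smooth_at_const smooth_at_add)

lemma smooth_at_compose:
  assumes V: "ropen k V" and F: "smooth_on k V F"
    and N: "open N" "p \<in> N" "\<And>q. q \<in> N \<Longrightarrow> H q \<in> rspace k"
    and H: "\<And>i. i < k \<Longrightarrow> smooth_at M (\<lambda>q. H q i) p" and mem: "H p \<in> V"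
  shows "smooth_at M (\<lambda>q. F (H q)) p"
proof -
  have "\<exists>W. open W \<and> p \<in> W \<and> (\<forall>q\<in>W. smooth_at M (\<lambda>q. H q i) q)" if "i < k" for i
    using smooth_at_nhd[OF H[OF that]] by metis
  then obtain W where W: "\<And>i. i < k \<Longrightarrow> open (W i)" "\<And>i. i < k \<Longrightarrow> p \<in> W i"
    "\<And>i q. i < k \<Longrightarrow> q \<in> W i \<Longrightarrow> smooth_at M (\<lambda>q. H q i) q"
    by metis
  obtain U \<phi> where U: "(U, \<phi>) \<in> maximal_atlas M" "p \<in> U" using maximal_atlas_covers by blast
  note cU = maximal_atlas_is_chart[OF U(1)]
  let ?N = "U \<inter> N \<inter> (\<Inter>i\<in>{..<k}. W i)"
  have opN: "open ?N" using W N chart_open[OF cU] by (intro open_Int open_INT) auto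
  have pN: "p \<in> ?N" using U N W by auto
  have "continuous_on ?N H"
  proof (rule continuous_on_coordinatewise_then_product)
    fix i
    show "continuous_on ?N (\<lambda>q. H q i)"
    proof (cases "i < k")
      case True
      then show ?thesis
        using W(3) by (intro continuous_at_imp_continuous_on ballI smooth_at_isCont) auto
    next
      case False
      then have "H q i = 0" if "q \<in> ?N" for q using that N(3) by auto
      then show ?thesis using continuous_on_cong[OF refl, of ?N "\<lambda>q. H q i" "\<lambda>q. 0"] by simp
    qed
  qed
  moreover obtain T where T: "open T" "V = rspace k \<inter> T"
    using V by (auto simp: openin_Euclidean_space_iff)
  ultimately have "open (H -` T \<inter> ?N)"
    using opN by (simp add: continuous_on_open_vimage)
  moreover define W' where "W' = H -` T \<inter> ?N"
  ultimately have op': "open W'" by simp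
  have W': "p \<in> W'" "W' \<subseteq> U" "\<And>q. q \<in> W' \<Longrightarrow> H q \<in> V" "\<And>q i. q \<in> W' \<Longrightarrow> i < k \<Longrightarrow> smooth_at M (\<lambda>q. H q i) q"
    using pN mem T N W(3) by (auto simp: W'_def)
  have "smooth_on (mdim M) (\<phi> ` W') (\<lambda>x. F (H (inv_into U \<phi> x)))"
  proof (rule smooth_on_compose[OF chart_image_openin[OF cU op' W'(2)] V F])
    show "smooth_on (mdim M) (\<phi> ` W') (\<lambda>x. H (inv_into U \<phi> x) i)" if "i < k" for i
      using smooth_on_chart_iff[OF U(1) op' W'(2), of "\<lambda>q. H q i"] W'(4) that by blast
    show "(\<lambda>x. H (inv_into U \<phi> x)) ` \<phi> ` W' \<subseteq> V"
      using W'(2,3) by (auto simp: chart_inv_into[OF cU] subset_iff)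
  qed
  then show ?thesis unfolding smooth_at_def using U(1) op' W'(1,2) by blast
qed

lemma smooth_functions_const: "(\<lambda>q. c) \<in> smooth_functions M"
  by (simp add: smooth_functions_iff smooth_at_const)

lemma smooth_functions_0: "0 \<in> smooth_functions M"
  using smooth_functions_const[of 0] by (simp add: zero_fun_def)

lemma smooth_functions_add: "f \<in> smooth_functions M \<Longrightarrow> g \<in> smooth_functions M \<Longrightarrow> f + g \<in> smooth_functions M"
  by (simp add: smooth_functions_iff plus_fun_def smooth_at_add)

lemma smooth_functions_mult: "f \<in> smooth_functions M \<Longrightarrow> g \<in> smooth_functions M \<Longrightarrow> f * g \<in> smooth_functions M"
  by (simp add: smooth_functions_iff times_fun_def smooth_at_mult)

lemma smooth_functions_scale: "f \<in> smooth_functions M \<Longrightarrow> (\<lambda>q. c * f q) \<in> smooth_functions M"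
  by (simp add: smooth_functions_iff smooth_at_mult smooth_at_const)

lemma smooth_functions_uminus: "f \<in> smooth_functions M \<Longrightarrow> - f \<in> smooth_functions M"
  using smooth_functions_scale[of f "-1"] by (simp add: fun_Compl_def)

lemma smooth_functions_diff: "f \<in> smooth_functions M \<Longrightarrow> g \<in> smooth_functions M \<Longrightarrow> f - g \<in> smooth_functions M"
  using smooth_functions_add[of f "- g"] smooth_functions_uminus[of g] by simp

lemma smooth_functions_sum: "(\<And>i. i \<in> I \<Longrightarrow> f i \<in> smooth_functions M) \<Longrightarrow> (\<Sum>i\<in>I. f i) \<in> smooth_functions M"
  by (induction I rule: infinite_finite_induct) (simp_all add: smooth_functions_0 smooth_functions_add)

subsection \<open>Bump functions and local extensions\<close>

text \<open>A product of compact factors: intervals below \<open>n\<close>, and the singleton of 0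
  from \<open>n\<close> on.\<close>

lemma compact_closed_cube: "compact {x \<in> rspace n. \<forall>i<n. \<bar>x i - p i\<bar> \<le> r}"
proof -
  let ?K = "\<lambda>i. if i < n then {p i - r..p i + r} else {0}"
  have "compactin (product_topology (\<lambda>i::nat. euclideanreal) UNIV) (PiE UNIV ?K)"
    by (subst compactin_PiE) auto
  moreover have "x i \<in> ?K i \<longleftrightarrow> (i < n \<longrightarrow> \<bar>x i - p i\<bar> \<le> r) \<and> (i \<ge> n \<longrightarrow> x i = 0)" for x :: "nat \<Rightarrow> real" and i
    by auto
  then have "PiE UNIV ?K = {x \<in> rspace n. \<forall>i<n. \<bar>x i - p i\<bar> \<le> r}"
    unfolding PiE_UNIV_domain Pi_def by blast
  ultimately show ?thesis by (simp add: euclidean_product_topology)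
qed

text \<open>A plateau function is transported by a chart and extended by zero. The extension is
  smooth because the closed cube containing the support has compact image, and compact sets are
  closed in a Hausdorff space, so the function is zero on the open set \<open>- K\<close>.\<close>

lemma bump_function:
  assumes W: "open W" "p \<in> W"
  obtains b N K where "b \<in> smooth_functions M" "open N" "closed K" "p \<in> N" "N \<subseteq> K" "K \<subseteq> W"
    "\<forall>q\<in>N. b q = 1" "\<forall>q. q \<notin> K \<longrightarrow> b q = 0"
proof -
  let ?n = "mdim M"
  obtain U \<phi> where U: "(U, \<phi>) \<in> maximal_atlas M" "p \<in> U" using maximal_atlas_covers by blast
  note cU = maximal_atlas_is_chart[OF U(1)]
  have "ropen ?n (\<phi> ` (U \<inter> W))"
    using W chart_open[OF cU] by (intro chart_image_openin[OF cU]) auto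
  then obtain d0 where d0: "d0 > 0" "cube ?n (\<phi> p) d0 \<subseteq> \<phi> ` (U \<inter> W)"
    using cube_subset_openin[of ?n "\<phi> ` (U \<inter> W)" "\<phi> p"] U W by blast
  \<comment> \<open>Halving makes room for the closed cube of radius \<open>r\<close> inside the
    open one of radius \<open>d0\<close>.\<close>
  define r where "r = d0 / 2"
  have r: "r > 0" "r < d0" using d0 by (auto simp: r_def)
  note p' = chart_mem_rspace[OF cU U(2)]
  obtain b d where b: "smooth_on ?n (rspace ?n) b" "0 < d" "d \<le> r" "\<forall>x\<in>cube ?n (\<phi> p) d. b x = 1"
    "\<forall>x\<in>rspace ?n. b x \<noteq> 0 \<longrightarrow> (\<forall>i<?n. \<bar>x i - \<phi> p i\<bar> \<le> r)"
    using smooth_plateau[OF p' r(1)] by blast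
  define K0 where "K0 = {x \<in> rspace ?n. \<forall>i<?n. \<bar>x i - \<phi> p i\<bar> \<le> r}"
  define K where "K = inv_into U \<phi> ` K0"
  define N where "N = {q \<in> U. \<phi> q \<in> cube ?n (\<phi> p) d}"
  define B where "B q = (if q \<in> U then b (\<phi> q) else 0)" for q
  have K0: "K0 \<subseteq> \<phi> ` (U \<inter> W)"
    using d0(2) r by (force simp: K0_def cube_def)
  have "compact K"
    unfolding K_def K0_def
    by (rule compact_continuous_image[OF continuous_on_subset[OF chart_inv_continuous_on[OF cU]] compact_closed_cube])
      (use K0 in \<open>auto simp: K0_def\<close>)
  then have K: "closed K" by (rule compact_imp_closed)
  have KW: "K \<subseteq> U \<inter> W"
  proof
    fix q assume "q \<in> K"
    then obtain x where x: "x \<in> K0" "q = inv_into U \<phi> x" by (auto simp: K_def)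
    then obtain q' where "q' \<in> U \<inter> W" "x = \<phi> q'" using K0 by blast
    then show "q \<in> U \<inter> W" using x by (simp add: chart_inv_into[OF cU])
  qed
  have inK: "q \<in> K" if "q \<in> U" "\<phi> q \<in> K0" for q
    unfolding K_def using that chart_inv_into[OF cU that(1)] by (metis imageI)
  have "cube ?n (\<phi> p) d \<subseteq> K0"
    using b(3) by (force simp: cube_def K0_def)
  then have NK: "N \<subseteq> K" using inK by (auto simp: N_def)
  have B0: "B q = 0" if "q \<notin> K" for q
    using that inK[of q] b(5) chart_mem_rspace[OF cU, of q]
    by (auto simp: B_def K0_def)
  have "B \<in> smooth_functions M"
    unfolding smooth_functions_iff
  proof
    fix q
    show "smooth_at M B q"
    proof (cases "q \<in> U")
      case True
      have "ropen ?n (rspace ?n)"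
        using openin_topspace[of "Euclidean_space ?n"] by (simp add: topspace_Euclidean_space)
      then have "smooth_at M (\<lambda>q. b (\<phi> q)) q"
        by (rule smooth_at_compose[OF _ b(1) chart_open[OF cU] True])
          (use chart_mem_rspace[OF cU] True smooth_at_coord[OF U(1) True] in auto)
      then show ?thesis
        by (rule smooth_at_cong[OF _ chart_open[OF cU] True]) (simp add: B_def)
    next
      case False
      then have "q \<in> - K" using KW by auto
      with smooth_at_const[of 0] show ?thesis
        by (rule smooth_at_cong[OF _ open_Compl[OF K]]) (use B0 in auto)
    qed
  qed
  moreover have "open N" unfolding N_def by (rule chart_preimage_open[OF cU openin_cube])
  moreover have "p \<in> N" using U centre_in_cube[OF p' b(2)] by (simp add: N_def)
  moreover have "B q = 1" if "q \<in> N" for q using that b(4) by (simp add: N_def B_def)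
  moreover have "K \<subseteq> W" using KW by blast
  ultimately show ?thesis using that[of B N K] K NK B0 by blast
qed

lemma cutoff_smooth:
  assumes b: "b \<in> smooth_functions M" and W: "open W" and K: "closed K" "K \<subseteq> W" "\<forall>q. q \<notin> K \<longrightarrow> b q = 0"
    and f: "\<And>q. q \<in> W \<Longrightarrow> smooth_at M f q"
  shows "(\<lambda>q. if q \<in> W then b q * f q else 0) \<in> smooth_functions M"
  unfolding smooth_functions_iff
proof
  fix q
  show "smooth_at M (\<lambda>q. if q \<in> W then b q * f q else 0) q"
  proof (cases "q \<in> W")
    case True
    have "smooth_at M (\<lambda>q. b q * f q) q"
      using f[OF True] smooth_functionsD[OF b] by (intro smooth_at_mult)
    then show ?thesis by (rule smooth_at_cong[OF _ W True]) simp
  next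
    case False
    then have "q \<in> - K" using K by auto
    with smooth_at_const[of 0] show ?thesis
      by (rule smooth_at_cong[OF _ open_Compl[OF K(1)]]) (use K in auto)
  qed
qed

text \<open>Makes functions defined near a point, such as coordinates, admissible as arguments of a
  derivation of global functions, without changing their germ.\<close>

lemma local_extension:
  assumes W: "open W" "p \<in> W" and f: "\<And>q. q \<in> W \<Longrightarrow> smooth_at M f q"
  obtains g N where "g \<in> smooth_functions M" "open N" "p \<in> N" "N \<subseteq> W" "\<And>q. q \<in> N \<Longrightarrow> g q = f q"
proof -
  obtain b N K where b: "b \<in> smooth_functions M" "open N" "closed K" "p \<in> N" "N \<subseteq> K" "K \<subseteq> W"
    "\<forall>q\<in>N. b q = 1" "\<forall>q. q \<notin> K \<longrightarrow> b q = 0"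
    using bump_function[OF W] by blast
  show ?thesis
    by (rule that[OF cutoff_smooth[OF b(1) W(1) b(3,6,8) f] b(2,4)]) (use b in auto)
qed

end

subsection \<open>Derivations\<close>

lemma sum_functions_apply: "(\<Sum>i\<in>I. f i) q = (\<Sum>i\<in>I. f i q :: real)"
  by (induction I rule: infinite_finite_induct) auto

text \<open>The shape obtained from a field by fixing all arguments but one. Uniqueness and locality
  are proved for such maps and then applied slot by slot.\<close>

definition derivation :: "'a manifold \<Rightarrow> (('a \<Rightarrow> real) \<Rightarrow> 'a \<Rightarrow> real) \<Rightarrow> bool" where
  "derivation M D \<longleftrightarrow> (\<forall>f\<in>smooth_functions M. D f \<in> smooth_functions M) \<and>
     (\<forall>f\<in>smooth_functions M. \<forall>g\<in>smooth_functions M. D (f + g) = D f + D g) \<and>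
     (\<forall>f\<in>smooth_functions M. \<forall>g\<in>smooth_functions M. D (f * g) = f * D g + g * D f) \<and>
     (\<forall>f\<in>smooth_functions M. \<forall>c::real. D (\<lambda>p. c * f p) = (\<lambda>p. c * D f p))"

context
  fixes M :: "'a manifold" and D :: "('a \<Rightarrow> real) \<Rightarrow> 'a \<Rightarrow> real"
  assumes D: "derivation M D"
begin

lemma derivation_smooth: "f \<in> smooth_functions M \<Longrightarrow> D f \<in> smooth_functions M"
  using D by (simp add: derivation_def)

lemma derivation_add:
  "f \<in> smooth_functions M \<Longrightarrow> g \<in> smooth_functions M \<Longrightarrow> D (f + g) = D f + D g"
  using D by (simp add: derivation_def)

lemma derivation_mult:
  "f \<in> smooth_functions M \<Longrightarrow> g \<in> smooth_functions M \<Longrightarrow> D (f * g) = f * D g + g * D f"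
  using D by (simp add: derivation_def)

lemma derivation_scale: "f \<in> smooth_functions M \<Longrightarrow> D (\<lambda>p. c * f p) = (\<lambda>p. c * D f p)"
  using D by (simp add: derivation_def)

lemma derivation_uminus: "f \<in> smooth_functions M \<Longrightarrow> D (- f) = - D f"
  using derivation_scale[of f "-1"] by (simp add: fun_Compl_def)

end

context
  fixes M :: "'a::{t2_space,second_countable_topology} manifold" and D :: "('a \<Rightarrow> real) \<Rightarrow> 'a \<Rightarrow> real"
  assumes M: "smooth_manifold M" and D: "derivation M D"
begin

lemma derivation_0: "D 0 = 0"
  using derivation_scale[OF D smooth_functions_0[OF M], of 0] by (simp add: zero_fun_def)

lemma derivation_const: "D (\<lambda>p. c) = 0"
proof -
  have 1: "(1 :: 'a \<Rightarrow> real) \<in> smooth_functions M"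
    using smooth_functions_const[OF M, of 1] by (simp add: one_fun_def)
  have "D 1 = D 1 + D 1"
    using derivation_mult[OF D 1 1] by simp
  then have "D 1 = 0" by simp
  then show ?thesis
    using derivation_scale[OF D 1, of c] by (simp add: one_fun_def zero_fun_def)
qed

lemma derivation_diff:
  "f \<in> smooth_functions M \<Longrightarrow> g \<in> smooth_functions M \<Longrightarrow> D (f - g) = D f - D g"
  using derivation_add[OF D, of f "- g"] smooth_functions_uminus[OF M, of g] derivation_uminus[OF D, of g] by simp

lemma derivation_sum:
  "(\<And>i. i \<in> I \<Longrightarrow> f i \<in> smooth_functions M) \<Longrightarrow> D (\<Sum>i\<in>I. f i) = (\<Sum>i\<in>I. D (f i))"
  by (induction I rule: infinite_finite_induct)
    (simp_all add: derivation_0 derivation_add[OF D] smooth_functions_sum[OF M])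

text \<open>With a bump function \<open>b\<close> supported where \<open>f = g\<close>, the product
  \<open>b * (f - g)\<close> is 0. Applying \<open>D\<close> and evaluating at \<open>p\<close>,
  where \<open>f - g\<close> is 0 and \<open>b\<close> is 1, leaves
  \<open>D (f - g) p = 0\<close>.\<close>

lemma derivation_local:
  assumes f: "f \<in> smooth_functions M" and g: "g \<in> smooth_functions M"
    and N: "open N" "p \<in> N" "\<And>q. q \<in> N \<Longrightarrow> f q = g q"
  shows "D f p = D g p"
proof -
  obtain b N' K where b: "b \<in> smooth_functions M" "open N'" "closed K" "p \<in> N'" "N' \<subseteq> K" "K \<subseteq> N"
    "\<forall>q\<in>N'. b q = 1" "\<forall>q. q \<notin> K \<longrightarrow> b q = 0"
    using bump_function[OF M N(1,2)] by blast
  have fg: "f - g \<in> smooth_functions M" using f g by (rule smooth_functions_diff[OF M])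
  have "b * (f - g) = 0"
  proof
    fix q show "(b * (f - g)) q = 0 q"
      using b(6,8) N(3) by (cases "q \<in> K") auto
  qed
  then have "b * D (f - g) + (f - g) * D b = 0"
    using derivation_mult[OF D b(1) fg] derivation_0 by simp
  then have "(b * D (f - g) + (f - g) * D b) p = 0" by simp
  then show ?thesis
    using b(4,7) N(2,3) derivation_diff[OF f g] by simp
qed

text \<open>Hadamard's lemma writes \<open>f - f p\<close> near \<open>p\<close> as a combination of \<open>\<phi>\<^sub>i - \<phi>\<^sub>i p\<close>, so that \<open>D f p\<close> is a
  combination of the values \<open>D (c i) p\<close>.\<close>

lemma derivation_eq_0_if_coords:
  assumes U: "(U, \<phi>) \<in> maximal_atlas M" "p \<in> U"
    and c: "\<And>i. i < mdim M \<Longrightarrow> c i \<in> smooth_functions M"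
    and N: "open N" "p \<in> N" "\<And>i q. i < mdim M \<Longrightarrow> q \<in> N \<Longrightarrow> c i q = \<phi> q i"
    and Dc: "\<And>i. i < mdim M \<Longrightarrow> D (c i) p = 0"
    and f: "f \<in> smooth_functions M"
  shows "D f p = 0"
proof -
  let ?n = "mdim M"
  note cU = maximal_atlas_is_chart[OF U(1)]
  have "ropen ?n (\<phi> ` U)"
    by (rule chart_image_openin[OF cU chart_open[OF cU] order.refl])
  then obtain d where d: "d > 0" "cube ?n (\<phi> p) d \<subseteq> \<phi> ` U"
    using cube_subset_openin[of ?n "\<phi> ` U" "\<phi> p"] U by blast
  have "smooth_on ?n (\<phi> ` U) (\<lambda>x. f (inv_into U \<phi> x))"
    using smooth_on_chart_iff[OF M U(1) chart_open[OF cU] order.refl] smooth_functionsD[OF M f] by simp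
  then have "smooth_on ?n (cube ?n (\<phi> p) d) (\<lambda>x. f (inv_into U \<phi> x))"
    using d(2) by (rule smooth_on_subset)
  from Hadamard[OF chart_mem_rspace[OF cU U(2)] this]
  obtain g where g: "\<And>i. i < ?n \<Longrightarrow> smooth_on ?n (cube ?n (\<phi> p) d) (g i)"
    "\<And>x. x \<in> cube ?n (\<phi> p) d \<Longrightarrow>
      f (inv_into U \<phi> x) = f (inv_into U \<phi> (\<phi> p)) + (\<Sum>i<?n. (x i - \<phi> p i) * g i x)"
    by blast
  define W where "W = {q \<in> U. \<phi> q \<in> cube ?n (\<phi> p) d}"
  have W: "open W" "p \<in> W"
    unfolding W_def using chart_preimage_open[OF cU openin_cube] U(2)
      centre_in_cube[OF chart_mem_rspace[OF cU U(2)] d(1)] by auto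
  have ex: "\<exists>G N. G \<in> smooth_functions M \<and> open N \<and> p \<in> N \<and> (\<forall>q\<in>N. G q = g i (\<phi> q))" if i: "i < ?n" for i
  proof -
    have "smooth_at M (\<lambda>q. g i (\<phi> q)) q" if q: "q \<in> W" for q
    proof (rule smooth_at_compose[OF M openin_cube g(1)[OF i] W(1) q])
      show "\<phi> q' \<in> rspace ?n" if "q' \<in> W" for q' using that chart_mem_rspace[OF cU] by (auto simp: W_def)
      show "\<phi> q \<in> cube ?n (\<phi> p) d" using q by (simp add: W_def)
      show "smooth_at M (\<lambda>q. \<phi> q i) q" for i
        using smooth_at_coord[OF M U(1)] q by (simp add: W_def)
    qed
    from local_extension[OF M W this] show ?thesis by metis
  qed
  then obtain G N' where G: "\<And>i. i < ?n \<Longrightarrow> G i \<in> smooth_functions M" "\<And>i. i < ?n \<Longrightarrow> open (N' i)"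
    "\<And>i. i < ?n \<Longrightarrow> p \<in> N' i" "\<And>i q. i < ?n \<Longrightarrow> q \<in> N' i \<Longrightarrow> G i q = g i (\<phi> q)"
    by metis
  \<comment> \<open>Subtracting the constant makes \<open>c' i\<close> vanish at \<open>p\<close>
    without changing its derivative. In \<open>D (c' i * G i) p\<close> the term with
    \<open>D (G i)\<close> then drops out, and the other is zero by \<open>Dc\<close>.\<close>
  define c' where "c' i = c i - (\<lambda>q. \<phi> p i)" for i
  have c': "c' i \<in> smooth_functions M" if "i < ?n" for i
    unfolding c'_def using c[OF that] smooth_functions_const[OF M] by (rule smooth_functions_diff[OF M])
  define h where "h = (\<lambda>q. f p) + (\<Sum>i<?n. c' i * G i)"
  have sum: "(\<Sum>i<?n. c' i * G i) \<in> smooth_functions M"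
    using c' G(1) by (intro smooth_functions_sum[OF M] smooth_functions_mult[OF M]) auto
  then have h: "h \<in> smooth_functions M"
    unfolding h_def by (intro smooth_functions_add[OF M] smooth_functions_const[OF M])
  let ?N = "N \<inter> W \<inter> (\<Inter>i\<in>{..<?n}. N' i)"
  have "D f p = D h p"
  proof (rule derivation_local[OF f h])
    show "open ?N" using N W G(2) by (intro open_Int open_INT) auto
    show "p \<in> ?N" using N W G(3) by auto
    fix q assume q: "q \<in> ?N"
    have "(\<Sum>i<?n. c' i * G i) q = (\<Sum>i<?n. (\<phi> q i - \<phi> p i) * g i (\<phi> q))"
      using q N(3) G(4) by (simp add: sum_functions_apply c'_def)
    then show "f q = h q"
      using q g(2)[of "\<phi> q"] U(2) by (simp add: W_def h_def chart_inv_into[OF cU])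
  qed
  also have "D h = (\<Sum>i<?n. D (c' i * G i))"
    unfolding h_def using c' G(1)
    by (subst derivation_add[OF D smooth_functions_const[OF M] sum], subst derivation_sum)
      (auto simp: derivation_const intro!: smooth_functions_mult[OF M])
  also have "\<dots> p = (\<Sum>i<?n. D (c' i * G i) p)"
    by (simp add: sum_functions_apply)
  also have "\<dots> = 0"
  proof (rule sum.neutral, intro ballI)
    fix i assume "i \<in> {..<?n}"
    then have i: "i < ?n" by simp
    have "D (c' i) = D (c i)"
      unfolding c'_def using derivation_diff[OF c[OF i] smooth_functions_const[OF M]] derivation_const by simp
    moreover have "c' i p = 0" using N i by (simp add: c'_def)
    ultimately show "D (c' i * G i) p = 0"
      using derivation_mult[OF D c'[OF i] G(1)[OF i]] Dc[OF i] by simp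
  qed
  finally show ?thesis .
qed

end

section \<open>Multivector fields of low degree\<close>

lemma multivector_field_support:
  "multivector_field M k A \<Longrightarrow> \<not> (length fs = k \<and> set fs \<subseteq> smooth_functions M) \<Longrightarrow> A fs = 0"
  by (auto simp: multivector_field_def)

lemma vector_field_iff:
  "vector_field M X \<longleftrightarrow> derivation M (\<lambda>f. X [f]) \<and> (\<forall>fs. \<not> (\<exists>f\<in>smooth_functions M. fs = [f]) \<longrightarrow> X fs = 0)"
proof -
  let ?S = "smooth_functions M"
  have 1: "length fs = 1 \<and> set fs \<subseteq> ?S \<longleftrightarrow> (\<exists>f\<in>?S. fs = [f])" for fs
    by (auto simp: length_Suc_conv)
  show ?thesis
    unfolding multivector_field_def derivation_def 1
    by (auto 0 3)
qed

lemma bivector_field_iff: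
  "bivector_field M B \<longleftrightarrow>
     (\<forall>g\<in>smooth_functions M. derivation M (\<lambda>f. B [f, g]) \<and> derivation M (\<lambda>f. B [g, f])) \<and>
     (\<forall>f\<in>smooth_functions M. B [f, f] = 0) \<and>
     (\<forall>fs. \<not> (\<exists>f\<in>smooth_functions M. \<exists>g\<in>smooth_functions M. fs = [f, g]) \<longrightarrow> B fs = 0)"
proof -
  let ?S = "smooth_functions M"
  have 1: "length fs = 2 \<and> set fs \<subseteq> ?S \<longleftrightarrow> (\<exists>f\<in>?S. \<exists>g\<in>?S. fs = [f, g])" for fs
    by (auto simp: length_Suc_conv numeral_2_eq_2)
  have 2: "(\<forall>i<2. P i) \<longleftrightarrow> P 0 \<and> P (Suc 0)" for P :: "nat \<Rightarrow> bool"
    by (auto simp: less_2_cases_iff)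
  have 3: "(\<forall>fs. (\<exists>f\<in>?S. \<exists>g\<in>?S. fs = [f, g]) \<longrightarrow> P fs) \<longleftrightarrow> (\<forall>f\<in>?S. \<forall>g\<in>?S. P [f, g])" for P
    by blast
  have 4: "(\<forall>i<2. \<forall>j<i. P i j) \<longleftrightarrow> P (Suc 0) 0" for P :: "nat \<Rightarrow> nat \<Rightarrow> bool"
    by (auto simp: less_2_cases_iff)
  let ?Q = "\<lambda>f g. B [f, g] \<in> ?S \<and> (g = f \<longrightarrow> B [f, g] = 0) \<and>
    (\<forall>a\<in>?S. \<forall>b\<in>?S. \<forall>c. B [a + b, g] = B [a, g] + B [b, g] \<and>
      B [\<lambda>p. c * a p, g] = (\<lambda>p. c * B [a, g] p) \<and> B [a * b, g] = a * B [b, g] + b * B [a, g]) \<and>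
    (\<forall>a\<in>?S. \<forall>b\<in>?S. \<forall>c. B [f, a + b] = B [f, a] + B [f, b] \<and>
      B [f, \<lambda>p. c * a p] = (\<lambda>p. c * B [f, a] p) \<and> B [f, a * b] = a * B [f, b] + b * B [f, a])"
  have 5: "bivector_field M B \<longleftrightarrow>
      (\<forall>fs. \<not> (\<exists>f\<in>?S. \<exists>g\<in>?S. fs = [f, g]) \<longrightarrow> B fs = 0) \<and> (\<forall>f\<in>?S. \<forall>g\<in>?S. ?Q f g)"
    unfolding multivector_field_def 1 2 3 4 by simp
  show ?thesis
  proof
    assume L: "bivector_field M B"
    then have Q: "?Q f g" if "f \<in> ?S" "g \<in> ?S" for f g using that unfolding 5 by blast
    show "(\<forall>g\<in>?S. derivation M (\<lambda>f. B [f, g]) \<and> derivation M (\<lambda>f. B [g, f])) \<and> (\<forall>f\<in>?S. B [f, f] = 0) \<and>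
      (\<forall>fs. \<not> (\<exists>f\<in>?S. \<exists>g\<in>?S. fs = [f, g]) \<longrightarrow> B fs = 0)"
    proof (intro conjI ballI)
      fix f assume f: "f \<in> ?S"
      show "derivation M (\<lambda>g. B [g, f])" "derivation M (\<lambda>g. B [f, g])" "B [f, f] = 0"
        unfolding derivation_def using Q[OF _ f] Q[OF f] f by simp_all
    qed (use L in \<open>unfold 5, elim conjE\<close>)
  next
    assume R: "(\<forall>g\<in>?S. derivation M (\<lambda>f. B [f, g]) \<and> derivation M (\<lambda>f. B [g, f])) \<and> (\<forall>f\<in>?S. B [f, f] = 0) \<and>
      (\<forall>fs. \<not> (\<exists>f\<in>?S. \<exists>g\<in>?S. fs = [f, g]) \<longrightarrow> B fs = 0)"
    then show "bivector_field M B" unfolding 5 derivation_def by simp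
  qed
qed

lemma vector_field_derivation: "vector_field M X \<Longrightarrow> derivation M (\<lambda>f. X [f])"
  unfolding vector_field_iff by blast

lemma bivector_field_derivation:
  assumes "bivector_field M B" "g \<in> smooth_functions M"
  shows "derivation M (\<lambda>f. B [f, g])" "derivation M (\<lambda>f. B [g, f])"
  using assms by (simp_all add: bivector_field_iff)

lemma bivector_field_antisym:
  assumes M: "smooth_manifold M" and B: "bivector_field M B"
    and f: "f \<in> smooth_functions M" and g: "g \<in> smooth_functions M"
  shows "B [g, f] = - B [f, g]"
proof -
  note D = bivector_field_derivation[OF B] and fg = smooth_functions_add[OF M f g]
  have "B [f + g, f + g] = B [f, f + g] + B [g, f + g]"
    by (rule derivation_add[OF D(1)[OF fg] f g])
  also have "\<dots> = B [f, f] + B [f, g] + (B [g, f] + B [g, g])"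
    using derivation_add[OF D(2)[OF f] f g] derivation_add[OF D(2)[OF g] f g] by simp
  finally have "B [f, g] + B [g, f] = 0"
    using B f g fg by (simp add: bivector_field_iff)
  then show ?thesis by (simp add: eq_neg_iff_add_eq_0 add.commute)
qed

text \<open>Antisymmetry transports the derivation property from the first argument to the second
  and gives vanishing on equal arguments.\<close>

lemma bivector_fieldI:
  assumes D: "\<And>g. g \<in> smooth_functions M \<Longrightarrow> derivation M (\<lambda>f. B [f, g])"
    and anti: "\<And>f g. f \<in> smooth_functions M \<Longrightarrow> g \<in> smooth_functions M \<Longrightarrow> B [g, f] = - B [f, g]"
    and supp: "\<And>fs. \<not> (length fs = 2 \<and> set fs \<subseteq> smooth_functions M) \<Longrightarrow> B fs = 0"
    and M: "smooth_manifold M"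
  shows "bivector_field M B"
  unfolding bivector_field_iff
proof (intro conjI ballI allI impI)
  fix g assume g: "g \<in> smooth_functions M"
  show "derivation M (\<lambda>f. B [f, g])" by (rule D[OF g])
  have "derivation M (\<lambda>f. B [g, f]) \<longleftrightarrow> derivation M (\<lambda>f. - B [f, g])"
    using anti[OF _ g] unfolding derivation_def
    by (simp add: smooth_functions_add[OF M] smooth_functions_mult[OF M] smooth_functions_scale[OF M])
  moreover have "derivation M (\<lambda>f. - B [f, g])"
    using D[OF g] unfolding derivation_def
    by (auto simp: smooth_functions_uminus[OF M] fun_eq_iff algebra_simps)
  ultimately show "derivation M (\<lambda>f. B [g, f])" by blast
next
  fix f assume f: "f \<in> smooth_functions M"
  show "B [f, f] = 0"
  proof
    fix p show "B [f, f] p = 0 p" using fun_cong[OF anti[OF f f], of p] by simp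
  qed
next
  fix fs assume "\<not> (\<exists>f\<in>smooth_functions M. \<exists>g\<in>smooth_functions M. fs = [f, g])"
  then show "B fs = 0"
    by (intro supp) (auto simp: length_Suc_conv numeral_2_eq_2)
qed

lemma derivation_diff_derivation:
  assumes M: "smooth_manifold M" and D: "derivation M D" "derivation M D'"
  shows "derivation M (\<lambda>f. D f - D' f)"
  using D unfolding derivation_def
  by (auto simp: smooth_functions_diff[OF M] fun_eq_iff algebra_simps)

lemma derivation_multiple:
  assumes M: "smooth_manifold M" and D: "derivation M D"
  shows "derivation M (\<lambda>f. - D f)" "h \<in> smooth_functions M \<Longrightarrow> derivation M (\<lambda>f. D f * h)"
  using D unfolding derivation_def
  by (auto simp: smooth_functions_uminus[OF M] smooth_functions_mult[OF M] fun_eq_iff algebra_simps)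

lemma vector_field_diff:
  assumes M: "smooth_manifold M" and X: "vector_field M X" "vector_field M Y"
  shows "vector_field M (X - Y)"
  using X unfolding vector_field_iff by (simp add: derivation_diff_derivation[OF M])

lemma vector_field_uminus:
  assumes M: "smooth_manifold M" and X: "vector_field M X"
  shows "vector_field M (- X)"
  using X unfolding vector_field_iff by (simp add: derivation_multiple(1)[OF M])

lemma bivector_field_diff:
  assumes M: "smooth_manifold M" and B: "bivector_field M A" "bivector_field M B"
  shows "bivector_field M (A - B)"
  using B unfolding bivector_field_iff by (simp add: derivation_diff_derivation[OF M])

section \<open>Vanishing on inadmissible argument lists\<close>

lemma length_nths_Compl: "length (nths fs S) + length (nths fs (- S)) = length fs"
proof -
  have "card {i. i < length fs \<and> i \<in> S} + card {i. i < length fs \<and> i \<in> - S} =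
      card ({i. i < length fs \<and> i \<in> S} \<union> {i. i < length fs \<and> i \<in> - S})"
    by (rule card_Un_disjoint[symmetric]) auto
  also have "{i. i < length fs \<and> i \<in> S} \<union> {i. i < length fs \<and> i \<in> - S} = {..<length fs}" by auto
  finally show ?thesis by (simp add: length_nths)
qed

lemma set_nths_Compl: "set (nths fs S) \<union> set (nths fs (- S)) = set fs"
proof -
  have "set fs = {fs ! i |i. i < length fs}" by (rule set_conv_nth)
  then show ?thesis unfolding set_nths by blast
qed

text \<open>Equality of fields is equality on all lists, so products must also be 0 on lists of the
  wrong length or with non-smooth entries. A nonzero shuffle term would make both sublists
  admissible, and together they recover \<open>fs\<close>.\<close>

lemma wedge_support:
  assumes A: "multivector_field M a A" and B: "multivector_field M b B"
    and fs: "\<not> (length fs = a + b \<and> set fs \<subseteq> smooth_functions M)"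
  shows "wedge k A B fs = 0"
proof -
  have "A (nths fs S) p * B (nths fs (- S)) p = 0" for S p
  proof (rule ccontr)
    assume "A (nths fs S) p * B (nths fs (- S)) p \<noteq> 0"
    then have "A (nths fs S) \<noteq> 0" "B (nths fs (- S)) \<noteq> 0" by auto
    then have l: "length (nths fs S) = a" "set (nths fs S) \<subseteq> smooth_functions M"
      "length (nths fs (- S)) = b" "set (nths fs (- S)) \<subseteq> smooth_functions M"
      using multivector_field_support[OF A] multivector_field_support[OF B] by blast+
    have "length fs = a + b" using l length_nths_Compl[of fs S] by simp
    moreover have "set fs \<subseteq> smooth_functions M" using l set_nths_Compl[of fs S] by blast
    ultimately show False using fs by blast
  qed
  then show ?thesis by (auto simp: wedge_def fun_eq_iff mult.assoc intro!: sum.neutral)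
qed

text \<open>In an insertion the inner field may take its default value 0; the outer field must then
  give 0 as well, whether or not the resulting list is admissible.\<close>

lemma multivector_field_Cons_0:
  assumes M: "smooth_manifold M" and A: "multivector_field M a A"
  shows "A (0 # fs) = 0"
proof (cases "length (0 # fs) = a \<and> set (0 # fs) \<subseteq> smooth_functions M")
  case True
  with A have "\<forall>i<a. \<forall>f\<in>smooth_functions M. \<forall>g\<in>smooth_functions M. \<forall>c::real.
      A ((0 # fs)[i := (\<lambda>p. c * f p)]) = (\<lambda>p. c * A ((0 # fs)[i := f]) p)"
    unfolding multivector_field_def by blast
  moreover have "0 < a" using True by auto
  ultimately have "A ((0 # fs)[0 := (\<lambda>p. 0 * (0 :: 'a \<Rightarrow> real) p)]) = (\<lambda>p. 0 * A ((0 # fs)[0 := 0]) p)"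
    using smooth_functions_0[OF M] by blast
  then show ?thesis by (simp add: zero_fun_def)
qed (rule multivector_field_support[OF A])

lemma insertion_support:
  assumes M: "smooth_manifold M" and A: "multivector_field M a A" and B: "multivector_field M b B"
    and fs: "\<not> (length fs + 1 = a + b \<and> set fs \<subseteq> smooth_functions M)"
  shows "insertion k A B fs = 0"
proof -
  have "A (B (nths fs S) # nths fs (- S)) p = 0" for S p
  proof (rule ccontr)
    assume *: "A (B (nths fs S) # nths fs (- S)) p \<noteq> 0"
    then have "B (nths fs S) \<noteq> 0" using multivector_field_Cons_0[OF M A] by auto
    moreover have "A (B (nths fs S) # nths fs (- S)) \<noteq> 0" using * by auto
    ultimately have l: "length (B (nths fs S) # nths fs (- S)) = a" "set (B (nths fs S) # nths fs (- S)) \<subseteq> smooth_functions M"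
      "length (nths fs S) = b" "set (nths fs S) \<subseteq> smooth_functions M"
      using multivector_field_support[OF A] multivector_field_support[OF B] by blast+
    have "length fs + 1 = a + b" using l length_nths_Compl[of fs S] by simp
    moreover have "set fs \<subseteq> smooth_functions M" using l set_nths_Compl[of fs S] by auto
    ultimately show False using fs by blast
  qed
  then show ?thesis by (auto simp: insertion_def fun_eq_iff mult.assoc intro!: sum.neutral)
qed

text \<open>The bracket has degree \<open>a + b - 1\<close>; the length condition is written
  additively because subtraction on \<open>nat\<close> truncates.\<close>

lemma schouten_support:
  assumes M: "smooth_manifold M" and A: "multivector_field M a A" and B: "multivector_field M b B"
    and fs: "\<not> (length fs + 1 = a + b \<and> set fs \<subseteq> smooth_functions M)"
  shows "schouten a b A B fs = 0"
  using insertion_support[OF M A B fs, of b] insertion_support[OF M B A, of fs a] fs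
  by (auto simp: schouten_def fun_eq_iff add.commute)

section \<open>Wedge products and Schouten brackets as multivector fields\<close>

lemma wedge_bivector_field:
  assumes M: "smooth_manifold M" and X: "vector_field M X" and Y: "vector_field M Y"
  shows "bivector_field M (wedge 1 X Y)"
proof (rule bivector_fieldI[OF _ _ _ M])
  fix g assume g: "g \<in> smooth_functions M"
  note d = vector_field_derivation[OF X] vector_field_derivation[OF Y]
  have "derivation M (\<lambda>f. X [f] * Y [g] - Y [f] * X [g])"
    using d g by (intro derivation_diff_derivation[OF M] derivation_multiple(2)[OF M]) (auto intro: derivation_smooth)
  then show "derivation M (\<lambda>f. wedge 1 X Y [f, g])"
    unfolding wedge_1_1 by (simp add: mult.commute)
next
  fix f g show "wedge 1 X Y [g, f] = - wedge 1 X Y [f, g]" unfolding wedge_1_1 by simp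
next
  fix fs assume "\<not> (length fs = 2 \<and> set fs \<subseteq> smooth_functions M)"
  then show "wedge 1 X Y fs = 0" using wedge_support[OF X Y, of fs 1] by simp
qed

lemma schouten_vector_field:
  assumes M: "smooth_manifold M" and X: "vector_field M X" and Y: "vector_field M Y"
  shows "vector_field M (schouten 1 1 X Y)"
  unfolding vector_field_iff
proof (intro conjI allI impI)
  note d = vector_field_derivation[OF X] vector_field_derivation[OF Y]
  note s = derivation_smooth[OF d(1)] derivation_smooth[OF d(2)]
  show "derivation M (\<lambda>f. schouten 1 1 X Y [f])"
    unfolding schouten_1_1 derivation_def
    by (auto simp: derivation_add[OF d(1)] derivation_add[OF d(2)] derivation_mult[OF d(1)] derivation_mult[OF d(2)]
        derivation_scale[OF d(1)] derivation_scale[OF d(2)] s smooth_functions_mult[OF M]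
        smooth_functions_diff[OF M] fun_eq_iff algebra_simps)
  fix fs assume "\<not> (\<exists>f\<in>smooth_functions M. fs = [f])"
  then show "schouten 1 1 X Y fs = 0"
    by (intro schouten_support[OF M X Y]) (auto simp: length_Suc_conv)
qed

lemma schouten_bivector_field:
  assumes M: "smooth_manifold M" and X: "vector_field M X" and B: "bivector_field M B"
  shows "bivector_field M (schouten 1 2 X B)"
proof (rule bivector_fieldI[OF _ _ _ M])
  let ?S = "smooth_functions M"
  note dX = vector_field_derivation[OF X] and dB = bivector_field_derivation[OF B]
  note sX = derivation_smooth[OF dX] and sB = derivation_smooth[OF dB(1)]
  note anti = bivector_field_antisym[OF M B]
  {
    fix g assume g: "g \<in> ?S"
    note Xg = sX[OF g]
    show "derivation M (\<lambda>f. schouten 1 2 X B [f, g])"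
      unfolding schouten_1_2 derivation_def
      by (auto simp: derivation_add[OF dX] derivation_add[OF dB(1)] derivation_add[OF dB(2)]
          derivation_mult[OF dX] derivation_mult[OF dB(1)] derivation_mult[OF dB(2)]
          derivation_scale[OF dX] derivation_scale[OF dB(1)] derivation_scale[OF dB(2)]
          sX sB g Xg smooth_functions_mult[OF M] smooth_functions_add[OF M]
          smooth_functions_diff[OF M] fun_eq_iff algebra_simps)
  }
  fix f g assume fg: "f \<in> ?S" "g \<in> ?S"
  have "X [B [g, f]] = - X [B [f, g]]"
    unfolding anti[OF fg] by (rule derivation_uminus[OF dX sB[OF fg(2,1)]])
  moreover have "B [X [f], g] = - B [g, X [f]]" "B [X [g], f] = - B [f, X [g]]"
    by (rule anti[OF fg(2) sX[OF fg(1)]], rule anti[OF fg(1) sX[OF fg(2)]])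
  ultimately show "schouten 1 2 X B [g, f] = - schouten 1 2 X B [f, g]"
    unfolding schouten_1_2 by simp
next
  fix fs assume "\<not> (length fs = 2 \<and> set fs \<subseteq> smooth_functions M)"
  then show "schouten 1 2 X B fs = 0" by (intro schouten_support[OF M X B]) auto
qed

lemma schouten_trivector_derivation:
  assumes M: "smooth_manifold M" and B: "bivector_field M B"
    and g: "g \<in> smooth_functions M" and h: "h \<in> smooth_functions M"
  shows "derivation M (\<lambda>f. schouten 2 2 B B [f, g, h])"
proof -
  let ?J = "\<lambda>f. B [B [f, g], h] - B [B [f, h], g] + B [B [g, h], f]"
  note dB = bivector_field_derivation[OF B]
  note sB = derivation_smooth[OF dB(1)]
  have gh: "B [g, h] \<in> smooth_functions M" using sB g h by blast
  have "derivation M ?J"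
    unfolding derivation_def
    by (auto simp: derivation_add[OF dB(1)] derivation_add[OF dB(2)]
        derivation_mult[OF dB(1)] derivation_mult[OF dB(2)]
        derivation_scale[OF dB(1)] derivation_scale[OF dB(2)]
        sB g h gh smooth_functions_mult[OF M] smooth_functions_add[OF M]
        smooth_functions_diff[OF M] fun_eq_iff algebra_simps)
  then have "derivation M (\<lambda>f. ?J f * (\<lambda>p. - 2))"
    by (rule derivation_multiple(2)[OF M _ smooth_functions_const[OF M]])
  moreover have "schouten 2 2 B B [f, g, h] = ?J f * (\<lambda>p. - 2)" for f
    unfolding schouten_2_2 by (simp add: fun_eq_iff)
  ultimately show ?thesis by simp
qed

text \<open>With cyclic invariance, being a derivation in the first argument is enough to treat all
  three arguments.\<close>

lemma schouten_trivector_cyclic: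
  assumes M: "smooth_manifold M" and B: "bivector_field M B"
    and fgh: "f \<in> smooth_functions M" "g \<in> smooth_functions M" "h \<in> smooth_functions M"
  shows "schouten 2 2 B B [f, g, h] = schouten 2 2 B B [g, h, f]"
proof -
  note anti = bivector_field_antisym[OF M B] and dB = bivector_field_derivation(1)[OF B]
  have "B [B [g, f], h] = - B [B [f, g], h]" "B [B [h, f], g] = - B [B [f, h], g]"
    unfolding anti[OF fgh(1,2)] anti[OF fgh(1,3)]
    by (rule derivation_uminus[OF dB[OF fgh(3)] derivation_smooth[OF dB[OF fgh(2)] fgh(1)]],
        rule derivation_uminus[OF dB[OF fgh(2)] derivation_smooth[OF dB[OF fgh(3)] fgh(1)]])
  then show ?thesis unfolding schouten_2_2 by (simp add: fun_eq_iff)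
qed

section \<open>Vector fields given by curves\<close>

lemma vector_field_by_derivation:
  assumes M: "smooth_manifold M" and D: "derivation M D"
  shows "vector_field M (vector_field_by M D)"
  unfolding vector_field_iff
proof (intro conjI allI impI)
  show "derivation M (\<lambda>f. vector_field_by M D [f])"
    using D unfolding vector_field_by_def derivation_def
    by (simp add: smooth_functions_add[OF M] smooth_functions_mult[OF M] smooth_functions_scale[OF M])
qed (auto simp: vector_field_by_def length_Suc_conv)

text \<open>Common source of the Liouville field and of vertical lifts, both defined by
  differentiating along curves. In a chart containing the curves the chain rule gives the derivative
  with velocity components \<open>v i\<close>, so their smoothness is what makes the result
  smooth.\<close>

lemma curve_vector_field:
  fixes M :: "'a::{t2_space,second_countable_topology} manifold" and \<gamma> :: "'a \<Rightarrow> real \<Rightarrow> 'a"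
  assumes M: "smooth_manifold M" and start: "\<And>p. \<gamma> p t0 = p"
    and charts: "\<And>p. \<exists>U \<phi> v. (U, \<phi>) \<in> maximal_atlas M \<and> p \<in> U \<and>
      (\<forall>q\<in>U. (\<forall>t. \<gamma> q t \<in> U) \<and> (\<forall>i<mdim M. smooth_at M (v i) q \<and>
         ((\<lambda>t. \<phi> (\<gamma> q t) i) has_real_derivative v i q) (at t0)))"
  shows "vector_field M (vector_field_by M (\<lambda>f p. deriv (\<lambda>t. f (\<gamma> p t)) t0))"
proof (rule vector_field_by_derivation[OF M])
  let ?S = "smooth_functions M" and ?D = "\<lambda>f p. deriv (\<lambda>t. f (\<gamma> p t)) t0" and ?n = "mdim M"
  have main: "smooth_at M (?D f) p \<and> ((\<lambda>t. f (\<gamma> p t)) has_real_derivative ?D f p) (at t0)"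
    if f: "f \<in> ?S" for f p
  proof -
    obtain U \<phi> v where U: "(U, \<phi>) \<in> maximal_atlas M" "p \<in> U"
      and \<gamma>: "\<And>q t. q \<in> U \<Longrightarrow> \<gamma> q t \<in> U"
      and v: "\<And>q i. q \<in> U \<Longrightarrow> i < ?n \<Longrightarrow> smooth_at M (v i) q"
      and der: "\<And>q i. q \<in> U \<Longrightarrow> i < ?n \<Longrightarrow> ((\<lambda>t. \<phi> (\<gamma> q t) i) has_real_derivative v i q) (at t0)"
      using charts[of p] by blast
    note cU = maximal_atlas_is_chart[OF U(1)]
    have op: "ropen ?n (\<phi> ` U)"
      by (rule chart_image_openin[OF cU chart_open[OF cU] order.refl])
    let ?F = "\<lambda>x. f (inv_into U \<phi> x)"
    have F: "smooth_on ?n (\<phi> ` U) ?F"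
      using smooth_on_chart_iff[OF M U(1) chart_open[OF cU] order.refl] smooth_functionsD[OF M f] by simp
    have D: "((\<lambda>t. f (\<gamma> q t)) has_real_derivative (\<Sum>i<?n. partial_deriv i ?F (\<phi> q) * v i q)) (at t0)"
      if q: "q \<in> U" for q
    proof -
      have "((\<lambda>t. ?F (\<phi> (\<gamma> q t))) has_real_derivative
          (\<Sum>i<?n. partial_deriv i ?F (\<phi> (\<gamma> q t0)) * v i q)) (at t0)"
      proof (rule has_real_derivative_along_curve[OF op])
        show "Ck_on 1 ?n (\<phi> ` U) ?F" using F by (simp add: smooth_on_def)
        show "\<forall>\<^sub>F t in at t0. \<phi> (\<gamma> q t) \<in> rspace ?n"
          by (rule always_eventually) (use chart_mem_rspace[OF cU] \<gamma>[OF q] in blast)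
      qed (use der \<gamma> q in auto)
      then show ?thesis by (simp add: start chart_inv_into[OF cU] \<gamma>[OF q])
    qed
    then have eq: "?D f q = (\<Sum>i<?n. partial_deriv i ?F (\<phi> q) * v i q)" if "q \<in> U" for q
      using that DERIV_imp_deriv by blast
    have "smooth_at M (\<lambda>q. \<Sum>i<?n. partial_deriv i ?F (\<phi> q) * v i q) p"
    proof (intro smooth_at_sum[OF M] smooth_at_mult[OF M])
      fix i assume "i \<in> {..<?n}"
      then have i: "i < ?n" by simp
      show "smooth_at M (v i) p" by (rule v[OF U(2) i])
      show "smooth_at M (\<lambda>q. partial_deriv i ?F (\<phi> q)) p"
        by (rule smooth_at_compose[OF M op smooth_on_partial_deriv[OF F i] chart_open[OF cU] U(2)])
          (use chart_mem_rspace[OF cU] smooth_at_coord[OF M U] U in auto)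
    qed
    then have "smooth_at M (?D f) p"
      by (rule smooth_at_cong[OF M _ chart_open[OF cU] U(2)]) (simp add: eq)
    then show ?thesis using D[OF U(2)] eq[OF U(2)] by simp
  qed
  show "derivation M ?D"
    unfolding derivation_def
  proof (intro conjI ballI allI)
    fix f assume f: "f \<in> ?S"
    show "?D f \<in> ?S" using main[OF f] smooth_functions_iff[OF M] by blast
    show "?D (\<lambda>p. c * f p) = (\<lambda>p. c * ?D f p)" for c
    proof
      fix p show "?D (\<lambda>p. c * f p) p = c * ?D f p"
        using main[OF f, of p] by (intro DERIV_imp_deriv DERIV_cmult) blast
    qed
    fix g assume g: "g \<in> ?S"
    show "?D (f + g) = ?D f + ?D g"
    proof
      fix p show "?D (f + g) p = (?D f + ?D g) p"
        unfolding plus_fun_apply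
        using main[OF f, of p] main[OF g, of p] by (intro DERIV_imp_deriv DERIV_add) blast+
    qed
    show "?D (f * g) = f * ?D g + g * ?D f"
    proof
      fix p
      have "((\<lambda>t. f (\<gamma> p t) * g (\<gamma> p t)) has_real_derivative
          ?D f p * g (\<gamma> p t0) + ?D g p * f (\<gamma> p t0)) (at t0)"
        using main[OF f, of p] main[OF g, of p] by (intro DERIV_mult) blast+
      then have "((\<lambda>t. (f * g) (\<gamma> p t)) has_real_derivative (f * ?D g + g * ?D f) p) (at t0)"
        by (simp add: start algebra_simps)
      then show "?D (f * g) p = (f * ?D g + g * ?D f) p"
        by (rule DERIV_imp_deriv)
    qed
  qed
qed

section \<open>Vector bundles\<close>

context
  fixes E :: "('m::{t2_space,second_countable_topology}, 'e::{t2_space,second_countable_topology}) vbundle"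
  assumes vb: "vector_bundle E"
begin

lemma base_manifold: "smooth_manifold (base E)"
  and total_manifold: "smooth_manifold (total E)"
  and mdim_total: "mdim (total E) = mdim (base E) + rank E"
  using vb by (simp_all add: vector_bundle_def)

lemma proj_smul [simp]: "proj E (smul E c e) = proj E e"
  using vb by (auto simp: vector_bundle_def fibre_def)

lemma proj_vadd: "proj E e' = proj E e \<Longrightarrow> proj E (vadd E e e') = proj E e"
  using vb by (auto simp: vector_bundle_def fibre_def)

lemma trivialization_exists:
  obtains U \<phi> \<tau> where "x \<in> U" "local_trivialization E (U, \<phi>) \<tau>"
proof -
  have "\<exists>c \<tau>. x \<in> fst c \<and> local_trivialization E c \<tau>"
    using vb by (simp add: vector_bundle_def)
  then obtain c \<tau> where "x \<in> fst c" "local_trivialization E c \<tau>" by blast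
  then show ?thesis using that[of "fst c" "snd c" \<tau>] by simp
qed

definition total_chart :: "('m \<Rightarrow> nat \<Rightarrow> real) \<Rightarrow> ('e \<Rightarrow> nat \<Rightarrow> real) \<Rightarrow> 'e \<Rightarrow> nat \<Rightarrow> real" where
  "total_chart \<phi> \<tau> e i = (if i < mdim (base E) then \<phi> (proj E e) i else \<tau> e (i - mdim (base E)))"

context
  fixes U :: "'m set" and \<phi> :: "'m \<Rightarrow> nat \<Rightarrow> real" and \<tau> :: "'e \<Rightarrow> nat \<Rightarrow> real"
  assumes triv: "local_trivialization E (U, \<phi>) \<tau>"
begin

lemma triv_base_chart: "(U, \<phi>) \<in> maximal_atlas (base E)"
  using triv by (simp add: local_trivialization_def)

lemma triv_total_chart: "(proj E -` U, total_chart \<phi> \<tau>) \<in> maximal_atlas (total E)"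
proof -
  have "total_chart \<phi> \<tau> = (\<lambda>e i. if i < mdim (base E) then \<phi> (proj E e) i else \<tau> e (i - mdim (base E)))"
    by (simp add: total_chart_def fun_eq_iff)
  then show ?thesis using triv by (simp add: local_trivialization_def)
qed

lemma triv_open: "open U" "open (proj E -` U)"
  using chart_open[OF maximal_atlas_is_chart[OF triv_base_chart]]
    chart_open[OF maximal_atlas_is_chart[OF triv_total_chart]] by auto

lemma triv_smul: "proj E e \<in> U \<Longrightarrow> \<tau> (smul E c e) i = c * \<tau> e i"
  using triv by (auto simp: local_trivialization_def fibre_linear_def fibre_def)

lemma triv_vadd: "proj E e \<in> U \<Longrightarrow> proj E e' = proj E e \<Longrightarrow> \<tau> (vadd E e e') i = \<tau> e i + \<tau> e' i"
  using triv by (auto simp: local_trivialization_def fibre_linear_def fibre_def)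

lemma triv_bij: "x \<in> U \<Longrightarrow> bij_betw \<tau> (fibre E x) (rspace (rank E))"
  using triv by (auto simp: local_trivialization_def topspace_Euclidean_space)

lemma triv_eq_0: "proj E e \<in> U \<Longrightarrow> rank E \<le> i \<Longrightarrow> \<tau> e i = 0"
  using bij_betwE[OF triv_bij] by (auto simp: fibre_def)

lemma triv_inj: "proj E e \<in> U \<Longrightarrow> proj E e' = proj E e \<Longrightarrow> (\<And>i. \<tau> e i = \<tau> e' i) \<Longrightarrow> e = e'"
  by (rule inj_onD[OF bij_betw_imp_inj_on[OF triv_bij, of "proj E e"]]) (auto simp: fibre_def)

lemma triv_surj:
  assumes "x \<in> U" "z \<in> rspace (rank E)"
  obtains e where "proj E e = x" "\<tau> e = z"
proof -
  have "z \<in> \<tau> ` fibre E x"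
    using bij_betw_imp_surj_on[OF triv_bij[OF assms(1)]] assms(2) by blast
  then show ?thesis using that by (auto simp: fibre_def)
qed

lemma triv_smooth_at: "proj E e \<in> U \<Longrightarrow> smooth_at (total E) (\<lambda>e. \<tau> e j) e"
  using smooth_at_coord[OF total_manifold triv_total_chart, of e "mdim (base E) + j"]
  by (simp add: total_chart_def)

lemma triv_smooth_at_base:
  "proj E e \<in> U \<Longrightarrow> i < mdim (base E) \<Longrightarrow> smooth_at (total E) (\<lambda>e. \<phi> (proj E e) i) e"
  using smooth_at_coord[OF total_manifold triv_total_chart, of e i]
  by (simp add: total_chart_def)

end

text \<open>Continuity of the projection is not an axiom of a vector bundle. It holds because the
  coordinates of \<open>proj E e\<close> are the first coordinates of \<open>e\<close> in the chart
  of a local trivialization.\<close>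

lemma open_proj_vimage:
  assumes W: "open W"
  shows "open (proj E -` W)"
proof (subst open_subopen, intro ballI)
  fix e assume e: "e \<in> proj E -` W"
  obtain U \<phi> \<tau> where U: "proj E e \<in> U" and T: "local_trivialization E (U, \<phi>) \<tau>"
    using trivialization_exists by blast
  note cU = maximal_atlas_is_chart[OF triv_base_chart[OF T]]
  have "continuous_on (proj E -` U) (\<lambda>e. \<phi> (proj E e))"
  proof (rule continuous_on_coordinatewise_then_product)
    fix i
    show "continuous_on (proj E -` U) (\<lambda>e. \<phi> (proj E e) i)"
    proof (cases "i < mdim (base E)")
      case True
      then show ?thesis
        by (intro continuous_at_imp_continuous_on ballI smooth_at_isCont[OF total_manifold] triv_smooth_at_base[OF T]) auto
    next
      case False
      then have "0 = \<phi> (proj E e) i" if "e \<in> proj E -` U" for e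
        using chart_mem_rspace[OF cU] that by auto
      with continuous_on_const show ?thesis by (rule continuous_on_eq)
    qed
  qed
  moreover have "ropen (mdim (base E)) (\<phi> ` (U \<inter> W))"
    using triv_open[OF T] W by (intro chart_image_openin[OF cU]) auto
  then obtain T' where T': "open T'" "\<phi> ` (U \<inter> W) = rspace (mdim (base E)) \<inter> T'"
    by (auto simp: openin_Euclidean_space_iff)
  ultimately have "open ((\<lambda>e. \<phi> (proj E e)) -` T' \<inter> proj E -` U)"
    using triv_open(2)[OF T] by (simp add: continuous_on_open_vimage)
  moreover have "(\<lambda>e. \<phi> (proj E e)) -` T' \<inter> proj E -` U \<subseteq> proj E -` W"
  proof
    fix e' assume e': "e' \<in> (\<lambda>e. \<phi> (proj E e)) -` T' \<inter> proj E -` U"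
    then have "\<phi> (proj E e') \<in> \<phi> ` (U \<inter> W)"
      unfolding T'(2) using chart_mem_rspace[OF cU] by auto
    then show "e' \<in> proj E -` W"
      using chart_inj_on[OF cU] e' by (auto simp: inj_on_def)
  qed
  moreover have "e \<in> (\<lambda>e. \<phi> (proj E e)) -` T' \<inter> proj E -` U"
    using e U T'(2) by auto
  ultimately show "\<exists>T. open T \<and> e \<in> T \<and> T \<subseteq> proj E -` W" by blast
qed

lemma smooth_at_pullback:
  assumes g: "smooth_at (base E) g (proj E e)"
  shows "smooth_at (total E) (\<lambda>e. g (proj E e)) e"
proof -
  obtain U \<phi> \<tau> where U: "proj E e \<in> U" and T: "local_trivialization E (U, \<phi>) \<tau>"
    using trivialization_exists by blast
  note cU = maximal_atlas_is_chart[OF triv_base_chart[OF T]]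
  obtain W where W: "open W" "proj E e \<in> W" "W \<subseteq> U"
    "smooth_on (mdim (base E)) (\<phi> ` W) (\<lambda>x. g (inv_into U \<phi> x))"
    using smooth_at_in_chart[OF base_manifold g triv_base_chart[OF T] U] by blast
  have "smooth_at (total E) (\<lambda>e. g (inv_into U \<phi> (\<phi> (proj E e)))) e"
    by (rule smooth_at_compose[OF total_manifold chart_image_openin[OF cU W(1,3)] W(4) open_proj_vimage[OF W(1)]])
      (use W chart_mem_rspace[OF cU] triv_smooth_at_base[OF T] in auto)
  then show ?thesis
    by (rule smooth_at_cong[OF total_manifold _ open_proj_vimage[OF W(1)]])
      (use W in \<open>auto simp: chart_inv_into[OF cU] subset_iff\<close>)
qed

lemma smooth_functions_pullback:
  "g \<in> smooth_functions (base E) \<Longrightarrow> g \<circ> proj E \<in> smooth_functions (total E)"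
  by (simp add: smooth_functions_iff[OF base_manifold] smooth_functions_iff[OF total_manifold]
      smooth_at_pullback comp_def)

subsection \<open>Linear, basic and affine functions\<close>

lemma linear_functions_iff:
  "h \<in> linear_functions E \<longleftrightarrow> h \<in> smooth_functions (total E) \<and> (\<forall>x. fibre_linear E x h)"
  by (subst linear_functions_eq) (auto simp: fibre_def proj_vadd)

lemma linear_smooth: "h \<in> linear_functions E \<Longrightarrow> h \<in> smooth_functions (total E)"
  by (simp add: linear_functions_iff)

lemma linear_smul: "h \<in> linear_functions E \<Longrightarrow> h (smul E c e) = c * h e"
  by (auto simp: linear_functions_iff fibre_linear_def fibre_def)

lemma basic_smooth: "a \<in> basic_functions E \<Longrightarrow> a \<in> smooth_functions (total E)"
  by (auto simp: basic_functions_def smooth_functions_pullback)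

lemma basic_smul: "a \<in> basic_functions E \<Longrightarrow> a (smul E c e) = a e"
  by (auto simp: basic_functions_def)

lemma linear_0: "0 \<in> linear_functions E"
  by (simp add: linear_functions_iff fibre_linear_def smooth_functions_0[OF total_manifold])

lemma linear_add: "h \<in> linear_functions E \<Longrightarrow> k \<in> linear_functions E \<Longrightarrow> h + k \<in> linear_functions E"
  by (auto simp: linear_functions_iff fibre_linear_def smooth_functions_add[OF total_manifold] algebra_simps)

lemma linear_diff: "h \<in> linear_functions E \<Longrightarrow> k \<in> linear_functions E \<Longrightarrow> h - k \<in> linear_functions E"
  by (auto simp: linear_functions_iff fibre_linear_def smooth_functions_diff[OF total_manifold] algebra_simps)

lemma basic_const: "(\<lambda>e. c) \<in> basic_functions E"
proof -
  have "(\<lambda>x. c) \<circ> proj E \<in> basic_functions E"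
    unfolding basic_functions_def by (intro imageI smooth_functions_const[OF base_manifold])
  then show ?thesis by (simp add: comp_def)
qed

lemma basic_add: "a \<in> basic_functions E \<Longrightarrow> b \<in> basic_functions E \<Longrightarrow> a + b \<in> basic_functions E"
  and basic_diff: "a \<in> basic_functions E \<Longrightarrow> b \<in> basic_functions E \<Longrightarrow> a - b \<in> basic_functions E"
  and basic_mult: "a \<in> basic_functions E \<Longrightarrow> b \<in> basic_functions E \<Longrightarrow> a * b \<in> basic_functions E"
proof -
  have *: "(g \<circ> proj E) + (g' \<circ> proj E) = (g + g') \<circ> proj E" "(g \<circ> proj E) - (g' \<circ> proj E) = (g - g') \<circ> proj E"
    "(g \<circ> proj E) * (g' \<circ> proj E) = (g * g') \<circ> proj E" for g g' :: "'m \<Rightarrow> real"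
    by (auto simp: fun_eq_iff)
  show "a \<in> basic_functions E \<Longrightarrow> b \<in> basic_functions E \<Longrightarrow> a + b \<in> basic_functions E"
    "a \<in> basic_functions E \<Longrightarrow> b \<in> basic_functions E \<Longrightarrow> a - b \<in> basic_functions E"
    "a \<in> basic_functions E \<Longrightarrow> b \<in> basic_functions E \<Longrightarrow> a * b \<in> basic_functions E"
    unfolding basic_functions_def
    by (auto simp: * intro!: imageI smooth_functions_add[OF base_manifold] smooth_functions_diff[OF base_manifold]
        smooth_functions_mult[OF base_manifold])
qed

lemma basic_mult_linear: "a \<in> basic_functions E \<Longrightarrow> h \<in> linear_functions E \<Longrightarrow> a * h \<in> linear_functions E"
  using basic_smooth[of a]
  by (auto simp: linear_functions_iff fibre_linear_def fibre_def proj_vadd basic_functions_def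
      smooth_functions_mult[OF total_manifold] algebra_simps)

text \<open>At the zero vector \<open>smul E 0 e\<close> a basic function keeps its value at
  \<open>e\<close>, while a linear one is 0. This separates the two degrees of an affine
  function.\<close>

lemma basic_linear_eq_0:
  assumes "f \<in> basic_functions E" "f \<in> linear_functions E"
  shows "f = 0"
proof
  fix e show "f e = 0 e"
    using basic_smul[OF assms(1), of 0 e] linear_smul[OF assms(2), of 0 e] by simp
qed

text \<open>Scaling a vector by 2 multiplies the square by 4, but a linear function by 2.\<close>

lemma square_linear_eq_0:
  assumes h: "h \<in> linear_functions E" and hh: "h * h \<in> linear_functions E"
  shows "h = 0"
proof
  fix e show "h e = 0 e"
    using linear_smul[OF hh, of 2 e] linear_smul[OF h, of 2 e] by simp
qed

lemma affine_functionsE: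
  assumes "f \<in> affine_functions E"
  obtains a h where "a \<in> basic_functions E" "h \<in> linear_functions E" "f = a + h"
  using assms by (auto simp: affine_functions_def)

lemma affine_functionsI: "a \<in> basic_functions E \<Longrightarrow> h \<in> linear_functions E \<Longrightarrow> a + h \<in> affine_functions E"
  by (auto simp: affine_functions_def)

lemma basic_affine: "a \<in> basic_functions E \<Longrightarrow> a \<in> affine_functions E"
  using affine_functionsI[OF _ linear_0] by simp

lemma linear_affine: "h \<in> linear_functions E \<Longrightarrow> h \<in> affine_functions E"
  using affine_functionsI[OF basic_const[of 0], of h] by (simp add: plus_fun_def)

lemma affine_smooth: "f \<in> affine_functions E \<Longrightarrow> f \<in> smooth_functions (total E)"
  using smooth_functions_add[OF total_manifold basic_smooth linear_smooth] by (auto elim!: affine_functionsE)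

lemma affine_add: "f \<in> affine_functions E \<Longrightarrow> g \<in> affine_functions E \<Longrightarrow> f + g \<in> affine_functions E"
proof -
  assume "f \<in> affine_functions E" "g \<in> affine_functions E"
  then obtain a h b k where *: "a \<in> basic_functions E" "h \<in> linear_functions E" "f = a + h"
    "b \<in> basic_functions E" "k \<in> linear_functions E" "g = b + k"
    by (meson affine_functionsE)
  have "(a + b) + (h + k) \<in> affine_functions E"
    using * by (intro affine_functionsI basic_add linear_add)
  then show ?thesis using * by (simp add: algebra_simps)
qed

lemma basic_mult_affine: "b \<in> basic_functions E \<Longrightarrow> f \<in> affine_functions E \<Longrightarrow> b * f \<in> affine_functions E"
proof -
  assume b: "b \<in> basic_functions E" and "f \<in> affine_functions E"
  then obtain a h where *: "a \<in> basic_functions E" "h \<in> linear_functions E" "f = a + h"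
    by (meson affine_functionsE)
  have "b * a + b * h \<in> affine_functions E"
    using * b by (intro affine_functionsI basic_mult basic_mult_linear)
  then show ?thesis using * by (simp add: algebra_simps)
qed

text \<open>The fibre coordinates are cut off by a function pulled back from the base. Being
  constant along fibres, it preserves linearity, which a bump function on the total space would
  destroy.\<close>

lemma linear_frame:
  assumes T: "local_trivialization E (U, \<phi>) \<tau>" and x: "x \<in> U"
  obtains h N where "open N" "x \<in> N" "N \<subseteq> U" "\<forall>j. h j \<in> linear_functions E"
    "\<forall>e j. proj E e \<in> N \<longrightarrow> h j e = \<tau> e j"
proof -
  obtain b N K where b: "b \<in> smooth_functions (base E)" "open N" "closed K" "x \<in> N" "N \<subseteq> K" "K \<subseteq> U"
    "\<forall>q\<in>N. b q = 1" "\<forall>q. q \<notin> K \<longrightarrow> b q = 0"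
    using bump_function[OF base_manifold triv_open(1)[OF T] x] by blast
  define h where "h j e = (if e \<in> proj E -` U then (b \<circ> proj E) e * \<tau> e j else 0)" for j e
  have "closed (proj E -` K)"
    using open_proj_vimage[of "- K"] b(3) by (simp add: open_Compl closed_def vimage_Compl)
  then have "(\<lambda>e. if e \<in> proj E -` U then (b \<circ> proj E) e * \<tau> e j else 0) \<in> smooth_functions (total E)" for j
    by (rule cutoff_smooth[OF total_manifold smooth_functions_pullback[OF b(1)] triv_open(2)[OF T]])
      (use b triv_smooth_at[OF T] in auto)
  then have "h j \<in> smooth_functions (total E)" for j
    unfolding h_def by simp
  moreover have "fibre_linear E y (h j)" for y j
    unfolding fibre_linear_def fibre_def h_def
    by (auto simp: proj_vadd triv_vadd[OF T] triv_smul[OF T] algebra_simps)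
  ultimately have "\<forall>j. h j \<in> linear_functions E" by (simp add: linear_functions_iff)
  moreover have "\<forall>e j. proj E e \<in> N \<longrightarrow> h j e = \<tau> e j"
    using b(5-7) by (auto simp: h_def)
  moreover have "N \<subseteq> U" using b by blast
  ultimately show ?thesis using that[of N h] b by blast
qed

subsection \<open>Derivations are determined by linear functions\<close>

text \<open>If \<open>c\<close> is basic and \<open>h\<close> is linear with \<open>h e \<noteq> 0\<close>, then \<open>c h\<close> is linear, and \<open>0 = D (c h) e = h e * D c e\<close>
  shows that \<open>D\<close> vanishes at \<open>e\<close> also on basic functions.\<close>

lemma derivation_eq_0_nonzero_vector:
  assumes D: "derivation (total E) D" and lin: "\<And>h. h \<in> linear_functions E \<Longrightarrow> D h = 0"
    and f: "f \<in> smooth_functions (total E)"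
    and T: "local_trivialization E (U, \<phi>) \<tau>" and e: "proj E e \<in> U" "\<tau> e k \<noteq> 0"
  shows "D f e = 0"
proof -
  let ?m = "mdim (base E)"
  obtain h N where N: "open N" "proj E e \<in> N" "N \<subseteq> U" "\<forall>j. h j \<in> linear_functions E"
    "\<forall>e j. proj E e \<in> N \<longrightarrow> h j e = \<tau> e j"
    by (rule linear_frame[OF T e(1)], rule that)
  have "\<exists>c N. c \<in> smooth_functions (base E) \<and> open N \<and> proj E e \<in> N \<and> (\<forall>x\<in>N. c x = \<phi> x i)" for i
    by (rule local_extension[OF base_manifold triv_open(1)[OF T] e(1)
          smooth_at_coord[OF base_manifold triv_base_chart[OF T], where i = i]]) blast+
  then obtain c N' where c: "\<And>i. c i \<in> smooth_functions (base E)" "\<And>i. open (N' i)" "\<And>i. proj E e \<in> N' i"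
    "\<And>i x. x \<in> N' i \<Longrightarrow> c i x = \<phi> x i"
    by metis
  define C where "C i = (if i < ?m then c i \<circ> proj E else h (i - ?m))" for i
  let ?N = "proj E -` (N \<inter> (\<Inter>i\<in>{..<?m}. N' i))"
  show ?thesis
  proof (rule derivation_eq_0_if_coords[OF total_manifold D triv_total_chart[OF T], where c = C and N = ?N])
    show "e \<in> proj E -` U" using e by simp
    show "C i \<in> smooth_functions (total E)" for i
      using N(4) c(1) by (auto simp: C_def smooth_functions_pullback linear_smooth)
    show "open ?N" using N(1) c(2) by (intro open_proj_vimage open_Int open_INT) auto
    show "e \<in> ?N" using N(2) c(3) by auto
    show "C i q = total_chart \<phi> \<tau> q i" if "q \<in> ?N" for i q
      using that N(5) c(4) by (auto simp: C_def total_chart_def)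
    show "D (C i) e = 0" for i
    proof (cases "i < ?m")
      case True
      have b: "c i \<circ> proj E \<in> basic_functions E"
        using c(1) by (auto simp: basic_functions_def)
      have "D ((c i \<circ> proj E) * h k) = 0"
        using b N(4) by (intro lin basic_mult_linear) auto
      then have "(c i \<circ> proj E) * D (h k) + h k * D (c i \<circ> proj E) = 0"
        using derivation_mult[OF D basic_smooth[OF b] linear_smooth] N(4) by simp
      then have "((c i \<circ> proj E) * D (h k) + h k * D (c i \<circ> proj E)) e = 0" by simp
      then show ?thesis
        using lin N(2,4,5) e(2) True by (simp add: C_def)
    next
      case False
      then show ?thesis using lin N(4) by (simp add: C_def)
    qed
  qed (rule f)
qed

lemma derivation_eq_0_if_linear:
  assumes rank: "rank E > 0"
    and D: "derivation (total E) D" and lin: "\<And>h. h \<in> linear_functions E \<Longrightarrow> D h = 0"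
    and f: "f \<in> smooth_functions (total E)"
  shows "D f = 0"
proof
  fix e
  let ?m = "mdim (base E)"
  obtain U \<phi> \<tau> where U: "proj E e \<in> U" and T: "local_trivialization E (U, \<phi>) \<tau>"
    using trivialization_exists by blast
  let ?\<chi> = "total_chart \<phi> \<tau>"
  note cU = maximal_atlas_is_chart[OF triv_total_chart[OF T]]
  show "D f e = 0 e"
  proof (rule ccontr)
    assume ne: "D f e \<noteq> 0 e"
    have "continuous_on UNIV (D f)"
      using smooth_at_isCont[OF total_manifold smooth_functionsD[OF total_manifold derivation_smooth[OF D f]]]
      by (simp add: continuous_on_eq_continuous_at)
    then have "open (D f -` (- {0}))" by (intro open_vimage) auto
    define W where "W = proj E -` U \<inter> D f -` (- {0})"
    have W: "open W" "e \<in> W" "W \<subseteq> proj E -` U"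
      using \<open>open (D f -` (- {0}))\<close> triv_open(2)[OF T] U ne by (auto simp: W_def)
    obtain d where d: "d > 0" "cube (mdim (total E)) (?\<chi> e) d \<subseteq> ?\<chi> ` W"
      using cube_subset_openin[OF chart_image_openin[OF cU W(1,3)], of "?\<chi> e"] W(2) by blast
    \<comment> \<open>\<open>?m\<close> is the index of the first fibre coordinate, which exists
      because the rank is positive. The shift by \<open>d / 2\<close> stays within the cube, and of
      two values differing by \<open>d / 2\<close> at least one is nonzero.\<close>
    define z where "z = (?\<chi> e)(?m := ?\<chi> e ?m + d / 2)"
    have "?\<chi> e \<in> rspace (mdim (total E))" using chart_mem_rspace[OF cU] U by auto
    then have "z \<in> cube (mdim (total E)) (?\<chi> e) d"
      using d(1) rank by (auto simp: z_def cube_def mdim_total)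
    then obtain e' where e': "e' \<in> W" "?\<chi> e' = z" using d(2) by auto
    then have "?\<chi> e' ?m = ?\<chi> e ?m + d / 2" by (simp add: z_def)
    then have "\<tau> e' 0 = \<tau> e 0 + d / 2" by (simp add: total_chart_def)
    then have "\<tau> e 0 \<noteq> 0 \<or> \<tau> e' 0 \<noteq> 0" using d(1) by auto
    then show False
      using derivation_eq_0_nonzero_vector[OF D lin f T, of e 0] derivation_eq_0_nonzero_vector[OF D lin f T, of e' 0]
        U e'(1) ne by (auto simp: W_def)
  qed
qed

section \<open>Uniqueness of multivector fields on the total space\<close>

lemma vector_field_eq_0:
  assumes "rank E > 0" and X: "vector_field (total E) X" and lin: "\<And>h. h \<in> linear_functions E \<Longrightarrow> X [h] = 0"
  shows "X = 0"
proof
  fix fs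
  show "X fs = 0 fs"
  proof (cases "\<exists>f\<in>smooth_functions (total E). fs = [f]")
    case True
    then show ?thesis
      using derivation_eq_0_if_linear[OF assms(1) vector_field_derivation[OF X]] lin by auto
  next
    case False
    then show ?thesis using X unfolding vector_field_iff by simp
  qed
qed

lemma vector_field_eqI:
  assumes "rank E > 0" and X: "vector_field (total E) X" and Y: "vector_field (total E) Y"
    and lin: "\<And>h. h \<in> linear_functions E \<Longrightarrow> X [h] = Y [h]"
  shows "X = Y"
proof -
  have "X - Y = 0"
    by (rule vector_field_eq_0[OF assms(1) vector_field_diff[OF total_manifold X Y]]) (simp add: lin)
  then show ?thesis by simp
qed

lemma bivector_field_eq_0:
  assumes r: "rank E > 0" and B: "bivector_field (total E) B"
    and lin: "\<And>h k. h \<in> linear_functions E \<Longrightarrow> k \<in> linear_functions E \<Longrightarrow> B [h, k] = 0"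
  shows "B = 0"
proof
  let ?S = "smooth_functions (total E)"
  have 1: "B [f, k] = 0" if "f \<in> ?S" "k \<in> linear_functions E" for f k
    by (rule derivation_eq_0_if_linear[OF r bivector_field_derivation(1)[OF B linear_smooth[OF that(2)]] lin[OF _ that(2)] that(1)])
  have 2: "B [f, g] = 0" if "f \<in> ?S" "g \<in> ?S" for f g
    by (rule derivation_eq_0_if_linear[OF r bivector_field_derivation(2)[OF B that(1)] 1[OF that(1)] that(2)])
  fix fs
  show "B fs = 0 fs"
  proof (cases "\<exists>f\<in>?S. \<exists>g\<in>?S. fs = [f, g]")
    case True
    then show ?thesis using 2 by auto
  next
    case False
    then show ?thesis using B unfolding bivector_field_iff by simp
  qed
qed

text \<open>The arguments are released from linearity one at a time: cyclic invariance brings the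
  next one to the front, where the bracket is a derivation.\<close>

lemma schouten_2_2_eq_0:
  assumes r: "rank E > 0" and B: "bivector_field (total E) B"
    and lin: "\<And>f g h. f \<in> linear_functions E \<Longrightarrow> g \<in> linear_functions E \<Longrightarrow> h \<in> linear_functions E \<Longrightarrow>
      schouten 2 2 B B [f, g, h] = 0"
  shows "schouten 2 2 B B = 0"
proof
  let ?S = "smooth_functions (total E)" and ?J = "\<lambda>f g h. schouten 2 2 B B [f, g, h]"
  note cyclic = schouten_trivector_cyclic[OF total_manifold B]
  have ext: "?J f g h = 0" if "f \<in> ?S" "g \<in> ?S" "h \<in> ?S" "\<And>f. f \<in> linear_functions E \<Longrightarrow> ?J f g h = 0" for f g h
    by (rule derivation_eq_0_if_linear[OF r schouten_trivector_derivation[OF total_manifold B that(2,3)] that(4) that(1)])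
  have 1: "?J f g h = 0" if "f \<in> ?S" "g \<in> linear_functions E" "h \<in> linear_functions E" for f g h
    using ext[OF that(1) linear_smooth[OF that(2)] linear_smooth[OF that(3)]] lin that by blast
  have 2: "?J g h f = 0" if "f \<in> ?S" "g \<in> ?S" "h \<in> linear_functions E" for f g h
    using ext[OF that(2) linear_smooth[OF that(3)] that(1)] 1[OF that(1) _ that(3)]
      cyclic[OF that(1) linear_smooth linear_smooth[OF that(3)]] by metis
  have 3: "?J h f g = 0" if "f \<in> ?S" "g \<in> ?S" "h \<in> ?S" for f g h
    using ext[OF that(3,1,2)] 2[OF that(1,2)] cyclic[OF that(2) linear_smooth that(1)] by metis
  fix fs
  show "schouten 2 2 B B fs = 0 fs"
  proof (cases "length fs + 1 = 2 + 2 \<and> set fs \<subseteq> ?S")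
    case True
    then obtain f g h where "fs = [f, g, h]" "f \<in> ?S" "g \<in> ?S" "h \<in> ?S"
      by (auto simp: length_Suc_conv eval_nat_numeral)
    then show ?thesis using 3 by auto
  next
    case False
    then show ?thesis using schouten_support[OF total_manifold B B] by simp
  qed
qed

subsection \<open>The Liouville field and vertical lifts\<close>

text \<open>The vector space laws of the fibres are not listed in the definition; they are recovered
  from injectivity of the fibre coordinates.\<close>

lemma smul_1: "smul E 1 e = e"
proof -
  obtain U \<phi> \<tau> where U: "proj E e \<in> U" and T: "local_trivialization E (U, \<phi>) \<tau>"
    using trivialization_exists by blast
  show ?thesis by (rule triv_inj[OF T]) (use U in \<open>auto simp: triv_smul[OF T]\<close>)
qed

lemma vadd_smul_0:
  assumes "proj E v = proj E e"
  shows "vadd E e (smul E 0 v) = e"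
proof -
  obtain U \<phi> \<tau> where U: "proj E e \<in> U" and T: "local_trivialization E (U, \<phi>) \<tau>"
    using trivialization_exists by blast
  show ?thesis
    by (rule triv_inj[OF T]) (use U assms in \<open>auto simp: triv_smul[OF T] triv_vadd[OF T] proj_vadd\<close>)
qed

lemma liouville_vector_field: "vector_field (total E) (liouville E)"
  unfolding liouville_def
proof (rule curve_vector_field[OF total_manifold])
  show "smul E 1 e = e" for e by (rule smul_1)
  fix e
  let ?m = "mdim (base E)"
  obtain U \<phi> \<tau> where U: "proj E e \<in> U" and T: "local_trivialization E (U, \<phi>) \<tau>"
    using trivialization_exists by blast
  \<comment> \<open>The velocity of \<open>t \<mapsto> t e\<close> at time 1: the base coordinates
    stand still, and the fibre coordinates move at the rate of their own value.\<close>
  define v where "v i = (if i < ?m then (\<lambda>e. 0) else (\<lambda>e. \<tau> e (i - ?m)))" for i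
  have "smooth_at (total E) (v i) q" if "proj E q \<in> U" for i q
    using triv_smooth_at[OF T that] smooth_at_const[OF total_manifold] by (simp add: v_def)
  moreover have "((\<lambda>t. total_chart \<phi> \<tau> (smul E t q) i) has_real_derivative v i q) (at 1)" if "proj E q \<in> U" for i q
    using that by (auto simp: total_chart_def v_def triv_smul[OF T] intro!: derivative_eq_intros)
  ultimately show "\<exists>U \<phi> v. (U, \<phi>) \<in> maximal_atlas (total E) \<and> e \<in> U \<and>
      (\<forall>q\<in>U. (\<forall>t. smul E t q \<in> U) \<and> (\<forall>i<mdim (total E). smooth_at (total E) (v i) q \<and>
         ((\<lambda>t. \<phi> (smul E t q) i) has_real_derivative v i q) (at 1)))"
    using triv_total_chart[OF T] U by (intro exI[of _ "proj E -` U"] exI[of _ "total_chart \<phi> \<tau>"] exI[of _ v]) auto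
qed

lemma liouville_of_linear: "h \<in> linear_functions E \<Longrightarrow> liouville E [h] = h"
  by (rule liouville_linear) (auto simp: linear_functions_iff)

lemma liouville_of_basic:
  assumes "a \<in> basic_functions E"
  shows "liouville E [a] = 0"
  using basic_smooth[OF assms] basic_smul[OF assms] by (auto simp: liouville_def vector_field_by_def fun_eq_iff)

lemma section_proj: "\<Phi> \<in> sections E \<Longrightarrow> proj E (\<Phi> x) = x"
  by (auto simp: sections_def fibre_def)

text \<open>Smooth maps are tested in charts of the atlas, whereas trivialization charts belong only
  to the maximal atlas. The transition from one to the other is composed with the coordinates of
  \<open>\<Phi>\<close>.\<close>

lemma section_smooth_at:
  assumes \<Phi>: "\<Phi> \<in> sections E" and T: "local_trivialization E (U, \<phi>) \<tau>" and x: "x \<in> U"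
    and j: "j < rank E"
  shows "smooth_at (base E) (\<lambda>x. \<tau> (\<Phi> x) j) x"
proof -
  let ?m = "mdim (base E)" and ?n = "mdim (total E)" and ?\<chi> = "total_chart \<phi> \<tau>"
  have \<Phi>': "smooth_map (base E) (total E) \<Phi>" using \<Phi> by (simp add: sections_def)
  then have cont: "open (\<Phi> -` V)" if "open V" for V
    using that by (auto simp: smooth_map_def intro: open_vimage)
  obtain A \<alpha> where A: "(A, \<alpha>) \<in> atlas (total E)" "\<Phi> x \<in> A" using atlas_covers[OF total_manifold] by blast
  obtain B \<beta> where B: "(B, \<beta>) \<in> atlas (base E)" "x \<in> B" using atlas_covers[OF base_manifold] by blast
  have A': "(A, \<alpha>) \<in> maximal_atlas (total E)" and B': "(B, \<beta>) \<in> maximal_atlas (base E)"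
    using A B atlas_subset_maximal_atlas[OF total_manifold] atlas_subset_maximal_atlas[OF base_manifold] by auto
  note cA = maximal_atlas_is_chart[OF A'] and cB = maximal_atlas_is_chart[OF B']
  have opW: "open (B \<inter> \<Phi> -` A)" using chart_open[OF cB] cont[OF chart_open[OF cA]] by blast
  have \<alpha>: "smooth_at (base E) (\<lambda>x. \<alpha> (\<Phi> x) i) y" if "i < ?n" "y \<in> B \<inter> \<Phi> -` A" for i y
  proof -
    have "smooth_on ?m (\<beta> ` (B \<inter> \<Phi> -` A)) (\<lambda>x. \<alpha> (\<Phi> (inv_into B \<beta> x)) i)"
      using \<Phi>' A(1) B(1) that(1)
      unfolding smooth_map_def Ball_def split_paired_All prod.case by blast
    then show ?thesis
      using smooth_on_chart_iff[OF base_manifold B' opW, of "\<lambda>x. \<alpha> (\<Phi> x) i"] that(2) by auto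
  qed
  let ?V = "\<alpha> ` (A \<inter> proj E -` U)" and ?N = "(B \<inter> \<Phi> -` A) \<inter> U"
  have N: "open ?N" "x \<in> ?N" using opW triv_open(1)[OF T] A B x by auto
  have opV: "ropen ?n ?V"
    using chart_open[OF cA] triv_open(2)[OF T] by (intro chart_image_openin[OF cA]) auto
  have "smooth_at (base E) (\<lambda>x. ?\<chi> (inv_into A \<alpha> (\<alpha> (\<Phi> x))) (?m + j)) x"
  proof (rule smooth_at_compose[OF base_manifold opV _ N, where F = "\<lambda>y. ?\<chi> (inv_into A \<alpha> y) (?m + j)"
        and H = "\<lambda>x. \<alpha> (\<Phi> x)"])
    show "smooth_on ?n ?V (\<lambda>y. ?\<chi> (inv_into A \<alpha> y) (?m + j))"
      by (rule maximal_atlas_transition[OF total_manifold A' triv_total_chart[OF T]]) (use j in \<open>simp add: mdim_total\<close>)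
    show "\<alpha> (\<Phi> y) \<in> rspace ?n" if "y \<in> ?N" for y using chart_mem_rspace[OF cA] that by auto
    show "smooth_at (base E) (\<lambda>x. \<alpha> (\<Phi> x) i) x" if "i < ?n" for i using \<alpha>[OF that] N by blast
    show "\<alpha> (\<Phi> x) \<in> ?V" using A x section_proj[OF \<Phi>] by auto
  qed
  then show ?thesis
    by (rule smooth_at_cong[OF base_manifold _ N]) (auto simp: chart_inv_into[OF cA] total_chart_def)
qed

lemma vertical_lift_vector_field:
  assumes \<Phi>: "\<Phi> \<in> sections E"
  shows "vector_field (total E) (vertical_lift E \<Phi>)"
  unfolding vertical_lift_def
proof (rule curve_vector_field[OF total_manifold])
  note P = section_proj[OF \<Phi>]
  show "vadd E e (smul E 0 (\<Phi> (proj E e))) = e" for e by (rule vadd_smul_0) (simp add: P)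
  fix e
  let ?m = "mdim (base E)" and ?\<gamma> = "\<lambda>e t. vadd E e (smul E t (\<Phi> (proj E e)))"
  obtain U \<phi> \<tau> where U: "proj E e \<in> U" and T: "local_trivialization E (U, \<phi>) \<tau>"
    using trivialization_exists by blast
  define v where "v i = (if i < ?m then (\<lambda>e. 0) else (\<lambda>e. \<tau> (\<Phi> (proj E e)) (i - ?m)))" for i
  have "smooth_at (total E) (v i) q" if "proj E q \<in> U" "i < mdim (total E)" for i q
  proof (cases "i < ?m")
    case True
    then show ?thesis using smooth_at_const[OF total_manifold] by (simp add: v_def)
  next
    case False
    then have "i - ?m < rank E" using that mdim_total by simp
    from smooth_at_pullback[OF section_smooth_at[OF \<Phi> T that(1) this]] show ?thesis
      using False by (simp add: v_def)
  qed
  moreover have "((\<lambda>t. total_chart \<phi> \<tau> (?\<gamma> q t) i) has_real_derivative v i q) (at 0)" if "proj E q \<in> U" for i q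
    using that by (auto simp: total_chart_def v_def proj_vadd P triv_vadd[OF T] triv_smul[OF T] intro!: derivative_eq_intros)
  ultimately show "\<exists>U \<phi> v. (U, \<phi>) \<in> maximal_atlas (total E) \<and> e \<in> U \<and>
      (\<forall>q\<in>U. (\<forall>t. ?\<gamma> q t \<in> U) \<and> (\<forall>i<mdim (total E). smooth_at (total E) (v i) q \<and>
         ((\<lambda>t. \<phi> (?\<gamma> q t) i) has_real_derivative v i q) (at 0)))"
    using triv_total_chart[OF T] U
    by (intro exI[of _ "proj E -` U"] exI[of _ "total_chart \<phi> \<tau>"] exI[of _ v]) (auto simp: proj_vadd P)
qed

end

subsection \<open>Sections from vector fields\<close>

context
  fixes E :: "('m::{t2_space,second_countable_topology}, 'e::{t2_space,second_countable_topology}) vbundle"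
  assumes vb: "vector_bundle E"
begin

text \<open>Continuity has to come first, from the coordinates in one trivialization chart. Only
  then are preimages of chart domains open, as the passage to arbitrary charts of the atlas
  requires.\<close>

lemma sectionI:
  assumes P: "\<And>x. proj E (\<Phi> x) = x"
    and loc: "\<And>x. \<exists>U \<phi> \<tau>. x \<in> U \<and> local_trivialization E (U, \<phi>) \<tau> \<and>
      (\<forall>j<rank E. smooth_at (base E) (\<lambda>y. \<tau> (\<Phi> y) j) x)"
  shows "\<Phi> \<in> sections E"
proof -
  let ?m = "mdim (base E)" and ?n = "mdim (total E)"
  note bM = base_manifold[OF vb] and tM = total_manifold[OF vb]
  have coord: "smooth_at (base E) (\<lambda>y. total_chart E \<phi> \<tau> (\<Phi> y) i) x"
    if x: "x \<in> U" and T: "local_trivialization E (U, \<phi>) \<tau>"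
      and sm: "\<forall>j<rank E. smooth_at (base E) (\<lambda>y. \<tau> (\<Phi> y) j) x" and i: "i < ?n" for x U \<phi> \<tau> i
  proof (cases "i < ?m")
    case True
    then show ?thesis
      using smooth_at_coord[OF bM triv_base_chart[OF vb T] x, of i] by (simp add: total_chart_def[OF vb] P)
  next
    case False
    then have "i - ?m < rank E" using i mdim_total[OF vb] by simp
    then show ?thesis using False sm by (simp add: total_chart_def[OF vb])
  qed
  have cont: "\<exists>T. open T \<and> x \<in> T \<and> T \<subseteq> \<Phi> -` W" if W: "open W" "\<Phi> x \<in> W" for x W
  proof -
    obtain U \<phi> \<tau> where x: "x \<in> U" and T: "local_trivialization E (U, \<phi>) \<tau>"
      and sm: "\<forall>j<rank E. smooth_at (base E) (\<lambda>y. \<tau> (\<Phi> y) j) x"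
      using loc by blast
    let ?\<chi> = "total_chart E \<phi> \<tau>"
    note cU = maximal_atlas_is_chart[OF triv_total_chart[OF vb T]]
    have "\<exists>N. open N \<and> x \<in> N \<and> (\<forall>q\<in>N. smooth_at (base E) (\<lambda>y. ?\<chi> (\<Phi> y) i) q)" if "i < ?n" for i
      by (rule smooth_at_nhd[OF bM coord[OF x T sm that]]) blast
    then obtain N where N: "\<And>i. i < ?n \<Longrightarrow> open (N i)" "\<And>i. i < ?n \<Longrightarrow> x \<in> N i"
      "\<And>i q. i < ?n \<Longrightarrow> q \<in> N i \<Longrightarrow> smooth_at (base E) (\<lambda>y. ?\<chi> (\<Phi> y) i) q"
      by metis
    let ?N = "U \<inter> (\<Inter>i\<in>{..<?n}. N i)"
    have opN: "open ?N" using N triv_open(1)[OF vb T] by (intro open_Int open_INT) auto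
    have "continuous_on ?N (\<lambda>y. ?\<chi> (\<Phi> y))"
    proof (rule continuous_on_coordinatewise_then_product)
      fix i
      show "continuous_on ?N (\<lambda>y. ?\<chi> (\<Phi> y) i)"
      proof (cases "i < ?n")
        case True
        then show ?thesis
          using N(3) by (intro continuous_at_imp_continuous_on ballI smooth_at_isCont[OF bM]) auto
      next
        case False
        then have "0 = ?\<chi> (\<Phi> y) i" if "y \<in> ?N" for y
          using chart_mem_rspace[OF cU, of "\<Phi> y"] that P by auto
        with continuous_on_const show ?thesis by (rule continuous_on_eq)
      qed
    qed
    moreover have "ropen ?n (?\<chi> ` (proj E -` U \<inter> W))"
      using triv_open(2)[OF vb T] W by (intro chart_image_openin[OF cU]) auto
    then obtain T' where T': "open T'" "?\<chi> ` (proj E -` U \<inter> W) = rspace ?n \<inter> T'"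
      by (auto simp: openin_Euclidean_space_iff)
    ultimately have "open ((\<lambda>y. ?\<chi> (\<Phi> y)) -` T' \<inter> ?N)"
      using opN by (simp add: continuous_on_open_vimage)
    moreover have "(\<lambda>y. ?\<chi> (\<Phi> y)) -` T' \<inter> ?N \<subseteq> \<Phi> -` W"
    proof
      fix y assume y: "y \<in> (\<lambda>y. ?\<chi> (\<Phi> y)) -` T' \<inter> ?N"
      then have "\<Phi> y \<in> proj E -` U" using P by auto
      moreover from this have "?\<chi> (\<Phi> y) \<in> ?\<chi> ` (proj E -` U \<inter> W)"
        unfolding T'(2) using chart_mem_rspace[OF cU] y by auto
      ultimately show "y \<in> \<Phi> -` W"
        using chart_inj_on[OF cU] by (auto simp: inj_on_def)
    qed
    moreover have "?\<chi> (\<Phi> x) \<in> ?\<chi> ` (proj E -` U \<inter> W)" using x W P by auto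
    then have "x \<in> (\<lambda>y. ?\<chi> (\<Phi> y)) -` T' \<inter> ?N"
      using x N(2) unfolding T'(2) by auto
    ultimately show ?thesis by blast
  qed
  have open_vim: "open (\<Phi> -` W)" if "open W" for W
    using cont[OF that] by (subst open_subopen) auto
  have "smooth_map (base E) (total E) \<Phi>"
    unfolding smooth_map_def
  proof (intro conjI ballI)
    show "continuous_on UNIV \<Phi>"
      using open_vim by (simp add: continuous_on_open_vimage)
    fix c assume c': "c \<in> atlas (base E)"
    obtain B \<beta> where c: "c = (B, \<beta>)" by (cases c)
    have "smooth_on ?m (\<beta> ` (B \<inter> \<Phi> -` A)) (\<lambda>y. \<alpha> (\<Phi> (inv_into B \<beta> y)) i)"
      if d: "(A, \<alpha>) \<in> atlas (total E)" and i: "i < ?n" for A \<alpha> i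
    proof -
      have A: "(A, \<alpha>) \<in> maximal_atlas (total E)" and B: "(B, \<beta>) \<in> maximal_atlas (base E)"
        using c' d atlas_subset_maximal_atlas[OF tM] atlas_subset_maximal_atlas[OF bM] unfolding c by auto
      note cA = maximal_atlas_is_chart[OF A] and cB = maximal_atlas_is_chart[OF B]
      have opW: "open (B \<inter> \<Phi> -` A)" using chart_open[OF cB] open_vim[OF chart_open[OF cA]] by blast
      have "smooth_at (base E) (\<lambda>y. \<alpha> (\<Phi> y) i) x" if xB: "x \<in> B \<inter> \<Phi> -` A" for x
      proof -
        obtain U \<phi> \<tau> where x: "x \<in> U" and T: "local_trivialization E (U, \<phi>) \<tau>"
          and sm: "\<forall>j<rank E. smooth_at (base E) (\<lambda>y. \<tau> (\<Phi> y) j) x"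
          using loc by blast
        let ?\<chi> = "total_chart E \<phi> \<tau>" and ?N = "U \<inter> \<Phi> -` A"
        note C = triv_total_chart[OF vb T]
        note cU = maximal_atlas_is_chart[OF C]
        have N: "open ?N" "x \<in> ?N" using triv_open(1)[OF vb T] open_vim[OF chart_open[OF cA]] x xB by auto
        have opV: "ropen ?n (?\<chi> ` (proj E -` U \<inter> A))"
          using triv_open(2)[OF vb T] chart_open[OF cA] by (intro chart_image_openin[OF cU]) auto
        have "smooth_at (base E) (\<lambda>y. \<alpha> (inv_into (proj E -` U) ?\<chi> (?\<chi> (\<Phi> y))) i) x"
        proof (rule smooth_at_compose[OF bM opV _ N, where H = "\<lambda>y. ?\<chi> (\<Phi> y)"
              and F = "\<lambda>z. \<alpha> (inv_into (proj E -` U) ?\<chi> z) i"])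
          show "smooth_on ?n (?\<chi> ` (proj E -` U \<inter> A)) (\<lambda>z. \<alpha> (inv_into (proj E -` U) ?\<chi> z) i)"
            by (rule maximal_atlas_transition[OF tM C A i])
          show "?\<chi> (\<Phi> y) \<in> rspace ?n" if "y \<in> ?N" for y using chart_mem_rspace[OF cU] that P by auto
          show "smooth_at (base E) (\<lambda>y. ?\<chi> (\<Phi> y) k) x" if "k < ?n" for k by (rule coord[OF x T sm that])
          show "?\<chi> (\<Phi> x) \<in> ?\<chi> ` (proj E -` U \<inter> A)" using x xB P by auto
        qed
        then show ?thesis
          by (rule smooth_at_cong[OF bM _ N]) (use P in \<open>auto simp: chart_inv_into[OF cU]\<close>)
      qed
      then show ?thesis
        using smooth_on_chart_iff[OF bM B opW, of "\<lambda>y. \<alpha> (\<Phi> y) i"] by auto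
    qed
    then show "case c of (U, \<phi>) \<Rightarrow> \<forall>(V, \<psi>)\<in>atlas (total E).
        \<forall>i<?n. smooth_on ?m (\<phi> ` (U \<inter> \<Phi> -` V)) (\<lambda>x. \<psi> (\<Phi> (inv_into U \<phi> x)) i)"
      unfolding c by auto
  qed
  then show ?thesis by (simp add: sections_def fibre_def P)
qed

text \<open>The coefficients are the values of \<open>h\<close> on the coordinate frame of the trivialization.\<close>

lemma linear_function_expansion:
  assumes T: "local_trivialization E (U, \<phi>) \<tau>" and h: "h \<in> linear_functions E"
  obtains c where "\<forall>j<rank E. \<forall>x\<in>U. smooth_at (base E) (c j) x"
    "\<forall>e. proj E e \<in> U \<longrightarrow> h e = (\<Sum>j<rank E. \<tau> e j * c j (proj E e))"
proof -
  let ?m = "mdim (base E)" and ?n = "mdim (total E)" and ?r = "rank E" and ?\<chi> = "total_chart E \<phi> \<tau>"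
  note bM = base_manifold[OF vb] and tM = total_manifold[OF vb]
  note C = triv_total_chart[OF vb T]
  note cU = maximal_atlas_is_chart[OF C]
  define \<delta> where "\<delta> j = (\<lambda>i. if i = j then 1 else 0 :: real)" for j :: nat
  have ex: "\<exists>e. proj E e = x \<and> \<tau> e = \<delta> j" if "x \<in> U" "j < ?r" for x j
    by (rule triv_surj[OF vb T that(1), of "\<delta> j"]) (use that in \<open>auto simp: \<delta>_def\<close>)
  \<comment> \<open>Over \<open>U\<close> this choice is the vector \<open>j\<close> of the
    coordinate frame of the trivialization.\<close>
  define s where "s j x = (SOME e. proj E e = x \<and> \<tau> e = \<delta> j)" for j x
  have s: "proj E (s j x) = x" "\<tau> (s j x) = \<delta> j" if "x \<in> U" "j < ?r" for x j
    using someI_ex[OF ex[OF that]] by (simp_all add: s_def)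
  have lin: "h (vadd E e e') = h e + h e'" if "proj E e' = proj E e" for e e'
    using h that by (auto simp: linear_functions_iff[OF vb] fibre_linear_def fibre_def)
  have "h e = (\<Sum>j<?r. \<tau> e j * h (s j (proj E e)))" if e: "proj E e \<in> U" for e
  proof -
    \<comment> \<open>Fibres have only a binary addition, so the expansion is proved by induction on
      \<open>k\<close>, with \<open>e'\<close> the truncation of \<open>e\<close> to its first
      \<open>k\<close> fibre coordinates.\<close>
    have "h e' = (\<Sum>j<k. \<tau> e j * h (s j (proj E e)))"
      if "k \<le> ?r" "proj E e' = proj E e" "\<forall>i. \<tau> e' i = (if i < k then \<tau> e i else 0)" for k e'
      using that
    proof (induction k arbitrary: e')
      case 0
      have "e' = smul E 0 e'"
        by (rule triv_inj[OF vb T]) (use 0 e in \<open>auto simp: triv_smul[OF vb T] proj_smul[OF vb]\<close>)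
      then show ?case using linear_smul[OF vb h, of 0 e'] by simp
    next
      case (Suc k)
      obtain e'' where e'': "proj E e'' = proj E e" "\<tau> e'' = (\<lambda>i. if i < k then \<tau> e i else 0)"
        by (rule triv_surj[OF vb T e, of "\<lambda>i. if i < k then \<tau> e i else 0"]) (use Suc.prems(1) in auto)
      let ?s = "s k (proj E e)"
      have k: "k < ?r" using Suc.prems by simp
      note sk = s(1)[OF e k] s(2)[OF e k]
      have "e' = vadd E e'' (smul E (\<tau> e k) ?s)"
      proof (rule triv_inj[OF vb T])
        show "proj E (vadd E e'' (smul E (\<tau> e k) ?s)) = proj E e'"
          using proj_vadd[OF vb, of "smul E (\<tau> e k) ?s" e''] sk e'' Suc.prems(2) by (simp add: proj_smul[OF vb])
        show "\<tau> e' i = \<tau> (vadd E e'' (smul E (\<tau> e k) ?s)) i" for i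
          using sk e'' Suc.prems(3) e
          by (simp add: triv_vadd[OF vb T] triv_smul[OF vb T] proj_smul[OF vb] \<delta>_def less_Suc_eq)
      qed (use e Suc.prems in simp)
      then have "h e' = h e'' + \<tau> e k * h ?s"
        using lin[of "smul E (\<tau> e k) ?s" e''] sk e'' linear_smul[OF vb h] by (simp add: proj_smul[OF vb])
      moreover have "h e'' = (\<Sum>j<k. \<tau> e j * h (s j (proj E e)))"
        by (rule Suc.IH) (use k e'' in auto)
      ultimately show ?case by simp
    qed
    from this[of ?r e] show ?thesis using triv_eq_0[OF vb T e] by auto
  qed
  \<comment> \<open>In the trivialization chart the frame vector has base coordinates
    \<open>\<phi>\<close> and constant fibre coordinates, so \<open>h\<close> along the frame is a
    composite of smooth maps.\<close>
  moreover have "smooth_at (base E) (\<lambda>x. h (s j x)) x" if j: "j < ?r" and x: "x \<in> U" for j x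
  proof -
    have op: "ropen ?n (?\<chi> ` (proj E -` U))"
      using triv_open(2)[OF vb T] by (intro chart_image_openin[OF cU]) auto
    have F: "smooth_on ?n (?\<chi> ` (proj E -` U)) (\<lambda>z. h (inv_into (proj E -` U) ?\<chi> z))"
      using smooth_on_chart_iff[OF tM C triv_open(2)[OF vb T] order.refl, of h]
        smooth_functionsD[OF tM linear_smooth[OF vb h]] by blast
    have "smooth_at (base E) (\<lambda>y. h (inv_into (proj E -` U) ?\<chi> (?\<chi> (s j y)))) x"
    proof (rule smooth_at_compose[OF bM op F triv_open(1)[OF vb T] x, where H = "\<lambda>y. ?\<chi> (s j y)"])
      show "?\<chi> (s j y) \<in> rspace ?n" if "y \<in> U" for y using chart_mem_rspace[OF cU] s(1)[OF that j] that by auto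
      show "?\<chi> (s j x) \<in> ?\<chi> ` (proj E -` U)" using s(1)[OF x j] x by auto
      fix i assume "i < ?n"
      show "smooth_at (base E) (\<lambda>y. ?\<chi> (s j y) i) x"
      proof (cases "i < ?m")
        case True
        have "smooth_at (base E) (\<lambda>y. \<phi> y i) x"
          by (rule smooth_at_coord[OF bM triv_base_chart[OF vb T] x])
        then show ?thesis
          by (rule smooth_at_cong[OF bM _ triv_open(1)[OF vb T] x]) (use True s(1) j in \<open>simp add: total_chart_def[OF vb]\<close>)
      next
        case False
        have "smooth_at (base E) (\<lambda>y. \<delta> j (i - ?m)) x" by (rule smooth_at_const[OF bM])
        then show ?thesis
          by (rule smooth_at_cong[OF bM _ triv_open(1)[OF vb T] x]) (use False s(2) j in \<open>simp add: total_chart_def[OF vb]\<close>)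
      qed
    qed
    then show ?thesis
      by (rule smooth_at_cong[OF bM _ triv_open(1)[OF vb T] x]) (use s(1) j in \<open>simp add: chart_inv_into[OF cU]\<close>)
  qed
  ultimately show ?thesis using that[of "\<lambda>j x. h (s j x)"] by blast
qed

text \<open>The basic part of \<open>X(h)\<close>, for linear \<open>h\<close>, is its value on the zero section, and it is linear in
  \<open>h\<close> over the functions on the base: it is given by pairing with a section.\<close>

lemma basic_part_section:
  assumes X: "vector_field (total E) X"
    and aff: "\<And>h. h \<in> linear_functions E \<Longrightarrow> X [h] \<in> affine_functions E"
  obtains \<Phi> where "\<Phi> \<in> sections E"
    "\<forall>h\<in>linear_functions E. \<exists>g\<in>smooth_functions (base E). (\<forall>x. h (\<Phi> x) = g x) \<and> X [h] - (g \<circ> proj E) \<in> linear_functions E"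
proof -
  let ?r = "rank E"
  note bM = base_manifold[OF vb] and tM = total_manifold[OF vb]
  note D = vector_field_derivation[OF X]
  have "\<exists>g\<in>smooth_functions (base E). X [h] - (g \<circ> proj E) \<in> linear_functions E" if h: "h \<in> linear_functions E" for h
  proof -
    obtain a l where al: "a \<in> basic_functions E" "l \<in> linear_functions E" "X [h] = a + l"
      using affine_functionsE[OF vb aff[OF h]] by blast
    then obtain g where "g \<in> smooth_functions (base E)" "a = g \<circ> proj E"
      by (auto simp: basic_functions_def)
    then show ?thesis using al by (intro bexI[of _ g]) simp_all
  qed
  then obtain g where g: "\<And>h. h \<in> linear_functions E \<Longrightarrow> g h \<in> smooth_functions (base E)"
    "\<And>h. h \<in> linear_functions E \<Longrightarrow> X [h] - (g h \<circ> proj E) \<in> linear_functions E"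
    by metis
  have zero: "X [h] (smul E 0 e) = g h (proj E e)" if "h \<in> linear_functions E" for h e
    using linear_smul[OF vb g(2)[OF that], of 0 e] by (simp add: proj_smul[OF vb])
  have "\<exists>v. proj E v = x \<and> (\<forall>h\<in>linear_functions E. h v = g h x)" for x
  proof -
    obtain U \<phi> \<tau> where x: "x \<in> U" and T: "local_trivialization E (U, \<phi>) \<tau>"
      using trivialization_exists[OF vb] by blast
    obtain k N where N: "open N" "x \<in> N" "N \<subseteq> U" "\<forall>j. k j \<in> linear_functions E"
      "\<forall>e j. proj E e \<in> N \<longrightarrow> k j e = \<tau> e j"
      by (rule linear_frame[OF vb T x], rule that)
    \<comment> \<open>The value of the section is forced by the local frame \<open>k\<close>: its
      fibre coordinate \<open>j\<close> must be the basic part of \<open>X [k j]\<close> at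
      \<open>x\<close>.\<close>
    obtain v where v: "proj E v = x" "\<tau> v = (\<lambda>j. if j < ?r then g (k j) x else 0)"
      by (rule triv_surj[OF vb T x, of "\<lambda>j. if j < ?r then g (k j) x else 0"]) auto
    have "h v = g h x" if h: "h \<in> linear_functions E" for h
    proof -
      obtain c where c: "\<forall>j<?r. \<forall>y\<in>U. smooth_at (base E) (c j) y"
        "\<forall>e. proj E e \<in> U \<longrightarrow> h e = (\<Sum>j<?r. \<tau> e j * c j (proj E e))"
        by (rule linear_function_expansion[OF T h], rule that)
      have "\<exists>c' N. c' \<in> smooth_functions (base E) \<and> open N \<and> x \<in> N \<and> (\<forall>y\<in>N. c' y = c j y)" if j: "j < ?r" for j
        by (rule local_extension[OF bM triv_open(1)[OF vb T] x, of "c j"]) (use c(1) j in blast)+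
      then obtain c' N' where c': "\<And>j. j < ?r \<Longrightarrow> c' j \<in> smooth_functions (base E)" "\<And>j. j < ?r \<Longrightarrow> open (N' j)"
        "\<And>j. j < ?r \<Longrightarrow> x \<in> N' j" "\<And>j y. j < ?r \<Longrightarrow> y \<in> N' j \<Longrightarrow> c' j y = c j y"
        by metis
      \<comment> \<open>At the zero vector every \<open>k j\<close> vanishes, so the product rule
        loses the term that differentiates the coefficient \<open>c' j\<close>. What remains is
        linearity over the functions on the base.\<close>
      let ?z = "smul E 0 v" and ?N = "proj E -` (N \<inter> (\<Inter>j\<in>{..<?r}. N' j))"
      have sm: "(c' j \<circ> proj E) \<in> smooth_functions (total E)" "k j \<in> smooth_functions (total E)" if "j < ?r" for j
        using c'(1)[OF that] N(4) smooth_functions_pullback[OF vb] linear_smooth[OF vb] by auto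
      have "g h x = X [h] ?z" using zero[OF h, of v] v(1) by simp
      also have "\<dots> = X [\<Sum>j<?r. (c' j \<circ> proj E) * k j] ?z"
      proof (rule derivation_local[OF tM D linear_smooth[OF vb h]])
        show "(\<Sum>j<?r. (c' j \<circ> proj E) * k j) \<in> smooth_functions (total E)"
          using sm by (intro smooth_functions_sum[OF tM] smooth_functions_mult[OF tM]) auto
        show "open ?N" using N(1) c'(2) by (intro open_proj_vimage[OF vb] open_Int open_INT) auto
        show "?z \<in> ?N" using N(2) c'(3) v(1) by (auto simp: proj_smul[OF vb])
        show "h q = (\<Sum>j<?r. (c' j \<circ> proj E) * k j) q" if q: "q \<in> ?N" for q
        proof -
          have "h q = (\<Sum>j<?r. \<tau> q j * c j (proj E q))" using c(2) q N(3) by auto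
          also have "\<dots> = (\<Sum>j<?r. c' j (proj E q) * k j q)"
            using q N(5) c'(4) by (intro sum.cong) auto
          finally show ?thesis by (simp add: sum_functions_apply)
        qed
      qed
      also have "\<dots> = (\<Sum>j<?r. X [(c' j \<circ> proj E) * k j] ?z)"
        using sm smooth_functions_mult[OF tM]
        by (subst derivation_sum[OF tM D]) (auto simp: sum_functions_apply)
      also have "\<dots> = (\<Sum>j<?r. \<tau> v j * c j x)"
      proof (rule sum.cong)
        fix j assume "j \<in> {..<?r}"
        then have j: "j < ?r" by simp
        have "k j ?z = 0" using linear_smul[OF vb, of "k j" 0 v] N(4) by simp
        moreover have "X [k j] ?z = \<tau> v j" using zero[of "k j" v] N(4) v j by simp
        moreover have "c' j x = c j x" using c'(3,4) j by blast
        ultimately show "X [(c' j \<circ> proj E) * k j] ?z = \<tau> v j * c j x"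
          using derivation_mult[OF D sm[OF j]] v(1) by (simp add: proj_smul[OF vb])
      qed simp
      also have "\<dots> = h v" using c(2) v(1) x by simp
      finally show ?thesis by simp
    qed
    then show ?thesis using v(1) by blast
  qed
  then obtain \<Phi> where \<Phi>: "\<And>x. proj E (\<Phi> x) = x" "\<And>x h. h \<in> linear_functions E \<Longrightarrow> h (\<Phi> x) = g h x"
    by metis
  have "\<Phi> \<in> sections E"
  proof (rule sectionI[OF \<Phi>(1)])
    fix x
    obtain U \<phi> \<tau> where x: "x \<in> U" and T: "local_trivialization E (U, \<phi>) \<tau>"
      using trivialization_exists[OF vb] by blast
    obtain k N where N: "open N" "x \<in> N" "N \<subseteq> U" "\<forall>j. k j \<in> linear_functions E"
      "\<forall>e j. proj E e \<in> N \<longrightarrow> k j e = \<tau> e j"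
      by (rule linear_frame[OF vb T x], rule that)
    \<comment> \<open>Near \<open>x\<close> the coordinate of \<open>\<Phi>\<close> is
      \<open>k j (\<Phi> y)\<close>, that is, the basic part \<open>g (k j) y\<close>, which is
      smooth on the base.\<close>
    have "smooth_at (base E) (\<lambda>y. \<tau> (\<Phi> y) j) x" for j
      by (rule smooth_at_cong[OF bM smooth_functionsD[OF bM g(1)[of "k j"]] N(1,2)])
        (use N(4,5) \<Phi> in \<open>auto simp flip: \<Phi>(2)\<close>)
    then show "\<exists>U \<phi> \<tau>. x \<in> U \<and> local_trivialization E (U, \<phi>) \<tau> \<and>
        (\<forall>j<?r. smooth_at (base E) (\<lambda>y. \<tau> (\<Phi> y) j) x)"
      using x T by blast
  qed
  then show ?thesis using that \<Phi>(2) g by blast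
qed

end

section \<open>Linear and affine Jacobi structures\<close>

text \<open>Expanding the double brackets gives the Jacobiator of \<open>L\<close> minus
  \<open>\<Gamma> \<and> L\<close>; the remaining terms cancel because
  \<open>[\<Gamma>, L] = 0\<close> makes \<open>\<Gamma>\<close> a derivation of the bracket given
  by \<open>L\<close>. The difference is zero by the equation for \<open>[L, L]\<close>, whose
  factor \<open>-2\<close> occurs on both sides.\<close>

lemma jacobi_bracket_identity:
  assumes M: "smooth_manifold M" and J: "jacobi_structure M (L, \<Gamma>)"
    and f: "f \<in> smooth_functions M" and g: "g \<in> smooth_functions M" and h: "h \<in> smooth_functions M"
  defines "B \<equiv> jacobi_bracket (L, \<Gamma>)"
  shows "B (B f g) h - B (B f h) g + B (B g h) f = 0"
proof -
  have L: "bivector_field M L" and G: "vector_field M \<Gamma>" and GL: "schouten 1 2 \<Gamma> L = 0"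
    and LL: "schouten 2 2 L L = (\<lambda>fs p. -2 * wedge 1 \<Gamma> L fs p)"
    using J by (auto simp: jacobi_structure_def)
  note dL = bivector_field_derivation[OF L] and dG = vector_field_derivation[OF G]
  note sL = derivation_smooth[OF dL(1)] and sG = derivation_smooth[OF dG]
  have B: "B u v = L [u, v] + u * \<Gamma> [v] - v * \<Gamma> [u]" for u v
    by (simp add: B_def jacobi_bracket_def)
  have 1: "L [L [f, g], h] - L [L [f, h], g] + L [L [g, h], f] =
      \<Gamma> [f] * L [g, h] - \<Gamma> [g] * L [f, h] + \<Gamma> [h] * L [f, g]"
  proof
    fix p
    show "(L [L [f, g], h] - L [L [f, h], g] + L [L [g, h], f]) p =
        (\<Gamma> [f] * L [g, h] - \<Gamma> [g] * L [f, h] + \<Gamma> [h] * L [f, g]) p"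
      using fun_cong[OF fun_cong[OF LL, of "[f, g, h]"], of p]
      unfolding schouten_2_2 wedge_1_2 by simp
  qed
  have 2: "\<Gamma> [L [u, v]] = L [\<Gamma> [u], v] - L [\<Gamma> [v], u]" for u v
    using fun_cong[OF GL, of "[u, v]"] unfolding schouten_1_2 by (simp add: algebra_simps)
  have e: "B (B u v) w = L [L [u, v], w] + (u * L [\<Gamma> [v], w] + \<Gamma> [v] * L [u, w]) - (v * L [\<Gamma> [u], w] + \<Gamma> [u] * L [v, w])
      + (L [u, v] + u * \<Gamma> [v] - v * \<Gamma> [u]) * \<Gamma> [w]
      - w * (L [\<Gamma> [u], v] - L [\<Gamma> [v], u] + u * \<Gamma> [\<Gamma> [v]] - v * \<Gamma> [\<Gamma> [u]])"
    if u: "u \<in> smooth_functions M" and v: "v \<in> smooth_functions M" and w: "w \<in> smooth_functions M" for u v w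
  proof -
    note m = sL[OF v u] smooth_functions_mult[OF M u sG[OF v]] smooth_functions_mult[OF M v sG[OF u]]
    note a = smooth_functions_add[OF M m(1,2)]
    have LB: "L [B u v, w] = L [L [u, v], w] + (u * L [\<Gamma> [v], w] + \<Gamma> [v] * L [u, w]) - (v * L [\<Gamma> [u], w] + \<Gamma> [u] * L [v, w])"
      unfolding B derivation_diff[OF M dL(1)[OF w] a m(3)] derivation_add[OF dL(1)[OF w] m(1,2)]
        derivation_mult[OF dL(1)[OF w] u sG[OF v]] derivation_mult[OF dL(1)[OF w] v sG[OF u]] ..
    have GB: "\<Gamma> [B u v] = L [\<Gamma> [u], v] - L [\<Gamma> [v], u] + u * \<Gamma> [\<Gamma> [v]] - v * \<Gamma> [\<Gamma> [u]]"
      unfolding B derivation_diff[OF M dG a m(3)] derivation_add[OF dG m(1,2)]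
        derivation_mult[OF dG u sG[OF v]] derivation_mult[OF dG v sG[OF u]] 2
      by (simp add: algebra_simps)
    show ?thesis
      unfolding B[of "B u v" w] LB GB unfolding B[of u v] by (simp add: algebra_simps)
  qed
  have anti: "L [g, f] = - L [f, g]" "L [h, f] = - L [f, h]" "L [h, g] = - L [g, h]"
    by (rule bivector_field_antisym[OF M L f g], rule bivector_field_antisym[OF M L f h],
        rule bivector_field_antisym[OF M L g h])
  have "B (B f g) h - B (B f h) g + B (B g h) f =
      (L [L [f, g], h] - L [L [f, h], g] + L [L [g, h], f])
      - (\<Gamma> [f] * L [g, h] - \<Gamma> [g] * L [f, h] + \<Gamma> [h] * L [f, g])"
    unfolding e[OF f g h] e[OF f h g] e[OF g h f] anti by (simp add: algebra_simps)
  then show ?thesis unfolding 1 by simp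
qed

context
  fixes E :: "('m::{t2_space,second_countable_topology}, 'e::{t2_space,second_countable_topology}) vbundle"
  assumes vb: "vector_bundle E"
begin

section \<open>The dual Lie algebroid and closed sections\<close>

lemma iota_dual_linear: "\<mu> \<in> dual_sections E \<Longrightarrow> iota E \<mu> \<in> linear_functions E"
  by (simp add: linear_functions_def)

lemma proj_surj: "\<exists>e. proj E e = x"
proof -
  obtain U \<phi> \<tau> where x: "x \<in> U" and T: "local_trivialization E (U, \<phi>) \<tau>"
    using trivialization_exists[OF vb] by blast
  show ?thesis by (rule triv_surj[OF vb T x, of 0]) auto
qed

lemma pullback_inject: "g \<circ> proj E = g' \<circ> proj E \<Longrightarrow> g = g'"
  using proj_surj by (metis comp_apply ext)

lemma dual_anchor_eq: "g \<circ> proj E = \<Lambda> [iota E \<mu>, f \<circ> proj E] \<Longrightarrow> dual_anchor E \<Lambda> \<mu> f = g"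
  unfolding dual_anchor_def by (rule the_equality) (auto intro: pullback_inject)

text \<open>The convention that a form is 0 off its own fibre makes \<open>\<mu>\<close> recoverable
  from \<open>iota E \<mu>\<close>; this provides the uniqueness behind the definite description in
  \<open>dual_bracket\<close>.\<close>

lemma dual_sections_inject:
  assumes "\<kappa> \<in> dual_sections E" "\<kappa>' \<in> dual_sections E" "iota E \<kappa> = iota E \<kappa>'"
  shows "\<kappa> = \<kappa>'"
proof (intro ext)
  fix x e show "\<kappa> x e = \<kappa>' x e"
    using assms(1,2) fun_cong[OF assms(3), of e] by (cases "proj E e = x") (auto simp: dual_sections_def iota_def fibre_def)
qed

lemma dual_bracket_eq:
  assumes "\<Lambda> [iota E \<mu>, iota E \<nu>] \<in> linear_functions E"
  shows "dual_bracket E \<Lambda> \<mu> \<nu> \<in> dual_sections E" "iota E (dual_bracket E \<Lambda> \<mu> \<nu>) = \<Lambda> [iota E \<mu>, iota E \<nu>]"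
proof -
  have "\<exists>!\<kappa>. \<kappa> \<in> dual_sections E \<and> iota E \<kappa> = \<Lambda> [iota E \<mu>, iota E \<nu>]"
    using assms dual_sections_inject by (auto simp: linear_functions_def)
  from theI'[OF this] show "dual_bracket E \<Lambda> \<mu> \<nu> \<in> dual_sections E" "iota E (dual_bracket E \<Lambda> \<mu> \<nu>) = \<Lambda> [iota E \<mu>, iota E \<nu>]"
    unfolding dual_bracket_def by blast+
qed

text \<open>Pulled back to the total space, the differential on a pair is
  \<open>\<rho>(\<mu>)\<langle>\<nu>, \<Phi>\<rangle> - \<rho>(\<nu>)\<langle>\<mu>, \<Phi>\<rangle>
  - \<langle>[\<mu>, \<nu>], \<Phi>\<rangle>\<close>, and each pairing is a value of the vertical
  lift. The hypothesis \<open>closed\<close> is thus \<open>[\<Phi>^v, \<Lambda>] = 0\<close> on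
  linear functions, up to antisymmetry; \<open>basic\<close> makes the anchor well defined.\<close>

lemma closed_sectionI:
  assumes \<Phi>: "\<Phi> \<in> sections E" and pair: "\<And>\<mu>. \<mu> \<in> dual_sections E \<Longrightarrow> pairing \<mu> \<Phi> \<in> smooth_functions (base E)"
    and lin: "\<And>h k. h \<in> linear_functions E \<Longrightarrow> k \<in> linear_functions E \<Longrightarrow> \<Lambda> [h, k] \<in> linear_functions E"
    and basic: "\<And>h a. h \<in> linear_functions E \<Longrightarrow> a \<in> basic_functions E \<Longrightarrow> \<Lambda> [h, a] \<in> basic_functions E"
    and closed: "\<And>h k. h \<in> linear_functions E \<Longrightarrow> k \<in> linear_functions E \<Longrightarrow>
      vertical_lift E \<Phi> [\<Lambda> [h, k]] = \<Lambda> [h, vertical_lift E \<Phi> [k]] - \<Lambda> [k, vertical_lift E \<Phi> [h]]"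
  shows "closed_section E \<Lambda> \<Phi>"
  unfolding closed_section_def
proof (intro conjI ballI)
  fix \<mu> \<nu> assume mn: "\<mu> \<in> dual_sections E" "\<nu> \<in> dual_sections E"
  note l = iota_dual_linear[OF mn(1)] iota_dual_linear[OF mn(2)]
  note lift = vertical_lift_iota[OF vb \<Phi>]
  let ?\<kappa> = "dual_bracket E \<Lambda> \<mu> \<nu>"
  note \<kappa> = dual_bracket_eq[of \<Lambda> \<mu> \<nu>, OF lin[OF l]]
  have anchor: "dual_anchor E \<Lambda> \<mu> (pairing \<nu> \<Phi>) \<circ> proj E = \<Lambda> [iota E \<mu>, pairing \<nu> \<Phi> \<circ> proj E]"
    if \<mu>: "\<mu> \<in> dual_sections E" and \<nu>: "\<nu> \<in> dual_sections E" for \<mu> \<nu>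
  proof -
    have "\<Lambda> [iota E \<mu>, pairing \<nu> \<Phi> \<circ> proj E] \<in> basic_functions E"
      using pair[OF \<nu>] by (intro basic iota_dual_linear \<mu>) (simp add: basic_functions_def)
    then obtain g where g: "g \<circ> proj E = \<Lambda> [iota E \<mu>, pairing \<nu> \<Phi> \<circ> proj E]"
      by (auto simp: basic_functions_def)
    have "dual_anchor E \<Lambda> \<mu> (pairing \<nu> \<Phi>) = g" by (rule dual_anchor_eq) (rule g)
    then show ?thesis using g by simp
  qed
  have "lie_algebroid_d E \<Lambda> (\<lambda>\<mu>s. pairing (hd \<mu>s) \<Phi>) [\<mu>, \<nu>] =
      dual_anchor E \<Lambda> \<mu> (pairing \<nu> \<Phi>) - dual_anchor E \<Lambda> \<nu> (pairing \<mu> \<Phi>) - pairing ?\<kappa> \<Phi>"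
    by (auto simp: lie_algebroid_d_def fun_eq_iff nths_Cons eval_nat_numeral)
  then have "lie_algebroid_d E \<Lambda> (\<lambda>\<mu>s. pairing (hd \<mu>s) \<Phi>) [\<mu>, \<nu>] \<circ> proj E =
      (dual_anchor E \<Lambda> \<mu> (pairing \<nu> \<Phi>) \<circ> proj E) - (dual_anchor E \<Lambda> \<nu> (pairing \<mu> \<Phi>) \<circ> proj E) - (pairing ?\<kappa> \<Phi> \<circ> proj E)"
    by (simp add: fun_eq_iff)
  also have "\<dots> = \<Lambda> [iota E \<mu>, vertical_lift E \<Phi> [iota E \<nu>]] - \<Lambda> [iota E \<nu>, vertical_lift E \<Phi> [iota E \<mu>]]
      - vertical_lift E \<Phi> [\<Lambda> [iota E \<mu>, iota E \<nu>]]"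
    unfolding anchor[OF mn] anchor[OF mn(2,1)] lift[OF mn(1)] lift[OF mn(2)] lift[OF \<kappa>(1)] \<kappa>(2)[symmetric] ..
  also have "\<dots> = 0 \<circ> proj E" unfolding closed[OF l] by (simp add: comp_def zero_fun_def)
  finally show "lie_algebroid_d E \<Lambda> (\<lambda>\<mu>s. pairing (hd \<mu>s) \<Phi>) [\<mu>, \<nu>] = 0"
    by (rule pullback_inject)
qed (rule \<Phi>)

text \<open>Stated for an arbitrary field because it is applied twice, to \<open>\<Gamma>\<close>
  and later to \<open>- \<Gamma>0\<close>.\<close>

lemma vertical_lift_of_basic_part:
  assumes X: "vector_field (total E) X"
    and aff: "\<And>h. h \<in> linear_functions E \<Longrightarrow> X [h] \<in> affine_functions E"
  obtains \<Phi> where "\<Phi> \<in> sections E" "\<forall>\<mu>\<in>dual_sections E. pairing \<mu> \<Phi> \<in> smooth_functions (base E)"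
    "\<forall>h\<in>linear_functions E. vertical_lift E \<Phi> [h] \<in> basic_functions E"
    "\<forall>h\<in>linear_functions E. X [h] - vertical_lift E \<Phi> [h] \<in> linear_functions E"
proof -
  obtain \<Phi> where \<Phi>: "\<Phi> \<in> sections E"
    "\<forall>h\<in>linear_functions E. \<exists>g\<in>smooth_functions (base E). (\<forall>x. h (\<Phi> x) = g x) \<and> X [h] - (g \<circ> proj E) \<in> linear_functions E"
    by (rule basic_part_section[OF vb X aff], assumption, rule that)
  have pair: "pairing \<mu> \<Phi> \<in> smooth_functions (base E) \<and> X [iota E \<mu>] - (pairing \<mu> \<Phi> \<circ> proj E) \<in> linear_functions E"
    if \<mu>: "\<mu> \<in> dual_sections E" for \<mu>
  proof -
    obtain g where g: "g \<in> smooth_functions (base E)" "\<forall>x. iota E \<mu> (\<Phi> x) = g x"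
      "X [iota E \<mu>] - (g \<circ> proj E) \<in> linear_functions E"
      using \<Phi>(2) iota_dual_linear[OF \<mu>] by blast
    have "pairing \<mu> \<Phi> = g"
      using g(2) section_proj[OF vb \<Phi>(1)] by (auto simp: pairing_def iota_def fun_eq_iff)
    then show ?thesis using g by simp
  qed
  have "vertical_lift E \<Phi> [h] \<in> basic_functions E \<and> X [h] - vertical_lift E \<Phi> [h] \<in> linear_functions E"
    if h: "h \<in> linear_functions E" for h
  proof -
    obtain \<mu> where \<mu>: "\<mu> \<in> dual_sections E" "h = iota E \<mu>" using h by (auto simp: linear_functions_def)
    show ?thesis
      unfolding \<mu>(2) vertical_lift_iota[OF vb \<Phi>(1) \<mu>(1)] using pair[OF \<mu>(1)] by (auto simp: basic_functions_def)
  qed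
  then show ?thesis using that[OF \<Phi>(1)] pair by blast
qed

end

theorem theorem2:
  fixes E :: "('m::{t2_space,second_countable_topology},
               'e::{t2_space,second_countable_topology}) vbundle"
    and J :: "'e multivector \<times> 'e multivector"
  assumes vb: "vector_bundle E" "rank E > 0"
    and jacobi: "jacobi_structure (total E) J"
    and linear: "\<And>f g. f \<in> linear_functions E \<Longrightarrow> g \<in> linear_functions E \<Longrightarrow>
                   jacobi_bracket J f g \<in> linear_functions E"
    and affine: "\<And>f g. f \<in> affine_functions E \<Longrightarrow> g \<in> affine_functions E \<Longrightarrow>
                   jacobi_bracket J f g \<in> affine_functions E"
  shows "\<exists>\<Lambda> \<Gamma> \<Gamma>0 \<Gamma>1.
    J = (\<Lambda> + wedge 1 \<Gamma> (liouville E), \<Gamma>) \<and>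
    linear_poisson_tensor E \<Lambda> \<and>
    affine_vector_field E \<Gamma> \<and>
    \<Gamma> = \<Gamma>0 + \<Gamma>1 \<and>
    homogeneous_vector_field E (-1) \<Gamma>0 \<and>
    homogeneous_vector_field E 0 \<Gamma>1 \<and>
    schouten 1 2 \<Gamma>0 \<Lambda> = 0 \<and>
    schouten 1 2 \<Gamma>1 \<Lambda> = wedge 1 \<Gamma>0 \<Gamma>1 \<and>
    (\<exists>\<Phi>. closed_section E \<Lambda> \<Phi> \<and> \<Gamma>0 = vertical_lift E \<Phi>) \<and>
    ((\<forall>f\<in>linear_functions E. \<forall>g\<in>basic_functions E. jacobi_bracket J f g \<in> basic_functions E) \<longrightarrow>
       \<Gamma>1 = 0 \<and>
       (\<exists>\<Phi>. closed_section E \<Lambda> \<Phi> \<and>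
            J = (\<Lambda> + wedge 1 (liouville E) (vertical_lift E \<Phi>), - vertical_lift E \<Phi>)))"
proof -
  let ?Lin = "linear_functions E" and ?Bas = "basic_functions E" and ?Aff = "affine_functions E"
  let ?S = "smooth_functions (total E)" and ?\<Delta> = "liouville E"
  note tM = total_manifold[OF vb(1)]
  obtain L \<Gamma> where J: "J = (L, \<Gamma>)" by (cases J)
  have L: "bivector_field (total E) L" and G: "vector_field (total E) \<Gamma>" and GL: "schouten 1 2 \<Gamma> L = 0"
    using jacobi by (auto simp: jacobi_structure_def J)
  note dL = bivector_field_derivation[OF L] and dG = vector_field_derivation[OF G]
  note D = liouville_vector_field[OF vb(1)]
  note D_lin = liouville_of_linear[OF vb(1)] and D_bas = liouville_of_basic[OF vb(1)]
  note lin_S = linear_smooth[OF vb(1)] and bas_S = basic_smooth[OF vb(1)]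
  have jb: "jacobi_bracket J f g = L [f, g] + f * \<Gamma> [g] - g * \<Gamma> [f]" for f g
    by (simp add: jacobi_bracket_def J)
  have one: "1 \<in> ?Bas" using basic_const[OF vb(1), of 1] by (simp add: one_fun_def)
  have bas0: "0 \<in> ?Bas" using basic_const[OF vb(1), of 0] by (simp add: zero_fun_def)
  have G1: "\<Gamma> [1] = 0" using derivation_const[OF tM dG, of 1] by (simp add: one_fun_def)
  have G_aff: "\<Gamma> [f] \<in> ?Aff" if f: "f \<in> ?Aff" for f
  proof -
    have "L [1, f] = 0"
      using derivation_const[OF tM dL(1)[OF affine_smooth[OF vb(1) f]], of 1] by (simp add: one_fun_def)
    then have "jacobi_bracket J 1 f = \<Gamma> [f]" by (simp add: jb G1)
    then show ?thesis using affine[OF basic_affine[OF vb(1) one] f] by simp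
  qed
  obtain \<Phi> where \<Phi>: "\<Phi> \<in> sections E" "\<forall>\<mu>\<in>dual_sections E. pairing \<mu> \<Phi> \<in> smooth_functions (base E)"
    "\<forall>h\<in>?Lin. vertical_lift E \<Phi> [h] \<in> ?Bas" "\<forall>h\<in>?Lin. \<Gamma> [h] - vertical_lift E \<Phi> [h] \<in> ?Lin"
    by (rule vertical_lift_of_basic_part[OF vb(1) G G_aff[OF linear_affine[OF vb(1)]]], assumption, rule that)
  define \<Gamma>0 where "\<Gamma>0 = vertical_lift E \<Phi>"
  define \<Gamma>1 where "\<Gamma>1 = \<Gamma> - \<Gamma>0"
  define \<Lambda> where "\<Lambda> = L - wedge 1 \<Gamma> ?\<Delta>"
  have G_eq: "\<Gamma> = \<Gamma>0 + \<Gamma>1" and G_app: "\<Gamma> fs = \<Gamma>0 fs + \<Gamma>1 fs" for fs by (auto simp: \<Gamma>1_def)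
  have V0: "vector_field (total E) \<Gamma>0" unfolding \<Gamma>0_def by (rule vertical_lift_vector_field[OF vb(1) \<Phi>(1)])
  have V1: "vector_field (total E) \<Gamma>1" unfolding \<Gamma>1_def by (rule vector_field_diff[OF tM G V0])
  have \<Gamma>0: "\<Gamma>0 [h] \<in> ?Bas" and \<Gamma>1: "\<Gamma>1 [h] \<in> ?Lin" if "h \<in> ?Lin" for h
    using \<Phi>(3,4) that by (auto simp: \<Gamma>0_def \<Gamma>1_def)
  have \<Gamma>0_bas: "\<Gamma>0 [a] = 0" if "a \<in> ?Bas" for a
    using that vertical_lift_basic[OF vb(1) \<Phi>(1)] by (auto simp: basic_functions_def \<Gamma>0_def)
  have \<Lambda>_biv: "bivector_field (total E) \<Lambda>"
    unfolding \<Lambda>_def by (intro bivector_field_diff[OF tM L] wedge_bivector_field[OF tM G D])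
  note d\<Lambda> = bivector_field_derivation[OF \<Lambda>_biv] and anti = bivector_field_antisym[OF tM \<Lambda>_biv]
  have \<Lambda>_app: "\<Lambda> [f, g] = L [f, g] - (\<Gamma> [f] * ?\<Delta> [g] - \<Gamma> [g] * ?\<Delta> [f])" for f g
    unfolding \<Lambda>_def minus_apply wedge_1_1 ..
  have \<Lambda>_jb: "\<Lambda> [f, g] = jacobi_bracket J f g" if "f \<in> ?Lin" "g \<in> ?Lin" for f g
    using that by (simp add: \<Lambda>_app jb D_lin algebra_simps)
  have \<Lambda>_lin: "\<Lambda> [f, g] \<in> ?Lin" if "f \<in> ?Lin" "g \<in> ?Lin" for f g
    using linear[OF that] \<Lambda>_jb[OF that] by simp
  have \<Lambda>_bas: "\<Lambda> [f, b] \<in> ?Bas" if f: "f \<in> ?Lin" and b: "b \<in> ?Bas" for f b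
  proof -
    have "\<Lambda> [f, b] = jacobi_bracket J f b + b * \<Gamma> [f]"
      using f b by (simp add: \<Lambda>_app jb D_lin D_bas algebra_simps)
    moreover have "jacobi_bracket J f b + b * \<Gamma> [f] \<in> ?Aff"
      using f b by (intro affine_add[OF vb(1)] affine basic_mult_affine[OF vb(1)] G_aff linear_affine[OF vb(1)] basic_affine[OF vb(1)])
    ultimately have "\<Lambda> [f, b] \<in> ?Aff" by simp
    then obtain a l where al: "a \<in> ?Bas" "l \<in> ?Lin" "\<Lambda> [f, b] = a + l"
      using affine_functionsE[OF vb(1)] by blast
    \<comment> \<open>The product \<open>b * l\<close> is linear, so both brackets with linear
      functions below are linear. The product rule then expresses \<open>l * l\<close> through
      linear functions, which forces \<open>l = 0\<close>.\<close>
    have "\<Lambda> [f, b * l] = b * \<Lambda> [f, l] + l * \<Lambda> [f, b]"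
      by (rule derivation_mult[OF d\<Lambda>(2)[OF lin_S[OF f]] bas_S[OF b] lin_S[OF al(2)]])
    then have "l * l = \<Lambda> [f, b * l] - b * \<Lambda> [f, l] - a * l"
      unfolding al(3) by (simp add: algebra_simps)
    moreover have "\<Lambda> [f, b * l] - b * \<Lambda> [f, l] - a * l \<in> ?Lin"
      using f b al by (intro linear_diff[OF vb(1)] basic_mult_linear[OF vb(1)] \<Lambda>_lin)
    ultimately have "l = 0" using square_linear_eq_0[OF vb(1) al(2)] by simp
    then show ?thesis using al by simp
  qed
  have Poisson: "schouten 2 2 \<Lambda> \<Lambda> = 0"
  proof (rule schouten_2_2_eq_0[OF vb \<Lambda>_biv])
    fix f g h assume fgh: "f \<in> ?Lin" "g \<in> ?Lin" "h \<in> ?Lin"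
    have "\<Lambda> [\<Lambda> [f, g], h] - \<Lambda> [\<Lambda> [f, h], g] + \<Lambda> [\<Lambda> [g, h], f] = 0"
      using jacobi_bracket_identity[OF tM jacobi[unfolded J] lin_S[OF fgh(1)] lin_S[OF fgh(2)] lin_S[OF fgh(3)]]
        fgh \<Lambda>_lin by (simp add: \<Lambda>_jb J)
    then have "(\<Lambda> [\<Lambda> [f, g], h] - \<Lambda> [\<Lambda> [f, h], g] + \<Lambda> [\<Lambda> [g, h], f]) p = 0" for p by simp
    then show "schouten 2 2 \<Lambda> \<Lambda> [f, g, h] = 0"
      unfolding schouten_2_2 by (simp add: fun_eq_iff)
  qed
  text \<open>On linear functions \<open>[\<Gamma>, \<Lambda>] = \<Gamma>0 \<and> \<Gamma>1\<close>. Since \<open>[\<Gamma>0, \<Lambda>](f, g)\<close> is basic, while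
    \<open>[\<Gamma>1, \<Lambda>](f, g)\<close> and \<open>(\<Gamma>0 \<and> \<Gamma>1)(f, g)\<close> are linear, the identity splits.\<close>
  have split: "schouten 1 2 \<Gamma>0 \<Lambda> [f, g] = 0 \<and> schouten 1 2 \<Gamma>1 \<Lambda> [f, g] = wedge 1 \<Gamma>0 \<Gamma>1 [f, g]"
    if f: "f \<in> ?Lin" and g: "g \<in> ?Lin" for f g
  proof -
    \<comment> \<open>The Liouville field kills the basic part of \<open>\<Gamma> [h]\<close> and
      fixes the linear part.\<close>
    have D_G: "?\<Delta> [\<Gamma> [h]] = \<Gamma>1 [h]" if "h \<in> ?Lin" for h
      using derivation_add[OF vector_field_derivation[OF D] bas_S[OF \<Gamma>0[OF that]] lin_S[OF \<Gamma>1[OF that]]]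
        D_bas[OF \<Gamma>0[OF that]] D_lin[OF \<Gamma>1[OF that]] by (simp add: G_app)
    note S = lin_S[OF f] lin_S[OF g] derivation_smooth[OF dG lin_S[OF f]] derivation_smooth[OF dG lin_S[OF g]]
    note S' = smooth_functions_mult[OF tM S(3) S(2)] smooth_functions_mult[OF tM S(4) S(1)]
    have GL': "\<Gamma> [L [f, g]] = L [\<Gamma> [f], g] - L [\<Gamma> [g], f]"
      using fun_cong[OF GL, of "[f, g]"] unfolding schouten_1_2 by (simp add: algebra_simps)
    have "\<Gamma> [\<Lambda> [f, g]] = \<Gamma> [L [f, g]] - (\<Gamma> [\<Gamma> [f] * g] - \<Gamma> [\<Gamma> [g] * f])"
      unfolding \<Lambda>_app D_lin[OF f] D_lin[OF g]
        derivation_diff[OF tM dG derivation_smooth[OF dL(1)[OF S(2)] S(1)] smooth_functions_diff[OF tM S']]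
        derivation_diff[OF tM dG S'] ..
    also have "\<dots> = L [\<Gamma> [f], g] - L [\<Gamma> [g], f] - g * \<Gamma> [\<Gamma> [f]] + f * \<Gamma> [\<Gamma> [g]]"
      unfolding GL' derivation_mult[OF dG S(3,2)] derivation_mult[OF dG S(4,1)] by (simp add: algebra_simps)
    finally have "schouten 1 2 \<Gamma> \<Lambda> [f, g] = \<Gamma> [f] * \<Gamma>1 [g] - \<Gamma> [g] * \<Gamma>1 [f]"
      unfolding schouten_1_2 \<Lambda>_app[of "\<Gamma> [f]"] \<Lambda>_app[of "\<Gamma> [g]"] D_lin[OF f] D_lin[OF g] D_G[OF f] D_G[OF g]
      by (simp add: algebra_simps)
    \<comment> \<open>The expression is \<open>(\<Gamma> \<and> \<Gamma>1)(f, g)\<close>, and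
      \<open>\<Gamma>1 \<and> \<Gamma>1 = 0\<close>.\<close>
    also have "\<dots> = wedge 1 \<Gamma>0 \<Gamma>1 [f, g]"
      unfolding wedge_1_1 by (simp add: G_app algebra_simps)
    finally have sum: "schouten 1 2 \<Gamma> \<Lambda> [f, g] = wedge 1 \<Gamma>0 \<Gamma>1 [f, g]" .
    note b = bas_S[OF \<Gamma>0[OF f]] bas_S[OF \<Gamma>0[OF g]] and l = lin_S[OF \<Gamma>1[OF f]] lin_S[OF \<Gamma>1[OF g]]
    have "\<Lambda> [\<Gamma> [f], g] = \<Lambda> [\<Gamma>0 [f], g] + \<Lambda> [\<Gamma>1 [f], g]" "\<Lambda> [\<Gamma> [g], f] = \<Lambda> [\<Gamma>0 [g], f] + \<Lambda> [\<Gamma>1 [g], f]"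
      unfolding G_app by (rule derivation_add[OF d\<Lambda>(1)[OF S(2)] b(1) l(1)], rule derivation_add[OF d\<Lambda>(1)[OF S(1)] b(2) l(2)])
    then have parts: "schouten 1 2 \<Gamma> \<Lambda> [f, g] = schouten 1 2 \<Gamma>0 \<Lambda> [f, g] + schouten 1 2 \<Gamma>1 \<Lambda> [f, g]"
      unfolding schouten_1_2 by (simp add: G_app algebra_simps)
    have eq: "schouten 1 2 \<Gamma>0 \<Lambda> [f, g] = wedge 1 \<Gamma>0 \<Gamma>1 [f, g] - schouten 1 2 \<Gamma>1 \<Lambda> [f, g]"
      unfolding eq_diff_eq by (rule trans[OF parts[symmetric] sum])
    \<comment> \<open>The basic argument is moved to the second place, where
      \<open>\<Lambda>_bas\<close> applies.\<close>
    have "\<Lambda> [\<Gamma>0 [f], g] = - \<Lambda> [g, \<Gamma>0 [f]]" "\<Lambda> [\<Gamma>0 [g], f] = - \<Lambda> [f, \<Gamma>0 [g]]"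
      by (rule anti[OF S(2) b(1)], rule anti[OF S(1) b(2)])
    then have "schouten 1 2 \<Gamma>0 \<Lambda> [f, g] = \<Gamma>0 [\<Lambda> [f, g]] + \<Lambda> [g, \<Gamma>0 [f]] - \<Lambda> [f, \<Gamma>0 [g]]"
      unfolding schouten_1_2 by simp
    then have bas: "schouten 1 2 \<Gamma>0 \<Lambda> [f, g] \<in> ?Bas"
      using f g by (auto intro!: basic_add[OF vb(1)] basic_diff[OF vb(1)] \<Gamma>0 \<Lambda>_bas \<Lambda>_lin)
    have "wedge 1 \<Gamma>0 \<Gamma>1 [f, g] - schouten 1 2 \<Gamma>1 \<Lambda> [f, g] \<in> ?Lin"
      unfolding schouten_1_2 wedge_1_1 using f g
      by (intro linear_diff[OF vb(1)] linear_add[OF vb(1)] basic_mult_linear[OF vb(1)] \<Gamma>0 \<Gamma>1 \<Lambda>_lin)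
    then have "schouten 1 2 \<Gamma>0 \<Lambda> [f, g] = 0"
      using basic_linear_eq_0[OF vb(1) bas] eq by simp
    then show ?thesis using eq by simp
  qed
  have S0: "schouten 1 2 \<Gamma>0 \<Lambda> = 0"
    by (rule bivector_field_eq_0[OF vb schouten_bivector_field[OF tM V0 \<Lambda>_biv]]) (use split in blast)
  have "schouten 1 2 \<Gamma>1 \<Lambda> - wedge 1 \<Gamma>0 \<Gamma>1 = 0"
    by (rule bivector_field_eq_0[OF vb bivector_field_diff[OF tM schouten_bivector_field[OF tM V1 \<Lambda>_biv]
        wedge_bivector_field[OF tM V0 V1]]]) (use split in \<open>simp only: minus_apply diff_self\<close>)
  then have S1: "schouten 1 2 \<Gamma>1 \<Lambda> = wedge 1 \<Gamma>0 \<Gamma>1" by simp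
  \<comment> \<open>On linear \<open>h\<close> the value \<open>\<Gamma>0 [h]\<close> is basic,
    hence killed by \<open>\<Delta>\<close>, and only
    \<open>- \<Gamma>0 [\<Delta> [h]] = - \<Gamma>0 [h]\<close> survives.\<close>
  have "schouten 1 1 ?\<Delta> \<Gamma>0 = - \<Gamma>0"
  proof (rule vector_field_eqI[OF vb schouten_vector_field[OF tM D V0] vector_field_uminus[OF tM V0]])
    fix h assume h: "h \<in> ?Lin"
    show "schouten 1 1 ?\<Delta> \<Gamma>0 [h] = (- \<Gamma>0) [h]"
      unfolding schouten_1_1 D_lin[OF h] D_bas[OF \<Gamma>0[OF h]] by simp
  qed
  then have H0: "homogeneous_vector_field E (-1) \<Gamma>0"
    using V0 by (simp add: homogeneous_vector_field_def fun_eq_iff)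
  have "schouten 1 1 ?\<Delta> \<Gamma>1 = 0"
  proof (rule vector_field_eq_0[OF vb schouten_vector_field[OF tM D V1]])
    fix h assume h: "h \<in> ?Lin"
    show "schouten 1 1 ?\<Delta> \<Gamma>1 [h] = 0"
      unfolding schouten_1_1 D_lin[OF h] D_lin[OF \<Gamma>1[OF h]] by simp
  qed
  then have H1: "homogeneous_vector_field E 0 \<Gamma>1"
    using V1 by (simp add: homogeneous_vector_field_def fun_eq_iff)
  have S0': "\<Gamma>0 [\<Lambda> [h, k]] = \<Lambda> [h, \<Gamma>0 [k]] - \<Lambda> [k, \<Gamma>0 [h]]" if h: "h \<in> ?Lin" and k: "k \<in> ?Lin" for h k
  proof -
    have "\<Lambda> [\<Gamma>0 [h], k] = - \<Lambda> [k, \<Gamma>0 [h]]" "\<Lambda> [\<Gamma>0 [k], h] = - \<Lambda> [h, \<Gamma>0 [k]]"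
      by (rule anti[OF lin_S[OF k] bas_S[OF \<Gamma>0[OF h]]], rule anti[OF lin_S[OF h] bas_S[OF \<Gamma>0[OF k]]])
    then show ?thesis
      using fun_cong[OF S0, of "[h, k]"] unfolding schouten_1_2 by (simp add: algebra_simps)
  qed
  have closed: "closed_section E \<Lambda> \<Phi>"
    by (rule closed_sectionI[OF vb(1) \<Phi>(1)]) (use \<Phi>(2) \<Lambda>_lin \<Lambda>_bas S0' in \<open>auto simp: \<Gamma>0_def\<close>)
  have J_eq: "J = (\<Lambda> + wedge 1 \<Gamma> ?\<Delta>, \<Gamma>)" by (simp add: J \<Lambda>_def)
  have homogeneous: "\<Gamma>1 = 0 \<and> (\<exists>\<Psi>. closed_section E \<Lambda> \<Psi> \<and>
      J = (\<Lambda> + wedge 1 ?\<Delta> (vertical_lift E \<Psi>), - vertical_lift E \<Psi>))"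
    if hyp: "\<forall>f\<in>?Lin. \<forall>g\<in>?Bas. jacobi_bracket J f g \<in> ?Bas"
  proof -
    have "\<Gamma>1 = 0"
    proof (rule vector_field_eq_0[OF vb V1])
      fix h assume h: "h \<in> ?Lin"
      \<comment> \<open>The hypothesis is tested on the basic function 1: it makes
        \<open>\<Gamma> [h]\<close> basic, so the linear function \<open>\<Gamma>1 [h]\<close> is
        basic as well.\<close>
      have "L [h, 1] = 0"
        using derivation_const[OF tM dL(2)[OF lin_S[OF h]], of 1] by (simp add: one_fun_def)
      then have "jacobi_bracket J h 1 = - \<Gamma> [h]" by (simp add: jb G1)
      then have "- \<Gamma> [h] \<in> ?Bas" using hyp h one by force
      then have "0 - (- \<Gamma> [h]) - \<Gamma>0 [h] \<in> ?Bas"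
        using bas0 h by (intro basic_diff[OF vb(1)] \<Gamma>0)
      then have "\<Gamma>1 [h] \<in> ?Bas" by (simp add: \<Gamma>1_def)
      then show "\<Gamma>1 [h] = 0" by (rule basic_linear_eq_0[OF vb(1) _ \<Gamma>1[OF h]])
    qed
    then have G0: "\<Gamma> = \<Gamma>0" using G_eq by simp
    note VN = vector_field_uminus[OF tM V0]
    have aff: "(- \<Gamma>0) [h] \<in> ?Aff" if "h \<in> ?Lin" for h
    proof -
      have "0 - \<Gamma>0 [h] \<in> ?Bas"
        using bas0 \<Gamma>0[OF that] by (rule basic_diff[OF vb(1)])
      then show ?thesis using basic_affine[OF vb(1)] by simp
    qed
    \<comment> \<open>The final form carries the opposite sign, so the section wanted is the
      negative of \<open>\<Phi>\<close>. Extracting it from the field \<open>- \<Gamma>0\<close>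
      yields its smoothness without constructing a negative in the fibres.\<close>
    obtain \<Psi> where \<Psi>: "\<Psi> \<in> sections E" "\<forall>\<mu>\<in>dual_sections E. pairing \<mu> \<Psi> \<in> smooth_functions (base E)"
      "\<forall>h\<in>?Lin. vertical_lift E \<Psi> [h] \<in> ?Bas" "\<forall>h\<in>?Lin. (- \<Gamma>0) [h] - vertical_lift E \<Psi> [h] \<in> ?Lin"
      by (rule vertical_lift_of_basic_part[OF vb(1) VN aff], assumption, rule that)
    have V: "vertical_lift E \<Psi> = - \<Gamma>0"
    proof (rule vector_field_eqI[OF vb vertical_lift_vector_field[OF vb(1) \<Psi>(1)] VN])
      fix h assume h: "h \<in> ?Lin"
      have "0 - \<Gamma>0 [h] - vertical_lift E \<Psi> [h] \<in> ?Bas"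
        using bas0 \<Gamma>0[OF h] \<Psi>(3) h by (intro basic_diff[OF vb(1)]) blast+
      moreover have "0 - \<Gamma>0 [h] - vertical_lift E \<Psi> [h] \<in> ?Lin" using \<Psi>(4) h by simp
      ultimately have "0 - \<Gamma>0 [h] - vertical_lift E \<Psi> [h] = 0" by (rule basic_linear_eq_0[OF vb(1)])
      then show "vertical_lift E \<Psi> [h] = (- \<Gamma>0) [h]" by simp
    qed
    have "closed_section E \<Lambda> \<Psi>"
    proof (rule closed_sectionI[OF vb(1) \<Psi>(1)])
      fix h k assume h: "h \<in> ?Lin" and k: "k \<in> ?Lin"
      have "\<Lambda> [h, - \<Gamma>0 [k]] = - \<Lambda> [h, \<Gamma>0 [k]]" "\<Lambda> [k, - \<Gamma>0 [h]] = - \<Lambda> [k, \<Gamma>0 [h]]"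
        by (rule derivation_uminus[OF d\<Lambda>(2)[OF lin_S[OF h]] bas_S[OF \<Gamma>0[OF k]]],
            rule derivation_uminus[OF d\<Lambda>(2)[OF lin_S[OF k]] bas_S[OF \<Gamma>0[OF h]]])
      then show "vertical_lift E \<Psi> [\<Lambda> [h, k]] = \<Lambda> [h, vertical_lift E \<Psi> [k]] - \<Lambda> [k, vertical_lift E \<Psi> [h]]"
        unfolding V using S0'[OF h k] by simp
    qed (use \<Psi>(2) \<Lambda>_lin \<Lambda>_bas in auto)
    \<comment> \<open>Here \<open>\<Gamma> \<and> \<Delta> = \<Delta> \<and> (- \<Gamma>)\<close>.
      The identity is immediate on pairs of functions; uniqueness extends it to all argument lists,
      as equality of fields demands.\<close>
    moreover have "wedge 1 \<Gamma> ?\<Delta> - wedge 1 ?\<Delta> (- \<Gamma>0) = 0"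
    proof (rule bivector_field_eq_0[OF vb bivector_field_diff[OF tM wedge_bivector_field[OF tM G D] wedge_bivector_field[OF tM D VN]]])
      fix h k
      show "(wedge 1 \<Gamma> ?\<Delta> - wedge 1 ?\<Delta> (- \<Gamma>0)) [h, k] = 0"
        unfolding minus_apply wedge_1_1 by (simp add: G0 fun_eq_iff algebra_simps)
    qed
    ultimately show ?thesis
      using \<open>\<Gamma>1 = 0\<close> J_eq G0 V by (intro conjI exI[of _ \<Psi>]) auto
  qed
  have poisson: "linear_poisson_tensor E \<Lambda>"
    using \<Lambda>_biv Poisson \<Lambda>_lin by (simp add: linear_poisson_tensor_def poisson_tensor_def)
  have aff: "affine_vector_field E \<Gamma>"
    using G G_aff by (simp add: affine_vector_field_def)
  show ?thesis
    by (rule exI[of _ \<Lambda>], rule exI[of _ \<Gamma>], rule exI[of _ \<Gamma>0], rule exI[of _ \<Gamma>1])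
      (intro conjI J_eq poisson aff G_eq H0 H1 S0 S1 exI[of _ \<Phi>] closed \<Gamma>0_def impI[OF homogeneous])
qed

end
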